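(* Let $q$ be a primitive cubic root of unity and let $\mathcal A=\mathcal O(\widetilde{\rm GL}_q(2))$. There exist left covariant $\mathbb Z_3$-graded first order differential calculi $(\Omega^1,{\sf d})$ over $\mathcal A$ (with respect to $\mathcal A$ itself) such that $\{{\sf d}a,{\sf d}\beta,{\sf d}\gamma,{\sf d}d\}$ is a free right $\mathcal A$-module basis of $\Omega^1$. Precisely, for every $P_1\in\{q,q^2\}$ and every $P_2\in\{1,q^2\}$, each of the following two systems of relations (Case I and Case II) determines the bimodule structure of such a calculus. Case I: \begin{align*} a\cdot {\sf d}a &= P_1\,{\sf d}a\cdot a, \quad a\cdot {\sf d}\beta = {\sf d}\beta\cdot a + (q^2P_2-1)\,{\sf d}a\cdot\beta,\\ a\cdot {\sf d}\gamma &= q^2P_1^{-1}\,{\sf d}\gamma\cdot a + q(1-qP_1)\,{\sf d}a\cdot\gamma,\\ a\cdot {\sf d}d &= {\sf d}d\cdot a + (q^2P_2-1)\,{\sf d}a\cdot d + (q-1)\,{\sf d}\beta\cdot\gamma,\\ \beta\cdot {\sf d}a &= P_2\,{\sf d}a\cdot \beta, \quad \beta\cdot {\sf d}\beta = P_2\,{\sf d}\beta\cdot\beta, \quad \beta\cdot {\sf d}\gamma = P_2\,{\sf d}\gamma\cdot\beta,\\ \beta\cdot {\sf d}d &= P_2^{-1}\,{\sf d}d\cdot\beta + q^2(1-P_2)\,{\sf d}\beta\cdot d,\\ \gamma\cdot {\sf d}a &= P_1^{-1}\,{\sf d}a\cdot\gamma + (q-P_1)\,{\sf d}\gamma\cdot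 a, \quad \gamma\cdot {\sf d}\gamma = q^2 P_1\,{\sf d}\gamma\cdot\gamma,\\ \gamma\cdot {\sf d}\beta &= q^2\,{\sf d}\beta\cdot\gamma + q(P_2-q)\,{\sf d}\gamma\cdot\beta, \quad \gamma\cdot {\sf d}d = {\sf d}d\cdot\gamma + q(P_2-q)\,{\sf d}\gamma\cdot d,\\ d\cdot {\sf d}a &= q^2P_2\,{\sf d}a\cdot d + (q^2-1)P_2\,{\sf d}\gamma\cdot\beta, \quad d\cdot {\sf d}\gamma = qP_2\,{\sf d}\gamma\cdot d,\\ d\cdot {\sf d}\beta &= P_2^{-1}\,{\sf d}\beta\cdot d + (q^2-P_2)\,{\sf d}d\cdot\beta, \quad d\cdot {\sf d}d = q^2 P_2\,{\sf d}d\cdot d. \end{align*} Case II: \begin{align*} a\cdot {\sf d}a &= P_1\,{\sf d}a\cdot a, \quad a\cdot {\sf d}\gamma = q^2P_1^{-1}\,{\sf d}\gamma\cdot a + q(1-qP_1)\,{\sf d}a\cdot\gamma,\\ a\cdot {\sf d}\beta &= P_1\,{\sf d}\beta\cdot a, \quad a\cdot {\sf d}d = P_1\,{\sf d}d\cdot a + (q-1)P_1\,{\sf d}\beta\cdot\gamma,\\ \beta\cdot {\sf d}a &= q\,{\sf d}a\cdot \beta + q(P_1-1)\,{\sf d}\beta\cdot a, \quad \beta\cdot {\sf d}\beta = P_2\,{\sf d}\beta\cdot\beta,\\ \beta\cdot{\sf d}\gamma &= q\,{\sf d}\gamma\cdot\beta + q(P_1-1)\,{\sf d}\beta\cdot\gamma,\\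 \beta\cdot{\sf d}d &= P_2^{-1}\,{\sf d}d\cdot\beta + q^2(1-P_2)\,{\sf d}\beta\cdot d,\\ \gamma\cdot{\sf d}a &= P_1^{-1}\,{\sf d}a\cdot\gamma + (q-P_1)\,{\sf d}\gamma\cdot a, \quad \gamma\cdot {\sf d}\beta = q^2P_1\,{\sf d}\beta\cdot\gamma,\\ \gamma\cdot{\sf d}\gamma &= q^2P_1\,{\sf d}\gamma\cdot\gamma, \quad \gamma\cdot{\sf d}d = P_1\,{\sf d}d\cdot\gamma,\\ d\cdot{\sf d}a &= {\sf d}a\cdot d + (1-q)\,{\sf d}\gamma\cdot\beta + (P_1-1)\,{\sf d}d\cdot a,\\ d\cdot{\sf d}\beta &= P_2^{-1}\,{\sf d}\beta\cdot d + (q^2 - P_2)\,{\sf d}d\cdot\beta,\\ d\cdot{\sf d}\gamma &= q^2\,{\sf d}\gamma\cdot d + (P_1-1)\,{\sf d}d\cdot\gamma, \quad d\cdot {\sf d}d = q^2P_2\,{\sf d}d\cdot d. \end{align*}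
   Context: The algebra. $\mathcal O(\widetilde M_q(2))$ is the unital associative $\mathbb C$-algebra generated by $a,\beta,\gamma,d$ with relations $$a\beta=\beta a,\quad a\gamma=q\gamma a,\quad \beta\gamma=\gamma\beta,\quad d\gamma=q^2\gamma d,\quad \beta d=d\beta,\quad ad=da+(q-1)\beta\gamma .$$ It is $\mathbb Z_3$-graded by $p(a)=p(d)=0$, $p(\gamma)=1$, $p(\beta)=2$. The element $\mathcal D_q=ad-q\beta\gamma=da-\beta\gamma$ (grade 0) is central, and $\mathcal A=\mathcal O(\widetilde{\rm GL}_q(2))=\mathcal O(\widetilde M_q(2))[t]/\langle t\mathcal D_q-1\rangle$, i.e. $\mathcal D_q$ is inverted. Here $d$ denotes a generator and ${\sf d}$ the differential. Graded tensor products. For $\mathbb Z_3$-graded algebras or bimodules, products on tensor products use $(x_1\otimes y_1)(x_2\otimes y_2)=q^{p(y_1)p(x_2)}x_1x_2\otimes y_1y_2$ for homogeneous elements. $\mathcal A$ is a $\mathbb Z_3$-graded Hopf algebra whose coproduct is the algebra homomorphism $\Delta:\mathcal A\to\mathcal A\otimes\mathcal A$ (with this product) given by $\Delta(t_{ij})=\sum_{k=1}^2t_{ik}\otimes t_{kj}$, where $t_{11}=a,t_{12}=\beta,t_{21}=\gamma,t_{22}=d$, and counit $\epsilon(t_{ij})=\delta_{ij}$. A $\mathbb Z_3$-graded first order differential calculus over $\mathcal A$ is a $\mathbb Z_3$-graded $\mathcal A$-bimodule $\Omega^1$, generated as a bimodule by the differentials of the generators, together with a linear map ${\sf d}:\mathcal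 A\to\Omega^1$ raising the grade $p$ by $1$ (so $p({\sf d}a)=p({\sf d}d)=1$, $p({\sf d}\beta)=0$, $p({\sf d}\gamma)=2$) and satisfying ${\sf d}(fg)=({\sf d}f)\cdot g+q^{p(f)}f\cdot{\sf d}g$ for homogeneous $f\in\mathcal A$ and all $g\in\mathcal A$. It is left covariant (with respect to $\mathcal A$) if there is a linear map $\Delta_L:\Omega^1\to\mathcal A\otimes\Omega^1$ which is a left coaction of $\mathcal A$ on $\Omega^1$ such that $\Delta_L(fwg)=\Delta(f)\Delta_L(w)\Delta(g)$ for all $f,g\in\mathcal A$, $w\in\Omega^1$, and $\Delta_L\circ{\sf d}=(\tau'\otimes{\sf d})\circ\Delta$, where $\tau'(f)=q^{p(f)}f$ for homogeneous $f\in\mathcal A$. *)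

theory Defs
  imports
    Complex_Main
    "HOL-Library.Poly_Mapping"
    "HOL-Library.Product_Plus"
begin

section \<open>Complex vector spaces and complex algebras\<close>

class complex_space = ab_group_add +
  fixes scaleC :: "complex \<Rightarrow> 'a \<Rightarrow> 'a" (infixr \<open>*\<^sub>C\<close> 75)
  assumes scaleC_add_right: "c *\<^sub>C (x + y) = c *\<^sub>C x + c *\<^sub>C y"
    and scaleC_add_left: "(c + c') *\<^sub>C x = c *\<^sub>C x + c' *\<^sub>C x"
    and scaleC_scaleC: "c *\<^sub>C c' *\<^sub>C x = (c * c') *\<^sub>C x"
    and scaleC_one: "1 *\<^sub>C x = x"

global_interpretation complex_space: vector_space "scaleC :: complex \<Rightarrow> 'a \<Rightarrow> 'a::complex_space"
  defines cspan = complex_space.span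
    and csubspace = complex_space.subspace
  by unfold_locales (rule scaleC_add_right scaleC_add_left scaleC_scaleC scaleC_one)+

abbreviation clinear :: "('a::complex_space \<Rightarrow> 'b::complex_space) \<Rightarrow> bool"
  where "clinear \<equiv> Vector_Spaces.linear scaleC scaleC"

class complex_algebra_1 = complex_space + ring_1 +
  assumes scaleC_mult_left: "(c *\<^sub>C x) * y = c *\<^sub>C (x * y)"
    and scaleC_mult_right: "x * (c *\<^sub>C y) = c *\<^sub>C (x * y)"

instantiation complex :: complex_algebra_1
begin
definition scaleC_complex :: "complex \<Rightarrow> complex \<Rightarrow> complex"
  where "scaleC_complex c x = c * x"
instance by standard (simp_all add: scaleC_complex_def algebra_simps)
end

instantiation prod :: (complex_space, complex_space) complex_space
begin
definition scaleC_prod :: "complex \<Rightarrow> 'a \<times> 'b \<Rightarrow> 'a \<times> 'b"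
  where "scaleC_prod c x = (c *\<^sub>C fst x, c *\<^sub>C snd x)"
instance
  by standard (simp_all add: scaleC_prod_def prod_eq_iff scaleC_add_right scaleC_add_left
      scaleC_scaleC scaleC_one)
end

instantiation poly_mapping :: (type, complex_space) complex_space
begin
definition scaleC_poly_mapping :: "complex \<Rightarrow> ('a \<Rightarrow>\<^sub>0 'b) \<Rightarrow> ('a \<Rightarrow>\<^sub>0 'b)"
  where "scaleC_poly_mapping c = Poly_Mapping.map (scaleC c)"

lemma lookup_scaleC: "Poly_Mapping.lookup (c *\<^sub>C f) x = c *\<^sub>C Poly_Mapping.lookup f x"
  for f :: "'a \<Rightarrow>\<^sub>0 'b"
  by (simp add: scaleC_poly_mapping_def Poly_Mapping.map.rep_eq when_def)

instance
  by standard (simp_all add: poly_mapping_eq_iff fun_eq_iff lookup_scaleC lookup_add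
      scaleC_add_right scaleC_add_left scaleC_scaleC scaleC_one)
end


section \<open>The tensor product of complex vector spaces\<close>

text \<open>The free vector space on pairs modulo the subspace spanned by the bilinearity relators.\<close>

definition tensor_relators :: "(('a::complex_space \<times> 'b::complex_space) \<Rightarrow>\<^sub>0 complex) set"
  where "tensor_relators =
     {Poly_Mapping.single (x + x', y) 1 - Poly_Mapping.single (x, y) 1
        - Poly_Mapping.single (x', y) 1 | x x' y. True}
   \<union> {Poly_Mapping.single (x, y + y') 1 - Poly_Mapping.single (x, y) 1
        - Poly_Mapping.single (x, y') 1 | x y y'. True}
   \<union> {Poly_Mapping.single (c *\<^sub>C x, y) 1 - c *\<^sub>C Poly_Mapping.single (x, y) 1 | c x y. True}
   \<union> {Poly_Mapping.single (x, c *\<^sub>C y) 1 - c *\<^sub>C Poly_Mapping.single (x, y) 1 | c x y. True}"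

definition tensor_rel ::
    "(('a::complex_space \<times> 'b::complex_space) \<Rightarrow>\<^sub>0 complex) \<Rightarrow> (('a \<times> 'b) \<Rightarrow>\<^sub>0 complex) \<Rightarrow> bool"
  where "tensor_rel u v \<longleftrightarrow> u - v \<in> cspan tensor_relators"

lemma equivp_tensor_rel:
  "equivp (tensor_rel :: (('a::complex_space \<times> 'b::complex_space) \<Rightarrow>\<^sub>0 complex) \<Rightarrow> _)" (is "equivp ?R")
proof (rule equivpI)
  show "reflp ?R"
    by (auto intro!: reflpI simp: tensor_rel_def complex_space.span_zero)
  show "symp ?R"
  proof (rule sympI)
    fix x y :: "('a \<times> 'b) \<Rightarrow>\<^sub>0 complex"
    assume "tensor_rel x y"
    then have "- (x - y) \<in> cspan tensor_relators"
      unfolding tensor_rel_def by (rule complex_space.span_neg)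
    then show "tensor_rel y x" by (simp add: tensor_rel_def)
  qed
  show "transp ?R"
  proof (rule transpI)
    fix x y z :: "('a \<times> 'b) \<Rightarrow>\<^sub>0 complex"
    assume "tensor_rel x y" "tensor_rel y z"
    then have "(x - y) + (y - z) \<in> cspan tensor_relators"
      unfolding tensor_rel_def by (rule complex_space.span_add)
    then show "tensor_rel x z" by (simp add: tensor_rel_def)
  qed
qed

quotient_type (overloaded) ('a, 'b) tensor =
  "(('a::complex_space \<times> 'b::complex_space) \<Rightarrow>\<^sub>0 complex)" / tensor_rel
  by (rule equivp_tensor_rel)

instantiation tensor :: (complex_space, complex_space) complex_space
begin

lift_definition zero_tensor :: "('a, 'b) tensor" is 0 .

lift_definition plus_tensor :: "('a, 'b) tensor \<Rightarrow> ('a, 'b) tensor \<Rightarrow> ('a, 'b) tensor" is "(+)"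
  unfolding tensor_rel_def by (drule (1) complex_space.span_add) (simp add: algebra_simps)

lift_definition uminus_tensor :: "('a, 'b) tensor \<Rightarrow> ('a, 'b) tensor" is uminus
  unfolding tensor_rel_def by (drule complex_space.span_neg) simp

lift_definition minus_tensor :: "('a, 'b) tensor \<Rightarrow> ('a, 'b) tensor \<Rightarrow> ('a, 'b) tensor" is "(-)"
  unfolding tensor_rel_def by (drule (1) complex_space.span_diff) (simp add: algebra_simps)

lift_definition scaleC_tensor :: "complex \<Rightarrow> ('a, 'b) tensor \<Rightarrow> ('a, 'b) tensor" is scaleC
  unfolding tensor_rel_def
  by (drule complex_space.span_scale) (simp add: complex_space.scale_right_diff_distrib)

instance
proof
  fix x y z :: "('a, 'b) tensor" and c c' :: complex
  have R: "tensor_rel u v" if "u = v" for u v :: "('a \<times> 'b) \<Rightarrow>\<^sub>0 complex"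
    using that by (simp add: tensor_rel_def complex_space.span_zero)
  show "x + y + z = x + (y + z)" by transfer (rule R, simp add: add.assoc)
  show "x + y = y + x" by transfer (rule R, simp add: add.commute)
  show "0 + x = x" by transfer (rule R, simp)
  show "- x + x = 0" by transfer (rule R, simp)
  show "x - y = x + - y" by transfer (rule R, simp)
  show "c *\<^sub>C (x + y) = c *\<^sub>C x + c *\<^sub>C y" by transfer (rule R, rule scaleC_add_right)
  show "(c + c') *\<^sub>C x = c *\<^sub>C x + c' *\<^sub>C x" by transfer (rule R, rule scaleC_add_left)
  show "c *\<^sub>C c' *\<^sub>C x = (c * c') *\<^sub>C x" by transfer (rule R, rule scaleC_scaleC)
  show "1 *\<^sub>C x = x" by transfer (rule R, rule scaleC_one)
qed

end

lift_definition tens :: "'a::complex_space \<Rightarrow> 'b::complex_space \<Rightarrow> ('a, 'b) tensor"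
    (infixr \<open>\<otimes>\<close> 76)
  is "\<lambda>x y. Poly_Mapping.single (x, y) 1" .

definition bilinear :: "('a::complex_space \<Rightarrow> 'b::complex_space \<Rightarrow> 'c::complex_space) \<Rightarrow> bool"
  where "bilinear f \<longleftrightarrow> (\<forall>x. clinear (f x)) \<and> (\<forall>y. clinear (\<lambda>x. f x y))"

text \<open>The linear map on the tensor product induced by a bilinear map \<open>f\<close>
  (characterised by \<open>tensor_lift_tens\<close> and \<open>clinear_tensor_lift\<close> below).\<close>

definition tensor_lift ::
    "('a::complex_space \<Rightarrow> 'b::complex_space \<Rightarrow> 'c::complex_space) \<Rightarrow> ('a, 'b) tensor \<Rightarrow> 'c"
  where "tensor_lift f u =
    (\<Sum>(x, y) \<in> Poly_Mapping.keys (rep_tensor u).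
        Poly_Mapping.lookup (rep_tensor u) (x, y) *\<^sub>C f x y)"

definition tensor_map ::
    "('a::complex_space \<Rightarrow> 'c::complex_space) \<Rightarrow> ('b::complex_space \<Rightarrow> 'd::complex_space)
      \<Rightarrow> ('a, 'b) tensor \<Rightarrow> ('c, 'd) tensor"
  where "tensor_map f h = tensor_lift (\<lambda>x y. f x \<otimes> h y)"

definition tensor_assoc ::
    "(('a::complex_space, 'b::complex_space) tensor, 'c::complex_space) tensor
      \<Rightarrow> ('a, ('b, 'c) tensor) tensor"
  where "tensor_assoc = tensor_lift (\<lambda>u z. tensor_lift (\<lambda>x y. x \<otimes> (y \<otimes> z)) u)"

context
  fixes f :: "'a::complex_space \<Rightarrow> 'b::complex_space \<Rightarrow> 'c::complex_space"
begin

private definition ext :: "(('a \<times> 'b) \<Rightarrow>\<^sub>0 complex) \<Rightarrow> 'c"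
  where "ext p = (\<Sum>z \<in> Poly_Mapping.keys p. Poly_Mapping.lookup p z *\<^sub>C f (fst z) (snd z))"

private lemma ext_superset:
  "finite K \<Longrightarrow> Poly_Mapping.keys p \<subseteq> K \<Longrightarrow>
    ext p = (\<Sum>z \<in> K. Poly_Mapping.lookup p z *\<^sub>C f (fst z) (snd z))"
  unfolding ext_def by (rule sum.mono_neutral_left) (auto simp: in_keys_iff)

private lemma ext_add: "ext (p + p') = ext p + ext p'"
proof -
  let ?K = "Poly_Mapping.keys p \<union> Poly_Mapping.keys p'"
  have "ext (p + p') = (\<Sum>z\<in>?K. Poly_Mapping.lookup (p + p') z *\<^sub>C f (fst z) (snd z))"
    by (rule ext_superset) (use Poly_Mapping.keys_add[of p p'] in auto)
  moreover have "ext p = (\<Sum>z\<in>?K. Poly_Mapping.lookup p z *\<^sub>C f (fst z) (snd z))"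
    by (rule ext_superset) auto
  moreover have "ext p' = (\<Sum>z\<in>?K. Poly_Mapping.lookup p' z *\<^sub>C f (fst z) (snd z))"
    by (rule ext_superset) auto
  ultimately show ?thesis
    by (simp add: lookup_add scaleC_add_left sum.distrib)
qed

private lemma ext_scale: "ext (c *\<^sub>C p) = c *\<^sub>C ext p"
proof -
  have "ext (c *\<^sub>C p)
      = (\<Sum>z\<in>Poly_Mapping.keys p. Poly_Mapping.lookup (c *\<^sub>C p) z *\<^sub>C f (fst z) (snd z))"
    by (rule ext_superset) (auto simp: in_keys_iff lookup_scaleC)
  then show ?thesis
    by (simp add: ext_def lookup_scaleC complex_space.scale_sum_right scaleC_scaleC
        scaleC_complex_def)
qed

private lemma ext_diff: "ext (p - p') = ext p - ext p'"
  by (metis add_diff_cancel diff_add_cancel ext_add)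

private lemma ext_single: "ext (Poly_Mapping.single z 1) = f (fst z) (snd z)"
  by (simp add: ext_def scaleC_one)

private lemma ext_rel:
  assumes f: "bilinear f" and "tensor_rel p p'"
  shows "ext p = ext p'"
proof -
  have lin: "f (x + x') y = f x y + f x' y" "f (c *\<^sub>C x) y = c *\<^sub>C f x y"
    "f x (y + y') = f x y + f x y'" "f x (c *\<^sub>C y) = c *\<^sub>C f x y" for x x' y y' c
    using f by (auto simp: bilinear_def Vector_Spaces.linear_iff)
  have "ext r = 0" if "r \<in> tensor_relators" for r
    using that unfolding tensor_relators_def
    by (auto simp: ext_diff ext_scale ext_single lin)
  moreover have "csubspace {r. ext r = 0}"
    by (rule complex_space.subspaceI) (auto simp: ext_add ext_scale, simp add: ext_def)
  ultimately have "cspan tensor_relators \<subseteq> {r. ext r = 0}"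
    by (intro complex_space.span_minimal) auto
  then show ?thesis
    using assms(2) by (auto simp: tensor_rel_def ext_diff)
qed

private lemma tensor_lift_abs: "bilinear f \<Longrightarrow> tensor_lift f (abs_tensor p) = ext p"
proof -
  assume f: "bilinear f"
  have "tensor_rel (rep_tensor (abs_tensor p)) p"
    by (metis Quotient3_rep_abs Quotient3_tensor equivp_tensor_rel equivp_reflp)
  then have "ext (rep_tensor (abs_tensor p)) = ext p"
    by (rule ext_rel[OF f])
  then show ?thesis
    by (simp add: tensor_lift_def ext_def case_prod_unfold)
qed

lemma tensor_lift_tens: "bilinear f \<Longrightarrow> tensor_lift f (x \<otimes> y) = f x y"
  unfolding tens.abs_eq by (simp add: tensor_lift_abs ext_single)

lemma clinear_tensor_lift:
  assumes "bilinear f"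
  shows "clinear (tensor_lift f)"
proof -
  have "tensor_lift f (u + v) = tensor_lift f u + tensor_lift f v" for u v
    by (induct u rule: tensor.abs_induct; induct v rule: tensor.abs_induct)
      (simp add: plus_tensor.abs_eq tensor_lift_abs assms ext_add)
  moreover have "tensor_lift f (c *\<^sub>C u) = c *\<^sub>C tensor_lift f u" for c u
    by (induct u rule: tensor.abs_induct) (simp add: scaleC_tensor.abs_eq tensor_lift_abs assms ext_scale)
  ultimately show ?thesis
    by (simp add: Vector_Spaces.linear_iff complex_space.vector_space_axioms)
qed

end


section \<open>Gradings by the integers modulo 3\<close>

text \<open>Degrees are represented by \<open>0\<close>, \<open>1\<close>, \<open>2\<close>; only these indices of a grading matter.\<close>

definition decomposes :: "(nat \<Rightarrow> 'v::complex_space set) \<Rightarrow> 'v \<Rightarrow> (nat \<Rightarrow> 'v) \<Rightarrow> bool"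
  where "decomposes G x c \<longleftrightarrow>
    (\<forall>i<3. c i \<in> G i) \<and> (\<forall>i\<ge>3. c i = 0) \<and> (\<Sum>i<3. c i) = x"

definition Z3_grading :: "(nat \<Rightarrow> 'v::complex_space set) \<Rightarrow> bool"
  where "Z3_grading G \<longleftrightarrow> (\<forall>i<3. csubspace (G i)) \<and> (\<forall>x. \<exists>!c. decomposes G x c)"

definition component :: "(nat \<Rightarrow> 'v::complex_space set) \<Rightarrow> nat \<Rightarrow> 'v \<Rightarrow> 'v"
  where "component G i x = (THE c. decomposes G x c) i"

text \<open>The bilinear map \<open>V\<^sub>1 \<otimes> W\<^sub>1 \<times> V\<^sub>2 \<otimes> W\<^sub>2 \<rightarrow> V\<^sub>3 \<otimes> W\<^sub>3\<close> sending
  \<open>(x\<^sub>1 \<otimes> y\<^sub>1, x\<^sub>2 \<otimes> y\<^sub>2)\<close> to \<open>q ^ (p(y\<^sub>1) p(x\<^sub>2)) m(x\<^sub>1, x\<^sub>2) \<otimes> n(y\<^sub>1, y\<^sub>2)\<close> for homogeneous elements,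
  where \<open>GW\<close> and \<open>GV\<close> are the gradings of \<open>W\<^sub>1\<close> and \<open>V\<^sub>2\<close>.\<close>

definition graded_mult ::
    "complex \<Rightarrow> (nat \<Rightarrow> 'w1 set) \<Rightarrow> (nat \<Rightarrow> 'v2 set)
      \<Rightarrow> ('v1 \<Rightarrow> 'v2 \<Rightarrow> 'v3) \<Rightarrow> ('w1 \<Rightarrow> 'w2 \<Rightarrow> 'w3)
      \<Rightarrow> ('v1::complex_space, 'w1::complex_space) tensor
      \<Rightarrow> ('v2::complex_space, 'w2::complex_space) tensor
      \<Rightarrow> ('v3::complex_space, 'w3::complex_space) tensor"
  where "graded_mult q GW GV m n s u =
    tensor_lift (\<lambda>x\<^sub>1 y\<^sub>1. tensor_lift (\<lambda>x\<^sub>2 y\<^sub>2.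
      (\<Sum>i<3. \<Sum>j<3. q ^ (i * j) *\<^sub>C
         (m x\<^sub>1 (component GV j x\<^sub>2) \<otimes> n (component GW i y\<^sub>1) y\<^sub>2))) u) s"


section \<open>The algebra\<close>

text \<open>The constructors of \<open>gen\<close> stand for \<open>a\<close>, \<open>\<beta>\<close>, \<open>\<gamma>\<close>, \<open>d\<close>. The letter \<open>Inv\<close> is the central variable \<open>t\<close>
  adjoined to the matrix algebra as the inverse of the quantum determinant \<open>a d - q \<beta> \<gamma>\<close>.\<close>

datatype gen = Gen_a | Gen_b | Gen_c | Gen_d

lemma UNIV_gen: "UNIV = {Gen_a, Gen_b, Gen_c, Gen_d}"
  by (auto intro: gen.exhaust)

instance gen :: finite
  by standard (simp add: UNIV_gen)

datatype letter = Gen gen | Inv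

fun deg :: "letter \<Rightarrow> nat" where
  "deg (Gen Gen_a) = 0"
| "deg (Gen Gen_b) = 2"
| "deg (Gen Gen_c) = 1"
| "deg (Gen Gen_d) = 0"
| "deg Inv = 0"

text \<open>Words are written additively, so that finitely supported functions on them form
  the free unital associative algebra (with the convolution product).\<close>

datatype word = Word (letters: "letter list")

instantiation word :: monoid_add
begin
definition zero_word :: word where "zero_word = Word []"
definition plus_word :: "word \<Rightarrow> word \<Rightarrow> word"
  where "plus_word v w = Word (letters v @ letters w)"
instance by standard (simp_all add: zero_word_def plus_word_def)
end

type_synonym free_algebra = "word \<Rightarrow>\<^sub>0 complex"

definition var :: "letter \<Rightarrow> free_algebra"
  where "var l = Poly_Mapping.single (Word [l]) 1"

definition evaluate :: "(letter \<Rightarrow> 'a::complex_algebra_1) \<Rightarrow> free_algebra \<Rightarrow> 'a"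
  where "evaluate g f =
    (\<Sum>w \<in> Poly_Mapping.keys f. Poly_Mapping.lookup f w *\<^sub>C prod_list (map g (letters w)))"

inductive_set ideal_generated :: "'r::ring_1 set \<Rightarrow> 'r set" for R where
  zero: "0 \<in> ideal_generated R"
| gen: "r \<in> R \<Longrightarrow> r \<in> ideal_generated R"
| add: "x \<in> ideal_generated R \<Longrightarrow> y \<in> ideal_generated R \<Longrightarrow> x + y \<in> ideal_generated R"
| mult: "x \<in> ideal_generated R \<Longrightarrow> s * x * t \<in> ideal_generated R"

definition GLq2_relators :: "complex \<Rightarrow> free_algebra set"
  where "GLq2_relators q =
    (let a = var (Gen Gen_a); \<beta> = var (Gen Gen_b); \<gamma> = var (Gen Gen_c); d = var (Gen Gen_d);
         t = var Inv
     in {a * \<beta> - \<beta> * a, a * \<gamma> - q *\<^sub>C (\<gamma> * a), \<beta> * \<gamma> - \<gamma> * \<beta>,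
         d * \<gamma> - q\<^sup>2 *\<^sub>C (\<gamma> * d), \<beta> * d - d * \<beta>,
         a * d - (d * a + (q - 1) *\<^sub>C (\<beta> * \<gamma>)),
         t * a - a * t, t * \<beta> - \<beta> * t, t * \<gamma> - \<gamma> * t, t * d - d * t,
         t * (a * d - q *\<^sub>C (\<beta> * \<gamma>)) - 1})"

text \<open>\<open>is_GLq2 q g\<close>: the algebra \<open>'a\<close>, with the images \<open>g l\<close> of the letters, is the algebra
  presented by \<open>GLq2_relators q\<close>, that is, \<open>g\<close> induces an isomorphism of the quotient of
  the free algebra by the ideal of relators onto \<open>'a\<close>. As \<open>q\<close> is a variable the algebra
  is given by this presentation rather than as one fixed type; a model for each
  primitive cubic root of unity \<open>q\<close> is constructed at the end of this theory (\<open>GLq2_model\<close>).\<close>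

definition is_GLq2 :: "complex \<Rightarrow> (letter \<Rightarrow> 'a::complex_algebra_1) \<Rightarrow> bool"
  where "is_GLq2 q g \<longleftrightarrow>
    surj (evaluate g) \<and> {f. evaluate g f = 0} = ideal_generated (GLq2_relators q)"

definition GL_grade :: "(letter \<Rightarrow> 'a::complex_algebra_1) \<Rightarrow> nat \<Rightarrow> 'a set"
  where "GL_grade g i =
    cspan {prod_list (map g ls) | ls. sum_list (map deg ls) mod 3 = i}"

definition tmat :: "(letter \<Rightarrow> 'a) \<Rightarrow> nat \<Rightarrow> nat \<Rightarrow> 'a"
  where "tmat g i j =
    g (Gen (if i = 1 then (if j = 1 then Gen_a else Gen_b) else (if j = 1 then Gen_c else Gen_d)))"

definition is_coproduct ::
    "complex \<Rightarrow> (letter \<Rightarrow> 'a::complex_algebra_1) \<Rightarrow> ('a \<Rightarrow> ('a, 'a) tensor) \<Rightarrow> bool"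
  where "is_coproduct q g \<Delta> \<longleftrightarrow>
    clinear \<Delta> \<and> \<Delta> 1 = 1 \<otimes> 1 \<and>
    (\<forall>x y. \<Delta> (x * y) = graded_mult q (GL_grade g) (GL_grade g) (*) (*) (\<Delta> x) (\<Delta> y)) \<and>
    (\<forall>i\<in>{1, 2}. \<forall>j\<in>{1, 2}. \<Delta> (tmat g i j) = (\<Sum>k\<in>{1, 2}. tmat g i k \<otimes> tmat g k j))"

definition is_counit :: "(letter \<Rightarrow> 'a::complex_algebra_1) \<Rightarrow> ('a \<Rightarrow> complex) \<Rightarrow> bool"
  where "is_counit g \<epsilon> \<longleftrightarrow>
    clinear \<epsilon> \<and> \<epsilon> 1 = 1 \<and> (\<forall>x y. \<epsilon> (x * y) = \<epsilon> x * \<epsilon> y) \<and>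
    (\<forall>i\<in>{1, 2}. \<forall>j\<in>{1, 2}. \<epsilon> (tmat g i j) = (if i = j then 1 else 0))"

definition grade_twist :: "complex \<Rightarrow> (letter \<Rightarrow> 'a::complex_algebra_1) \<Rightarrow> 'a \<Rightarrow> 'a"
  where "grade_twist q g f = (\<Sum>i<3. q ^ i *\<^sub>C component (GL_grade g) i f)"


section \<open>First order differential calculi\<close>

text \<open>The differential is written \<open>\<delta>\<close> because \<open>d\<close> is a generator.\<close>

record ('a, 'w) calculus =
  lact :: "'a \<Rightarrow> 'w \<Rightarrow> 'w" (infixr \<open>\<rhd>\<index>\<close> 78)
  ract :: "'w \<Rightarrow> 'a \<Rightarrow> 'w" (infixl \<open>\<lhd>\<index>\<close> 79)
  diff :: "'a \<Rightarrow> 'w" (\<open>\<delta>\<index> _\<close> [90] 90)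
  grade :: "nat \<Rightarrow> 'w set"

definition bimodule :: "('a::complex_algebra_1, 'w::complex_space) calculus \<Rightarrow> bool"
  where "bimodule \<Omega> \<longleftrightarrow>
    bilinear (lact \<Omega>) \<and> bilinear (ract \<Omega>) \<and>
    (\<forall>w. lact \<Omega> 1 w = w) \<and> (\<forall>w. ract \<Omega> w 1 = w) \<and>
    (\<forall>x y w. lact \<Omega> (x * y) w = lact \<Omega> x (lact \<Omega> y w)) \<and>
    (\<forall>x y w. ract \<Omega> w (x * y) = ract \<Omega> (ract \<Omega> w x) y) \<and>
    (\<forall>x y w. ract \<Omega> (lact \<Omega> x w) y = lact \<Omega> x (ract \<Omega> w y))"

inductive_set subbimodule_generated ::
    "('a::complex_algebra_1, 'w::complex_space) calculus \<Rightarrow> 'w set \<Rightarrow> 'w set"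
  for \<Omega> S where
  zero: "0 \<in> subbimodule_generated \<Omega> S"
| gen: "w \<in> S \<Longrightarrow> w \<in> subbimodule_generated \<Omega> S"
| add: "v \<in> subbimodule_generated \<Omega> S \<Longrightarrow> w \<in> subbimodule_generated \<Omega> S
    \<Longrightarrow> v + w \<in> subbimodule_generated \<Omega> S"
| act: "w \<in> subbimodule_generated \<Omega> S
    \<Longrightarrow> ract \<Omega> (lact \<Omega> x w) y \<in> subbimodule_generated \<Omega> S"

definition graded_calculus ::
    "complex \<Rightarrow> (letter \<Rightarrow> 'a::complex_algebra_1) \<Rightarrow> ('a, 'w::complex_space) calculus \<Rightarrow> bool"
  where "graded_calculus q g \<Omega> \<longleftrightarrow>
    bimodule \<Omega> \<and>
    Z3_grading (grade \<Omega>) \<and>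
    (\<forall>i<3. \<forall>j<3. \<forall>f \<in> GL_grade g i. \<forall>w \<in> grade \<Omega> j.
        lact \<Omega> f w \<in> grade \<Omega> ((i + j) mod 3) \<and> ract \<Omega> w f \<in> grade \<Omega> ((i + j) mod 3)) \<and>
    subbimodule_generated \<Omega> (range (\<lambda>x. diff \<Omega> (g (Gen x)))) = UNIV \<and>
    clinear (diff \<Omega>) \<and>
    (\<forall>i<3. \<forall>f \<in> GL_grade g i. diff \<Omega> f \<in> grade \<Omega> ((i + 1) mod 3)) \<and>
    (\<forall>i<3. \<forall>f \<in> GL_grade g i. \<forall>h.
        diff \<Omega> (f * h) = ract \<Omega> (diff \<Omega> f) h + q ^ i *\<^sub>C lact \<Omega> f (diff \<Omega> h))"

definition left_coaction ::
    "('a::complex_algebra_1 \<Rightarrow> ('a, 'a) tensor) \<Rightarrow> ('a \<Rightarrow> complex)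
      \<Rightarrow> ('w::complex_space \<Rightarrow> ('a, 'w) tensor) \<Rightarrow> bool"
  where "left_coaction \<Delta> \<epsilon> \<Delta>\<^sub>L \<longleftrightarrow>
    (\<forall>w. tensor_assoc (tensor_map \<Delta> id (\<Delta>\<^sub>L w)) = tensor_map id \<Delta>\<^sub>L (\<Delta>\<^sub>L w)) \<and>
    (\<forall>w. tensor_lift (\<lambda>x v. \<epsilon> x *\<^sub>C v) (\<Delta>\<^sub>L w) = w)"

text \<open>There is at most one coproduct and one counit in the sense of \<open>is_coproduct\<close> and
  \<open>is_counit\<close>, so the existential quantifiers over \<open>\<Delta>\<close> and \<open>\<epsilon>\<close> refer to the
  structure maps of the graded Hopf algebra.\<close>

definition left_covariant ::
    "complex \<Rightarrow> (letter \<Rightarrow> 'a::complex_algebra_1) \<Rightarrow> ('a, 'w::complex_space) calculus \<Rightarrow> bool"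
  where "left_covariant q g \<Omega> \<longleftrightarrow>
    (\<exists>\<Delta> \<epsilon> \<Delta>\<^sub>L. is_coproduct q g \<Delta> \<and> is_counit g \<epsilon> \<and>
       clinear \<Delta>\<^sub>L \<and> left_coaction \<Delta> \<epsilon> \<Delta>\<^sub>L \<and>
       (\<forall>f w h. \<Delta>\<^sub>L (ract \<Omega> (lact \<Omega> f w) h) =
          graded_mult q (grade \<Omega>) (GL_grade g) (*) (ract \<Omega>)
            (graded_mult q (GL_grade g) (GL_grade g) (*) (lact \<Omega>) (\<Delta> f) (\<Delta>\<^sub>L w))
            (\<Delta> h)) \<and>
       (\<forall>f. \<Delta>\<^sub>L (diff \<Omega> f) = tensor_map (grade_twist q g) (diff \<Omega>) (\<Delta> f)))"

definition differentials_right_basis ::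
    "(letter \<Rightarrow> 'a::complex_algebra_1) \<Rightarrow> ('a, 'w::complex_space) calculus \<Rightarrow> bool"
  where "differentials_right_basis g \<Omega> \<longleftrightarrow>
    (\<forall>w. \<exists>!c :: gen \<Rightarrow> 'a. w = (\<Sum>x\<in>UNIV. ract \<Omega> (diff \<Omega> (g (Gen x))) (c x)))"

definition calculus_iso ::
    "('a::complex_algebra_1, 'w::complex_space) calculus
      \<Rightarrow> ('a, 'v::complex_space) calculus \<Rightarrow> ('w \<Rightarrow> 'v) \<Rightarrow> bool"
  where "calculus_iso \<Omega> \<Omega>' \<phi> \<longleftrightarrow>
    clinear \<phi> \<and> bij \<phi> \<and>
    (\<forall>x w. \<phi> (lact \<Omega> x w) = lact \<Omega>' x (\<phi> w)) \<and>
    (\<forall>x w. \<phi> (ract \<Omega> w x) = ract \<Omega>' (\<phi> w) x) \<and>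
    (\<forall>x. \<phi> (diff \<Omega> x) = diff \<Omega>' x) \<and>
    (\<forall>i<3. \<phi> ` grade \<Omega> i = grade \<Omega>' i)"


section \<open>The two systems of relations\<close>

definition case_I ::
    "complex \<Rightarrow> complex \<Rightarrow> complex \<Rightarrow> (letter \<Rightarrow> 'a::complex_algebra_1)
      \<Rightarrow> ('a, 'w::complex_space) calculus \<Rightarrow> bool"
  where "case_I q P\<^sub>1 P\<^sub>2 g \<Omega> \<longleftrightarrow>
   (let a = g (Gen Gen_a); \<beta> = g (Gen Gen_b); \<gamma> = g (Gen Gen_c); d = g (Gen Gen_d) in
      a \<rhd>\<^bsub>\<Omega>\<^esub> \<delta>\<^bsub>\<Omega>\<^esub> a = P\<^sub>1 *\<^sub>C (\<delta>\<^bsub>\<Omega>\<^esub> a \<lhd>\<^bsub>\<Omega>\<^esub> a)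
    \<and> a \<rhd>\<^bsub>\<Omega>\<^esub> \<delta>\<^bsub>\<Omega>\<^esub> \<beta> = \<delta>\<^bsub>\<Omega>\<^esub> \<beta> \<lhd>\<^bsub>\<Omega>\<^esub> a + (q\<^sup>2 * P\<^sub>2 - 1) *\<^sub>C (\<delta>\<^bsub>\<Omega>\<^esub> a \<lhd>\<^bsub>\<Omega>\<^esub> \<beta>)
    \<and> a \<rhd>\<^bsub>\<Omega>\<^esub> \<delta>\<^bsub>\<Omega>\<^esub> \<gamma> = (q\<^sup>2 * inverse P\<^sub>1) *\<^sub>C (\<delta>\<^bsub>\<Omega>\<^esub> \<gamma> \<lhd>\<^bsub>\<Omega>\<^esub> a)
        + (q * (1 - q * P\<^sub>1)) *\<^sub>C (\<delta>\<^bsub>\<Omega>\<^esub> a \<lhd>\<^bsub>\<Omega>\<^esub> \<gamma>)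
    \<and> a \<rhd>\<^bsub>\<Omega>\<^esub> \<delta>\<^bsub>\<Omega>\<^esub> d = \<delta>\<^bsub>\<Omega>\<^esub> d \<lhd>\<^bsub>\<Omega>\<^esub> a + (q\<^sup>2 * P\<^sub>2 - 1) *\<^sub>C (\<delta>\<^bsub>\<Omega>\<^esub> a \<lhd>\<^bsub>\<Omega>\<^esub> d)
        + (q - 1) *\<^sub>C (\<delta>\<^bsub>\<Omega>\<^esub> \<beta> \<lhd>\<^bsub>\<Omega>\<^esub> \<gamma>)
    \<and> \<beta> \<rhd>\<^bsub>\<Omega>\<^esub> \<delta>\<^bsub>\<Omega>\<^esub> a = P\<^sub>2 *\<^sub>C (\<delta>\<^bsub>\<Omega>\<^esub> a \<lhd>\<^bsub>\<Omega>\<^esub> \<beta>)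
    \<and> \<beta> \<rhd>\<^bsub>\<Omega>\<^esub> \<delta>\<^bsub>\<Omega>\<^esub> \<beta> = P\<^sub>2 *\<^sub>C (\<delta>\<^bsub>\<Omega>\<^esub> \<beta> \<lhd>\<^bsub>\<Omega>\<^esub> \<beta>)
    \<and> \<beta> \<rhd>\<^bsub>\<Omega>\<^esub> \<delta>\<^bsub>\<Omega>\<^esub> \<gamma> = P\<^sub>2 *\<^sub>C (\<delta>\<^bsub>\<Omega>\<^esub> \<gamma> \<lhd>\<^bsub>\<Omega>\<^esub> \<beta>)
    \<and> \<beta> \<rhd>\<^bsub>\<Omega>\<^esub> \<delta>\<^bsub>\<Omega>\<^esub> d = inverse P\<^sub>2 *\<^sub>C (\<delta>\<^bsub>\<Omega>\<^esub> d \<lhd>\<^bsub>\<Omega>\<^esub> \<beta>)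
        + (q\<^sup>2 * (1 - P\<^sub>2)) *\<^sub>C (\<delta>\<^bsub>\<Omega>\<^esub> \<beta> \<lhd>\<^bsub>\<Omega>\<^esub> d)
    \<and> \<gamma> \<rhd>\<^bsub>\<Omega>\<^esub> \<delta>\<^bsub>\<Omega>\<^esub> a = inverse P\<^sub>1 *\<^sub>C (\<delta>\<^bsub>\<Omega>\<^esub> a \<lhd>\<^bsub>\<Omega>\<^esub> \<gamma>) + (q - P\<^sub>1) *\<^sub>C (\<delta>\<^bsub>\<Omega>\<^esub> \<gamma> \<lhd>\<^bsub>\<Omega>\<^esub> a)
    \<and> \<gamma> \<rhd>\<^bsub>\<Omega>\<^esub> \<delta>\<^bsub>\<Omega>\<^esub> \<gamma> = (q\<^sup>2 * P\<^sub>1) *\<^sub>C (\<delta>\<^bsub>\<Omega>\<^esub> \<gamma> \<lhd>\<^bsub>\<Omega>\<^esub> \<gamma>)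
    \<and> \<gamma> \<rhd>\<^bsub>\<Omega>\<^esub> \<delta>\<^bsub>\<Omega>\<^esub> \<beta> = q\<^sup>2 *\<^sub>C (\<delta>\<^bsub>\<Omega>\<^esub> \<beta> \<lhd>\<^bsub>\<Omega>\<^esub> \<gamma>) + (q * (P\<^sub>2 - q)) *\<^sub>C (\<delta>\<^bsub>\<Omega>\<^esub> \<gamma> \<lhd>\<^bsub>\<Omega>\<^esub> \<beta>)
    \<and> \<gamma> \<rhd>\<^bsub>\<Omega>\<^esub> \<delta>\<^bsub>\<Omega>\<^esub> d = \<delta>\<^bsub>\<Omega>\<^esub> d \<lhd>\<^bsub>\<Omega>\<^esub> \<gamma> + (q * (P\<^sub>2 - q)) *\<^sub>C (\<delta>\<^bsub>\<Omega>\<^esub> \<gamma> \<lhd>\<^bsub>\<Omega>\<^esub> d)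
    \<and> d \<rhd>\<^bsub>\<Omega>\<^esub> \<delta>\<^bsub>\<Omega>\<^esub> a = (q\<^sup>2 * P\<^sub>2) *\<^sub>C (\<delta>\<^bsub>\<Omega>\<^esub> a \<lhd>\<^bsub>\<Omega>\<^esub> d)
        + ((q\<^sup>2 - 1) * P\<^sub>2) *\<^sub>C (\<delta>\<^bsub>\<Omega>\<^esub> \<gamma> \<lhd>\<^bsub>\<Omega>\<^esub> \<beta>)
    \<and> d \<rhd>\<^bsub>\<Omega>\<^esub> \<delta>\<^bsub>\<Omega>\<^esub> \<gamma> = (q * P\<^sub>2) *\<^sub>C (\<delta>\<^bsub>\<Omega>\<^esub> \<gamma> \<lhd>\<^bsub>\<Omega>\<^esub> d)
    \<and> d \<rhd>\<^bsub>\<Omega>\<^esub> \<delta>\<^bsub>\<Omega>\<^esub> \<beta> = inverse P\<^sub>2 *\<^sub>C (\<delta>\<^bsub>\<Omega>\<^esub> \<beta> \<lhd>\<^bsub>\<Omega>\<^esub> d) + (q\<^sup>2 - P\<^sub>2) *\<^sub>C (\<delta>\<^bsub>\<Omega>\<^esub> d \<lhd>\<^bsub>\<Omega>\<^esub> \<beta>)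
    \<and> d \<rhd>\<^bsub>\<Omega>\<^esub> \<delta>\<^bsub>\<Omega>\<^esub> d = (q\<^sup>2 * P\<^sub>2) *\<^sub>C (\<delta>\<^bsub>\<Omega>\<^esub> d \<lhd>\<^bsub>\<Omega>\<^esub> d))"

definition case_II ::
    "complex \<Rightarrow> complex \<Rightarrow> complex \<Rightarrow> (letter \<Rightarrow> 'a::complex_algebra_1)
      \<Rightarrow> ('a, 'w::complex_space) calculus \<Rightarrow> bool"
  where "case_II q P\<^sub>1 P\<^sub>2 g \<Omega> \<longleftrightarrow>
   (let a = g (Gen Gen_a); \<beta> = g (Gen Gen_b); \<gamma> = g (Gen Gen_c); d = g (Gen Gen_d) in
      a \<rhd>\<^bsub>\<Omega>\<^esub> \<delta>\<^bsub>\<Omega>\<^esub> a = P\<^sub>1 *\<^sub>C (\<delta>\<^bsub>\<Omega>\<^esub> a \<lhd>\<^bsub>\<Omega>\<^esub> a)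
    \<and> a \<rhd>\<^bsub>\<Omega>\<^esub> \<delta>\<^bsub>\<Omega>\<^esub> \<gamma> = (q\<^sup>2 * inverse P\<^sub>1) *\<^sub>C (\<delta>\<^bsub>\<Omega>\<^esub> \<gamma> \<lhd>\<^bsub>\<Omega>\<^esub> a)
        + (q * (1 - q * P\<^sub>1)) *\<^sub>C (\<delta>\<^bsub>\<Omega>\<^esub> a \<lhd>\<^bsub>\<Omega>\<^esub> \<gamma>)
    \<and> a \<rhd>\<^bsub>\<Omega>\<^esub> \<delta>\<^bsub>\<Omega>\<^esub> \<beta> = P\<^sub>1 *\<^sub>C (\<delta>\<^bsub>\<Omega>\<^esub> \<beta> \<lhd>\<^bsub>\<Omega>\<^esub> a)
    \<and> a \<rhd>\<^bsub>\<Omega>\<^esub> \<delta>\<^bsub>\<Omega>\<^esub> d = P\<^sub>1 *\<^sub>C (\<delta>\<^bsub>\<Omega>\<^esub> d \<lhd>\<^bsub>\<Omega>\<^esub> a) + ((q - 1) * P\<^sub>1) *\<^sub>C (\<delta>\<^bsub>\<Omega>\<^esub> \<beta> \<lhd>\<^bsub>\<Omega>\<^esub> \<gamma>)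
    \<and> \<beta> \<rhd>\<^bsub>\<Omega>\<^esub> \<delta>\<^bsub>\<Omega>\<^esub> a = q *\<^sub>C (\<delta>\<^bsub>\<Omega>\<^esub> a \<lhd>\<^bsub>\<Omega>\<^esub> \<beta>) + (q * (P\<^sub>1 - 1)) *\<^sub>C (\<delta>\<^bsub>\<Omega>\<^esub> \<beta> \<lhd>\<^bsub>\<Omega>\<^esub> a)
    \<and> \<beta> \<rhd>\<^bsub>\<Omega>\<^esub> \<delta>\<^bsub>\<Omega>\<^esub> \<beta> = P\<^sub>2 *\<^sub>C (\<delta>\<^bsub>\<Omega>\<^esub> \<beta> \<lhd>\<^bsub>\<Omega>\<^esub> \<beta>)
    \<and> \<beta> \<rhd>\<^bsub>\<Omega>\<^esub> \<delta>\<^bsub>\<Omega>\<^esub> \<gamma> = q *\<^sub>C (\<delta>\<^bsub>\<Omega>\<^esub> \<gamma> \<lhd>\<^bsub>\<Omega>\<^esub> \<beta>) + (q * (P\<^sub>1 - 1)) *\<^sub>C (\<delta>\<^bsub>\<Omega>\<^esub> \<beta> \<lhd>\<^bsub>\<Omega>\<^esub> \<gamma>)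
    \<and> \<beta> \<rhd>\<^bsub>\<Omega>\<^esub> \<delta>\<^bsub>\<Omega>\<^esub> d = inverse P\<^sub>2 *\<^sub>C (\<delta>\<^bsub>\<Omega>\<^esub> d \<lhd>\<^bsub>\<Omega>\<^esub> \<beta>)
        + (q\<^sup>2 * (1 - P\<^sub>2)) *\<^sub>C (\<delta>\<^bsub>\<Omega>\<^esub> \<beta> \<lhd>\<^bsub>\<Omega>\<^esub> d)
    \<and> \<gamma> \<rhd>\<^bsub>\<Omega>\<^esub> \<delta>\<^bsub>\<Omega>\<^esub> a = inverse P\<^sub>1 *\<^sub>C (\<delta>\<^bsub>\<Omega>\<^esub> a \<lhd>\<^bsub>\<Omega>\<^esub> \<gamma>) + (q - P\<^sub>1) *\<^sub>C (\<delta>\<^bsub>\<Omega>\<^esub> \<gamma> \<lhd>\<^bsub>\<Omega>\<^esub> a)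
    \<and> \<gamma> \<rhd>\<^bsub>\<Omega>\<^esub> \<delta>\<^bsub>\<Omega>\<^esub> \<beta> = (q\<^sup>2 * P\<^sub>1) *\<^sub>C (\<delta>\<^bsub>\<Omega>\<^esub> \<beta> \<lhd>\<^bsub>\<Omega>\<^esub> \<gamma>)
    \<and> \<gamma> \<rhd>\<^bsub>\<Omega>\<^esub> \<delta>\<^bsub>\<Omega>\<^esub> \<gamma> = (q\<^sup>2 * P\<^sub>1) *\<^sub>C (\<delta>\<^bsub>\<Omega>\<^esub> \<gamma> \<lhd>\<^bsub>\<Omega>\<^esub> \<gamma>)
    \<and> \<gamma> \<rhd>\<^bsub>\<Omega>\<^esub> \<delta>\<^bsub>\<Omega>\<^esub> d = P\<^sub>1 *\<^sub>C (\<delta>\<^bsub>\<Omega>\<^esub> d \<lhd>\<^bsub>\<Omega>\<^esub> \<gamma>)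
    \<and> d \<rhd>\<^bsub>\<Omega>\<^esub> \<delta>\<^bsub>\<Omega>\<^esub> a = \<delta>\<^bsub>\<Omega>\<^esub> a \<lhd>\<^bsub>\<Omega>\<^esub> d + (1 - q) *\<^sub>C (\<delta>\<^bsub>\<Omega>\<^esub> \<gamma> \<lhd>\<^bsub>\<Omega>\<^esub> \<beta>)
        + (P\<^sub>1 - 1) *\<^sub>C (\<delta>\<^bsub>\<Omega>\<^esub> d \<lhd>\<^bsub>\<Omega>\<^esub> a)
    \<and> d \<rhd>\<^bsub>\<Omega>\<^esub> \<delta>\<^bsub>\<Omega>\<^esub> \<beta> = inverse P\<^sub>2 *\<^sub>C (\<delta>\<^bsub>\<Omega>\<^esub> \<beta> \<lhd>\<^bsub>\<Omega>\<^esub> d) + (q\<^sup>2 - P\<^sub>2) *\<^sub>C (\<delta>\<^bsub>\<Omega>\<^esub> d \<lhd>\<^bsub>\<Omega>\<^esub> \<beta>)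
    \<and> d \<rhd>\<^bsub>\<Omega>\<^esub> \<delta>\<^bsub>\<Omega>\<^esub> \<gamma> = q\<^sup>2 *\<^sub>C (\<delta>\<^bsub>\<Omega>\<^esub> \<gamma> \<lhd>\<^bsub>\<Omega>\<^esub> d) + (P\<^sub>1 - 1) *\<^sub>C (\<delta>\<^bsub>\<Omega>\<^esub> d \<lhd>\<^bsub>\<Omega>\<^esub> \<gamma>)
    \<and> d \<rhd>\<^bsub>\<Omega>\<^esub> \<delta>\<^bsub>\<Omega>\<^esub> d = (q\<^sup>2 * P\<^sub>2) *\<^sub>C (\<delta>\<^bsub>\<Omega>\<^esub> d \<lhd>\<^bsub>\<Omega>\<^esub> d))"

definition free_covariant_calculus ::
    "complex \<Rightarrow> (letter \<Rightarrow> 'a::complex_algebra_1) \<Rightarrow> ('a, 'w::complex_space) calculus \<Rightarrow> bool"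
  where "free_covariant_calculus q g \<Omega> \<longleftrightarrow>
    graded_calculus q g \<Omega> \<and> left_covariant q g \<Omega> \<and> differentials_right_basis g \<Omega>"


section \<open>Existence of the algebra\<close>

lemma evaluate_superset:
  "finite K \<Longrightarrow> Poly_Mapping.keys f \<subseteq> K \<Longrightarrow>
    evaluate g f = (\<Sum>w \<in> K. Poly_Mapping.lookup f w *\<^sub>C prod_list (map g (letters w)))"
  unfolding evaluate_def by (rule sum.mono_neutral_left) (auto simp: in_keys_iff)

lemma evaluate_add: "evaluate g (f + h) = evaluate g f + evaluate g h"
proof -
  let ?K = "Poly_Mapping.keys f \<union> Poly_Mapping.keys h"
  let ?s = "\<lambda>f. \<Sum>w\<in>?K. Poly_Mapping.lookup f w *\<^sub>C prod_list (map g (letters w))"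
  have "evaluate g (f + h) = ?s (f + h)"
    by (rule evaluate_superset) (use Poly_Mapping.keys_add[of f h] in auto)
  moreover have "evaluate g f = ?s f" "evaluate g h = ?s h"
    by (rule evaluate_superset; auto)+
  ultimately show ?thesis
    by (simp add: lookup_add scaleC_add_left sum.distrib)
qed

lemma evaluate_zero: "evaluate g 0 = 0"
  by (simp add: evaluate_def)

lemma evaluate_diff: "evaluate g (f - h) = evaluate g f - evaluate g h"
  by (metis add_diff_cancel diff_add_cancel evaluate_add)

lemma evaluate_sum: "evaluate g (\<Sum>i\<in>I. f i) = (\<Sum>i\<in>I. evaluate g (f i))"
  by (induct I rule: infinite_finite_induct) (simp_all add: evaluate_add evaluate_zero)

lemma evaluate_single:
  "evaluate g (Poly_Mapping.single w c) = c *\<^sub>C prod_list (map g (letters w))"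
  by (cases "c = 0") (simp_all add: evaluate_def)

lemma free_algebra_sum_monomials:
  "f = (\<Sum>w\<in>Poly_Mapping.keys f. Poly_Mapping.single w (Poly_Mapping.lookup f w))"
  for f :: free_algebra
  by (rule poly_mapping_eqI)
    (simp add: lookup_sum lookup_single when_def in_keys_iff sum.delta')

lemma evaluate_mult: "evaluate g (f * h) = evaluate g f * evaluate g h"
proof -
  let ?m = "\<lambda>(f :: free_algebra) w. Poly_Mapping.single w (Poly_Mapping.lookup f w)"
  have *: "evaluate g (Poly_Mapping.single v c * Poly_Mapping.single w c')
      = evaluate g (Poly_Mapping.single v c) * evaluate g (Poly_Mapping.single w c')" for v w c c'
    by (simp add: mult_single evaluate_single plus_word_def scaleC_mult_left scaleC_mult_right
        scaleC_scaleC mult.commute)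
  have "evaluate g (f * h) = evaluate g (sum (?m f) (Poly_Mapping.keys f) * sum (?m h) (Poly_Mapping.keys h))"
    by (simp flip: free_algebra_sum_monomials)
  also have "\<dots> = evaluate g (sum (?m f) (Poly_Mapping.keys f)) * evaluate g (sum (?m h) (Poly_Mapping.keys h))"
    by (simp add: sum_product evaluate_sum *)
  finally show ?thesis
    by (simp flip: free_algebra_sum_monomials)
qed

lemma evaluate_var: "evaluate g (var l) = g l"
  by (simp add: var_def evaluate_single scaleC_one)

lemma evaluate_one: "evaluate g 1 = 1"
  by (simp add: evaluate_single zero_word_def scaleC_one flip: single_one)

lemma evaluate_scaleC: "evaluate g (c *\<^sub>C f) = c *\<^sub>C evaluate g f"
proof -
  have "evaluate g (c *\<^sub>C f)
      = (\<Sum>w\<in>Poly_Mapping.keys f. Poly_Mapping.lookup (c *\<^sub>C f) w *\<^sub>C prod_list (map g (letters w)))"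
    by (rule evaluate_superset) (auto simp: in_keys_iff lookup_scaleC scaleC_complex_def)
  then show ?thesis
    by (simp add: evaluate_def lookup_scaleC complex_space.scale_sum_right scaleC_scaleC
        scaleC_complex_def)
qed

lemma one_notin_ideal: "1 \<notin> ideal_generated (GLq2_relators q)"
proof
  define g :: "letter \<Rightarrow> complex" where "g l = (if l \<in> {Gen Gen_b, Gen Gen_c} then 0 else 1)" for l
  have "evaluate g f = 0" if "f \<in> ideal_generated (GLq2_relators q)" for f
    using that
  proof induct
    case (gen r)
    then show ?case
      by (auto simp: GLq2_relators_def Let_def evaluate_add evaluate_diff evaluate_mult
          evaluate_scaleC evaluate_var evaluate_one g_def scaleC_complex_def)
  qed (simp_all add: evaluate_add evaluate_mult evaluate_zero)
  moreover assume "1 \<in> ideal_generated (GLq2_relators q)"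
  ultimately show False
    by (fastforce simp: evaluate_one)
qed

lemma free_scaleC: "c *\<^sub>C f = Poly_Mapping.single 0 c * f" for f :: free_algebra
proof (rule poly_mapping_eqI)
  fix w
  show "Poly_Mapping.lookup (c *\<^sub>C f) w = Poly_Mapping.lookup (Poly_Mapping.single 0 c * f) w"
    by (simp add: lookup_scaleC scaleC_complex_def lookup_mult lookup_single when_mult)
qed

lemma free_scaleC_right: "c *\<^sub>C f = f * Poly_Mapping.single 0 c" for f :: free_algebra
proof (rule poly_mapping_eqI)
  fix w
  have *: "(\<Sum>v. c when v = 0 when w = u + v) = (c when w = u)" for u :: word
    by (subst when_commute) simp
  show "Poly_Mapping.lookup (c *\<^sub>C f) w = Poly_Mapping.lookup (f * Poly_Mapping.single 0 c) w"
    by (simp add: lookup_scaleC scaleC_complex_def lookup_mult lookup_single * mult_when mult.commute)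
qed

lemma ideal_generated_uminus: "x \<in> ideal_generated R \<Longrightarrow> - x \<in> ideal_generated R"
  using ideal_generated.mult[of x R "- 1" 1] by simp

lemma ideal_generated_diff:
  "x \<in> ideal_generated R \<Longrightarrow> y \<in> ideal_generated R \<Longrightarrow> x - y \<in> ideal_generated R"
  using ideal_generated.add[OF _ ideal_generated_uminus] by fastforce

text \<open>As types cannot depend on \<open>q\<close>, the parameter of the model is attached to a phantom type;
  \<open>root1\<close> and \<open>root2\<close> realise the two primitive cubic roots of unity.\<close>

class parameter =
  fixes parameter :: "'a itself \<Rightarrow> complex"

datatype root1 = Root1
datatype root2 = Root2

instantiation root1 :: parameter
begin
definition parameter_root1 :: "root1 itself \<Rightarrow> complex"
  where "parameter_root1 _ = Complex (- 1 / 2) (sqrt 3 / 2)"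
instance ..
end

instantiation root2 :: parameter
begin
definition parameter_root2 :: "root2 itself \<Rightarrow> complex"
  where "parameter_root2 _ = Complex (- 1 / 2) (- sqrt 3 / 2)"
instance ..
end

lemma primitive_cubic_root_cases:
  fixes q :: complex
  assumes "q ^ 3 = 1" and "q \<noteq> 1"
  shows "q = parameter TYPE(root1) \<or> q = parameter TYPE(root2)"
proof -
  have "(q - 1) * (q\<^sup>2 + q + 1) = q ^ 3 - 1"
    by (simp add: power2_eq_square power3_eq_cube algebra_simps)
  then have "q\<^sup>2 + q + 1 = 0" using assms by simp
  moreover have "(q - Complex (- 1 / 2) (sqrt 3 / 2)) * (q - Complex (- 1 / 2) (- sqrt 3 / 2))
      = q\<^sup>2 + q + 1"
    by (simp add: complex_eq_iff power2_eq_square algebra_simps)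
  ultimately show ?thesis
    by (auto simp: parameter_root1_def parameter_root2_def)
qed

definition glq_rel :: "'q::parameter itself \<Rightarrow> free_algebra \<Rightarrow> free_algebra \<Rightarrow> bool"
  where "glq_rel T x y \<longleftrightarrow> x - y \<in> ideal_generated (GLq2_relators (parameter T))"

lemma equivp_glq_rel: "equivp (glq_rel T)"
proof (rule equivpI)
  show "reflp (glq_rel T)"
    by (auto intro!: reflpI simp: glq_rel_def ideal_generated.zero)
  show "symp (glq_rel T)"
    by (rule sympI) (use ideal_generated_uminus in \<open>fastforce simp: glq_rel_def\<close>)
  show "transp (glq_rel T)"
    by (rule transpI) (use ideal_generated.add in \<open>fastforce simp: glq_rel_def\<close>)
qed

quotient_type (overloaded) 'q glq = free_algebra / "glq_rel TYPE('q::parameter)"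
  by (rule equivp_glq_rel)

instantiation glq :: (parameter) ring_1
begin

lift_definition zero_glq :: "'a glq" is 0 .
lift_definition one_glq :: "'a glq" is 1 .

lift_definition plus_glq :: "'a glq \<Rightarrow> 'a glq \<Rightarrow> 'a glq" is "(+)"
  unfolding glq_rel_def by (drule (1) ideal_generated.add) (simp add: algebra_simps)

lift_definition uminus_glq :: "'a glq \<Rightarrow> 'a glq" is uminus
  unfolding glq_rel_def by (drule ideal_generated_uminus) simp

lift_definition minus_glq :: "'a glq \<Rightarrow> 'a glq \<Rightarrow> 'a glq" is "(-)"
  unfolding glq_rel_def by (drule (1) ideal_generated_diff) (simp add: algebra_simps)

lift_definition times_glq :: "'a glq \<Rightarrow> 'a glq \<Rightarrow> 'a glq" is "(*)"
proof -
  fix x x' y y' :: free_algebra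
  let ?I = "ideal_generated (GLq2_relators (parameter TYPE('a)))"
  assume "glq_rel TYPE('a) x x'" "glq_rel TYPE('a) y y'"
  then have "1 * (x - x') * y \<in> ?I" "x' * (y - y') * 1 \<in> ?I"
    unfolding glq_rel_def by (blast intro: ideal_generated.mult)+
  then have "1 * (x - x') * y + x' * (y - y') * 1 \<in> ?I"
    by (rule ideal_generated.add)
  then show "glq_rel TYPE('a) (x * y) (x' * y')"
    by (simp add: glq_rel_def algebra_simps)
qed

instance
proof
  fix x y z :: "'a glq"
  have R: "glq_rel TYPE('a) u v" if "u = v" for u v
    using that by (simp add: glq_rel_def ideal_generated.zero)
  show "x + y + z = x + (y + z)" by transfer (rule R, simp add: add.assoc)
  show "x + y = y + x" by transfer (rule R, simp add: add.commute)
  show "0 + x = x" by transfer (rule R, simp)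
  show "- x + x = 0" by transfer (rule R, simp)
  show "x - y = x + - y" by transfer (rule R, simp)
  show "x * y * z = x * (y * z)" by transfer (rule R, simp add: mult.assoc)
  show "1 * x = x" by transfer (rule R, simp)
  show "x * 1 = x" by transfer (rule R, simp)
  show "(x + y) * z = x * z + y * z" by transfer (rule R, simp add: algebra_simps)
  show "x * (y + z) = x * y + x * z" by transfer (rule R, simp add: algebra_simps)
  show "(0 :: 'a glq) \<noteq> 1"
  proof transfer
    have "- 1 \<notin> ideal_generated (GLq2_relators (parameter TYPE('a)))"
      using ideal_generated_uminus one_notin_ideal by fastforce
    then show "\<not> glq_rel TYPE('a) 0 1" by (simp add: glq_rel_def)
  qed
qed

end

instantiation glq :: (parameter) complex_algebra_1
begin

lift_definition scaleC_glq :: "complex \<Rightarrow> 'a glq \<Rightarrow> 'a glq" is scaleC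
proof -
  fix c and x y :: free_algebra
  assume "glq_rel TYPE('a) x y"
  then have "Poly_Mapping.single 0 c * (x - y) * 1
      \<in> ideal_generated (GLq2_relators (parameter TYPE('a)))"
    unfolding glq_rel_def by (rule ideal_generated.mult)
  then show "glq_rel TYPE('a) (c *\<^sub>C x) (c *\<^sub>C y)"
    by (simp add: glq_rel_def free_scaleC right_diff_distrib)
qed

instance
proof
  fix x y :: "'a glq" and c c' :: complex
  have R: "glq_rel TYPE('a) u v" if "u = v" for u v
    using that by (simp add: glq_rel_def ideal_generated.zero)
  show "c *\<^sub>C (x + y) = c *\<^sub>C x + c *\<^sub>C y" by transfer (rule R, rule scaleC_add_right)
  show "(c + c') *\<^sub>C x = c *\<^sub>C x + c' *\<^sub>C x" by transfer (rule R, rule scaleC_add_left)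
  show "c *\<^sub>C c' *\<^sub>C x = (c * c') *\<^sub>C x" by transfer (rule R, rule scaleC_scaleC)
  show "1 *\<^sub>C x = x" by transfer (rule R, rule scaleC_one)
  show "(c *\<^sub>C x) * y = c *\<^sub>C (x * y)"
    by transfer (rule R, simp add: free_scaleC mult.assoc)
  show "x * (c *\<^sub>C y) = c *\<^sub>C (x * y)"
    by transfer (rule R, simp add: free_scaleC_right mult.assoc)
qed

end

lemma GLq2_model: "is_GLq2 (parameter TYPE('q)) (\<lambda>l. abs_glq (var l) :: 'q::parameter glq)"
proof -
  let ?g = "\<lambda>l. abs_glq (var l) :: 'q glq"
  have mono: "prod_list (map ?g ls) = abs_glq (Poly_Mapping.single (Word ls) 1)" for ls
  proof (induct ls)
    case Nil
    show ?case by (simp add: one_glq.abs_eq flip: zero_word_def)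
  next
    case (Cons l ls)
    then show ?case
      by (simp add: times_glq.abs_eq var_def mult_single plus_word_def)
  qed
  have sum: "(\<Sum>i\<in>I. abs_glq (f i)) = (abs_glq (\<Sum>i\<in>I. f i) :: 'q glq)"
    for I and f :: "word \<Rightarrow> free_algebra"
    by (induct I rule: infinite_finite_induct) (simp_all add: plus_glq.abs_eq zero_glq.abs_eq)
  have eval: "evaluate ?g f = abs_glq f" for f
  proof -
    have "evaluate ?g f
        = abs_glq (\<Sum>w\<in>Poly_Mapping.keys f. Poly_Mapping.single w (Poly_Mapping.lookup f w))"
      unfolding evaluate_def mono
      by (simp add: scaleC_glq.abs_eq free_scaleC mult_single sum)
    then show ?thesis by (simp flip: free_algebra_sum_monomials)
  qed
  have "surj (evaluate ?g)"
    by (rule surjI[of _ rep_glq]) (simp add: eval Quotient3_abs_rep[OF Quotient3_glq])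
  moreover have "abs_glq f = (0 :: 'q glq)
      \<longleftrightarrow> f \<in> ideal_generated (GLq2_relators (parameter TYPE('q)))" for f
    by (simp add: zero_glq.abs_eq glq.abs_eq_iff glq_rel_def)
  ultimately show ?thesis
    by (simp add: is_GLq2_def eval)
qed

end

theory Submission
  imports Defs
begin

text \<open>
  On the free right module with basis \<open>da\<close>, \<open>d\<beta>\<close>, \<open>d\<gamma>\<close>, \<open>dd\<close> the relations prescribe right linear operators
  for the left multiplications by the generators. Together with the differential they are encoded as
  operators \<open>(w, h) \<mapsto> (\<tau> x \<cdot> w + dx \<cdot> h, x h)\<close> on the direct sum of the forms and the algebra, where \<open>\<tau>\<close> is
  the automorphism defining the grading; the twisted Leibniz rule says exactly that this is a representation.
  It therefore suffices to check the six relations of the matrix algebra and that the operator of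
  the quantum determinant \<open>D\<close> is invertible. The latter holds because the cube of each generator \<open>x\<close> acts as right
  multiplication by the central element \<open>x\<^sup>3\<close>, and \<open>D\<^sup>3 = a\<^sup>3 d\<^sup>3 - \<beta>\<^sup>3 \<gamma>\<^sup>3\<close>, so that \<open>D\<^sup>3\<close> acts as right multiplication
  by \<open>D\<^sup>3\<close>. The coaction is determined by its values on the four differentials, and covariance need only be
  tested on generators. An isomorphism between two calculi with the same relations maps one
  basis of differentials to the other.
\<close>

section \<open>Linear and bilinear maps\<close>

text \<open>The obstacle is the inverse of the determinant. The relations prescribe the action of
  the four generators but say nothing about \<open>t\<close>, and nothing makes the determinant
  itself act as a right multiplication. Its cube does; as right multiplication S by
  \<open>t^3\<close> commutes with the operators of all generators, the operator D of the
  determinant has inverse \<open>D * D * S\<close>. The universal property gives homomorphisms only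
  into types of class \<open>complex_algebra_1\<close>, so its targets are endomorphism algebras.
  The coproduct arises in the same way: the letters go to left multiplications on the graded tensor
  square, and the value of the resulting operator at 1 \<otimes> 1 is the coproduct. As q is a
  primitive cubic root of unity, a grading modulo 3 amounts to a linear operator whose cube is the
  identity. Claims about degrees thus become equations between maps, which can be tested on
  generators. The parameters enter the calculations only through quadratic equations, so their four
  combinations are treated at once.\<close>

lemma clinearI:
  "(\<And>x y. f (x + y) = f x + f y) \<Longrightarrow> (\<And>c x. f (c *\<^sub>C x) = c *\<^sub>C f x) \<Longrightarrow> clinear f"
  by (simp add: Vector_Spaces.linear_iff complex_space.vector_space_axioms)

lemma clinear_add: "clinear f \<Longrightarrow> f (x + y) = f x + f y"
  and clinear_scale: "clinear f \<Longrightarrow> f (c *\<^sub>C x) = c *\<^sub>C f x"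
  by (simp_all add: Vector_Spaces.linear_iff)

lemma clinear_zero: "clinear f \<Longrightarrow> f 0 = 0"
  using clinear_add[of f 0 0] by simp

lemma clinear_minus: "clinear f \<Longrightarrow> f (- x) = - f x"
  by (metis add_eq_0_iff clinear_add clinear_zero)

lemma clinear_diff: "clinear f \<Longrightarrow> f (x - y) = f x - f y"
  by (metis clinear_add diff_add_cancel add_diff_cancel)

lemma clinear_sum: "clinear f \<Longrightarrow> f (\<Sum>i\<in>I. x i) = (\<Sum>i\<in>I. f (x i))"
  by (induct I rule: infinite_finite_induct) (simp_all add: clinear_zero clinear_add)

lemmas clinear_simps =
  clinear_add clinear_scale clinear_zero clinear_minus clinear_diff clinear_sum

lemma clinear_id: "clinear id" "clinear (\<lambda>x. x)"
  by (auto intro: clinearI)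

lemma clinear_comp: "clinear f \<Longrightarrow> clinear h \<Longrightarrow> clinear (\<lambda>x. f (h x))"
  by (rule clinearI) (simp_all add: clinear_simps)

lemma clinear_plus: "clinear f \<Longrightarrow> clinear h \<Longrightarrow> clinear (\<lambda>x. f x + h x)"
  by (rule clinearI) (simp_all add: clinear_simps scaleC_add_right algebra_simps)

lemma clinear_scaleC: "clinear f \<Longrightarrow> clinear (\<lambda>x. c *\<^sub>C f x)"
  by (rule clinearI) (simp_all add: clinear_simps scaleC_add_right scaleC_scaleC mult.commute)

lemma clinear_Sum: "(\<And>i. i \<in> I \<Longrightarrow> clinear (f i)) \<Longrightarrow> clinear (\<lambda>x. \<Sum>i\<in>I. f i x)"
  by (rule clinearI) (simp_all add: clinear_simps sum.distrib complex_space.scale_sum_right)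

lemma bilinearI:
  assumes "\<And>x x' y. f (x + x') y = f x y + f x' y" "\<And>c x y. f (c *\<^sub>C x) y = c *\<^sub>C f x y"
    and "\<And>x y y'. f x (y + y') = f x y + f x y'" "\<And>c x y. f x (c *\<^sub>C y) = c *\<^sub>C f x y"
  shows "bilinear f"
  unfolding bilinear_def using assms by (blast intro: clinearI)

lemma bilinear_left: "bilinear f \<Longrightarrow> clinear (\<lambda>x. f x y)"
  and bilinear_right: "bilinear f \<Longrightarrow> clinear (f x)"
  by (simp_all add: bilinear_def)

lemma bilinear_simps:
  assumes "bilinear f"
  shows "f (x + x') y = f x y + f x' y" "f (c *\<^sub>C x) y = c *\<^sub>C f x y"
    "f x (y + y') = f x y + f x y'" "f x (c *\<^sub>C y) = c *\<^sub>C f x y"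
    "f 0 y = 0" "f x 0 = 0" "f (- x) y = - f x y" "f x (- y) = - f x y"
    "f (x - x') y = f x y - f x' y" "f x (y - y') = f x y - f x y'"
    "f (\<Sum>i\<in>I. u i) y = (\<Sum>i\<in>I. f (u i) y)" "f x (\<Sum>i\<in>I. v i) = (\<Sum>i\<in>I. f x (v i))"
  using clinear_simps[OF bilinear_left[OF assms]] clinear_simps[OF bilinear_right[OF assms]]
  by simp_all

lemma bilinear_comp:
  "bilinear f \<Longrightarrow> clinear h \<Longrightarrow> clinear k \<Longrightarrow> clinear l \<Longrightarrow> bilinear (\<lambda>x y. h (f (k x) (l y)))"
  by (rule bilinearI) (simp_all add: clinear_simps bilinear_simps)

lemma bilinear_times: "bilinear ((*) :: 'a::complex_algebra_1 \<Rightarrow> 'a \<Rightarrow> 'a)"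
  by (rule bilinearI) (simp_all add: algebra_simps scaleC_mult_left scaleC_mult_right)

lemma bilinear_tens: "bilinear (\<otimes>)"
proof -
  have *: "tensor_rel p p'" if "p - p' \<in> tensor_relators"
    for p p' :: "('a \<times> 'b) \<Rightarrow>\<^sub>0 complex"
    using that by (simp add: tensor_rel_def complex_space.span_base)
  show ?thesis
  proof (rule bilinearI)
    fix x x' :: 'a and y y' :: 'b and c
    show "(x + x') \<otimes> y = x \<otimes> y + x' \<otimes> y"
      by transfer (rule *, simp add: tensor_relators_def diff_diff_add[symmetric], blast)
    show "x \<otimes> (y + y') = x \<otimes> y + x \<otimes> y'"
      by transfer (rule *, simp add: tensor_relators_def diff_diff_add[symmetric], blast)
    show "(c *\<^sub>C x) \<otimes> y = c *\<^sub>C (x \<otimes> y)"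
      by transfer (rule *, simp add: tensor_relators_def, blast)
    show "x \<otimes> (c *\<^sub>C y) = c *\<^sub>C (x \<otimes> y)"
      by transfer (rule *, simp add: tensor_relators_def, blast)
  qed
qed

lemmas tens_simps = bilinear_simps[OF bilinear_tens]

text \<open>The scalars of a formal combination are absorbed into the first factor, so no case for
  scalar multiples is required, and zero is covered as 0 \<otimes> 0.\<close>

lemma tensor_induct [case_names add tens]:
  assumes add: "\<And>u v. P u \<Longrightarrow> P v \<Longrightarrow> P (u + v)" and tens: "\<And>x y. P (x \<otimes> y)"
  shows "P u"
proof -
  have single: "P (abs_tensor (Poly_Mapping.single z c))" for z :: "'a \<times> 'b" and c
  proof -
    have "abs_tensor (Poly_Mapping.single z c) = c *\<^sub>C (fst z \<otimes> snd z)"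
      unfolding tens.abs_eq scaleC_tensor.abs_eq
      by (rule arg_cong[where f = abs_tensor], rule poly_mapping_eqI)
        (simp add: lookup_scaleC lookup_single scaleC_complex_def when_def)
    then show ?thesis
      using tens[of "c *\<^sub>C fst z" "snd z"] by (simp add: tens_simps)
  qed
  have "P (abs_tensor (\<Sum>z\<in>K. Poly_Mapping.single z (f z)))" if "finite K"
    for K and f :: "'a \<times> 'b \<Rightarrow> complex"
    using that
  proof induct
    case empty
    show ?case using tens[of 0 0] by (simp add: tens_simps zero_tensor.abs_eq)
  next
    case (insert z K)
    then show ?case by (simp add: add single flip: plus_tensor.abs_eq)
  qed
  moreover have "p = (\<Sum>z\<in>Poly_Mapping.keys p. Poly_Mapping.single z (Poly_Mapping.lookup p z))"
    for p :: "('a \<times> 'b) \<Rightarrow>\<^sub>0 complex"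
    by (rule poly_mapping_eqI) (simp add: lookup_sum lookup_single when_def in_keys_iff sum.delta')
  ultimately have "P (abs_tensor p)" for p
    by (metis finite_keys)
  then show ?thesis by (metis tensor.abs_induct)
qed

lemma tensor_ext:
  assumes "clinear F" "clinear H" "\<And>x y. F (x \<otimes> y) = H (x \<otimes> y)"
  shows "F u = H u"
  by (induct u rule: tensor_induct) (simp_all add: assms clinear_simps)

lemma bilinear_tens_maps: "clinear f \<Longrightarrow> clinear h \<Longrightarrow> bilinear (\<lambda>x y. f x \<otimes> h y)"
  using bilinear_comp[OF bilinear_tens clinear_id(2)] .

lemma clinear_tensor_map: "clinear f \<Longrightarrow> clinear h \<Longrightarrow> clinear (tensor_map f h)"
  unfolding tensor_map_def by (intro clinear_tensor_lift bilinear_tens_maps)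

lemma tensor_map_tens: "clinear f \<Longrightarrow> clinear h \<Longrightarrow> tensor_map f h (x \<otimes> y) = f x \<otimes> h y"
  unfolding tensor_map_def by (intro tensor_lift_tens bilinear_tens_maps)

lemma bilinear_plus: "bilinear f \<Longrightarrow> bilinear h \<Longrightarrow> bilinear (\<lambda>x y. f x y + h x y)"
  by (rule bilinearI) (simp_all add: bilinear_simps scaleC_add_right algebra_simps)

lemma bilinear_scaleC: "bilinear f \<Longrightarrow> bilinear (\<lambda>x y. c *\<^sub>C f x y)"
  by (rule bilinearI) (simp_all add: bilinear_simps scaleC_add_right scaleC_scaleC mult.commute)

lemma tensor_lift_plus:
  assumes "bilinear f" "bilinear h"
  shows "tensor_lift (\<lambda>x y. f x y + h x y) u = tensor_lift f u + tensor_lift h u"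
  by (rule tensor_ext[of "tensor_lift (\<lambda>x y. f x y + h x y)" "\<lambda>u. tensor_lift f u + tensor_lift h u"])
    (simp_all add: assms clinear_tensor_lift clinear_plus tensor_lift_tens bilinear_plus)

lemma tensor_lift_scaleC:
  assumes "bilinear f"
  shows "tensor_lift (\<lambda>x y. c *\<^sub>C f x y) u = c *\<^sub>C tensor_lift f u"
  by (rule tensor_ext[of "tensor_lift (\<lambda>x y. c *\<^sub>C f x y)" "\<lambda>u. c *\<^sub>C tensor_lift f u"])
    (simp_all add: assms clinear_tensor_lift clinear_scaleC tensor_lift_tens bilinear_scaleC)

lemma bilinear_tens_tens: "bilinear (\<lambda>x y. x \<otimes> (y \<otimes> z))"
  by (rule bilinearI) (simp_all add: tens_simps)

lemma bilinear_tensor_assoc: "bilinear (\<lambda>u z. tensor_lift (\<lambda>x y. x \<otimes> (y \<otimes> z)) u)"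
  by (rule bilinearI)
    (simp_all add: tens_simps tensor_lift_plus tensor_lift_scaleC clinear_simps
      clinear_tensor_lift bilinear_tens_tens)

lemma clinear_tensor_assoc: "clinear tensor_assoc"
  unfolding tensor_assoc_def by (intro clinear_tensor_lift bilinear_tensor_assoc)

lemma tensor_assoc_tens: "tensor_assoc ((x \<otimes> y) \<otimes> z) = x \<otimes> (y \<otimes> z)"
  unfolding tensor_assoc_def by (simp add: tensor_lift_tens bilinear_tensor_assoc bilinear_tens_tens)

section \<open>Algebras of endomorphisms\<close>

text \<open>The class \<open>complex_algebra_1\<close> demands 0 \<noteq> 1, so endomorphisms can
  form an instance only on a nonzero space.\<close>

class nontrivial_complex_space = complex_space +
  assumes nontrivial: "\<exists>x. x \<noteq> 0"

subclass (in complex_algebra_1) nontrivial_complex_space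
  by standard (metis zero_neq_one)

instance prod :: (complex_space, nontrivial_complex_space) nontrivial_complex_space
  by standard (metis nontrivial prod.inject zero_prod_def)

lemma ex_functional:
  fixes x :: "'v::complex_space"
  assumes "x \<noteq> 0"
  shows "\<exists>f :: 'v \<Rightarrow> complex. clinear f \<and> f x = 1"
proof -
  interpret vector_space_pair "scaleC :: complex \<Rightarrow> 'v \<Rightarrow> 'v" "scaleC :: complex \<Rightarrow> complex \<Rightarrow> complex"
    by unfold_locales
  have "complex_space.independent {x}"
    using assms by simp
  then show ?thesis
    using linear_independent_extend[of "{x}" "\<lambda>_. 1"] by auto
qed

text \<open>If two functionals take the value 1 at x and at y, their product is a bilinear form
  whose lift has the value 1 at x \<otimes> y.\<close>

lemma tensor_nontrivial:
  "\<exists>u :: ('a::nontrivial_complex_space, 'b::nontrivial_complex_space) tensor. u \<noteq> 0"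
proof -
  obtain x :: 'a and y :: 'b where "x \<noteq> 0" "y \<noteq> 0"
    using nontrivial[where 'a = 'a] nontrivial[where 'a = 'b] by blast
  then obtain f :: "'a \<Rightarrow> complex" and h :: "'b \<Rightarrow> complex"
    where fh: "clinear f" "f x = 1" "clinear h" "h y = 1" using ex_functional by metis
  have b: "bilinear (\<lambda>x y. f x * h y)"
    using bilinear_comp[OF bilinear_times clinear_id(2) fh(1,3)] .
  have "tensor_lift (\<lambda>x y. f x * h y) (x \<otimes> y) = 1"
    by (simp add: tensor_lift_tens[OF b] fh)
  then have "x \<otimes> y \<noteq> 0"
    using clinear_zero[OF clinear_tensor_lift[OF b]] by force
  then show ?thesis by blast
qed

instance tensor :: (nontrivial_complex_space, nontrivial_complex_space) nontrivial_complex_space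
  by standard (rule tensor_nontrivial)

text \<open>Endomorphisms get a type of their own to serve as targets of the universal property
  \<open>hom_exists\<close>.\<close>

typedef (overloaded) 'v cend = "{f :: 'v::complex_space \<Rightarrow> 'v. clinear f}"
  morphisms apply_cend Cend
  by (rule exI[of _ id]) (simp add: clinear_id)

setup_lifting type_definition_cend

lemma clinear_apply_cend: "clinear (apply_cend T)"
  using apply_cend by blast

instantiation cend :: (complex_space) complex_space
begin
lift_definition zero_cend :: "'a cend" is "\<lambda>_. 0" by (rule clinearI) simp_all
lift_definition plus_cend :: "'a cend \<Rightarrow> 'a cend \<Rightarrow> 'a cend" is "\<lambda>f h x. f x + h x"
  by (rule clinear_plus)
lift_definition uminus_cend :: "'a cend \<Rightarrow> 'a cend" is "\<lambda>f x. - f x"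
  by (rule clinearI) (simp_all add: clinear_simps)
lift_definition minus_cend :: "'a cend \<Rightarrow> 'a cend \<Rightarrow> 'a cend" is "\<lambda>f h x. f x - h x"
  by (rule clinearI) (simp_all add: clinear_simps complex_space.scale_right_diff_distrib)
lift_definition scaleC_cend :: "complex \<Rightarrow> 'a cend \<Rightarrow> 'a cend" is "\<lambda>c f x. c *\<^sub>C f x"
  by (rule clinear_scaleC)
instance
  by standard (transfer; simp add: fun_eq_iff scaleC_add_right scaleC_add_left scaleC_scaleC
      scaleC_one algebra_simps)+
end

instantiation cend :: (nontrivial_complex_space) complex_algebra_1
begin
lift_definition one_cend :: "'a cend" is "\<lambda>x. x" by (rule clinear_id)
lift_definition times_cend :: "'a cend \<Rightarrow> 'a cend \<Rightarrow> 'a cend" is "\<lambda>f h x. f (h x)"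
  by (rule clinear_comp)
instance
  by standard (transfer; use nontrivial in \<open>auto simp: fun_eq_iff clinear_simps\<close>)+
end

lemma apply_cend_simps:
  "apply_cend (S + T) v = apply_cend S v + apply_cend T v" "apply_cend (- S) v = - apply_cend S v"
  "apply_cend (S - T) v = apply_cend S v - apply_cend T v" "apply_cend 0 v = 0"
  "apply_cend (c *\<^sub>C S) v = c *\<^sub>C apply_cend S v"
  by (simp_all add: zero_cend.rep_eq plus_cend.rep_eq uminus_cend.rep_eq minus_cend.rep_eq
      scaleC_cend.rep_eq)

lemma apply_cend_mult:
  "apply_cend (S * T) v = apply_cend S (apply_cend T v)" "apply_cend 1 v = v"
  by (simp_all add: times_cend.rep_eq one_cend.rep_eq)

lemma apply_Cend: "clinear f \<Longrightarrow> apply_cend (Cend f) = f"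
  by (simp add: Cend_inverse)

lemma cend_eqI: "(\<And>v. apply_cend S v = apply_cend T v) \<Longrightarrow> S = T"
  by (simp add: apply_cend_inject fun_eq_iff flip: apply_cend_inject)

section \<open>Gradings as eigenspaces of an operator of order three\<close>

locale cubic_root =
  fixes q :: complex
  assumes q3: "q ^ 3 = 1" and q1: "q \<noteq> 1"
begin

lemma qq: "q * q = - q - 1"
proof -
  have "(q - 1) * (q * q + q + 1) = 0"
    using q3 by (simp add: power3_eq_cube algebra_simps)
  then have "q * q + (q + 1) = 0" using q1 by (simp add: add.assoc)
  then show ?thesis using eq_neg_iff_add_eq_0[of "q * q" "q + 1"] by simp
qed

lemma q2: "q\<^sup>2 = - q - 1"
  by (simp add: power2_eq_square qq)

lemma q_mod: "q ^ (k mod 3) = q ^ k"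
proof -
  have "q ^ k = q ^ (k mod 3 + 3 * (k div 3))" by simp
  also have "\<dots> = q ^ (k mod 3)" by (simp only: power_add power_mult q3) simp
  finally show ?thesis ..
qed

lemma q_powers: "q ^ 4 = q" "q ^ 5 = - q - 1" "q ^ 6 = 1" "q ^ (i * 3) = 1"
  using q_mod[of 4] q_mod[of 5] q_mod[of 6] q_mod[of "i * 3"] by (simp_all add: q2)

lemma lessThan_3: "{..<3::nat} = {0, 1, 2}"
  by auto

lemma q_cong: "k mod 3 = l mod 3 \<Longrightarrow> q ^ k = q ^ l"
  by (metis q_mod)

definition Z3_operator :: "('v::complex_space \<Rightarrow> 'v) \<Rightarrow> bool"
  where "Z3_operator \<sigma> \<longleftrightarrow> clinear \<sigma> \<and> (\<forall>x. \<sigma> (\<sigma> (\<sigma> x)) = x)"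

definition eigengrade :: "('v::complex_space \<Rightarrow> 'v) \<Rightarrow> nat \<Rightarrow> 'v set"
  where "eigengrade \<sigma> i = {x. \<sigma> x = q ^ i *\<^sub>C x}"

text \<open>A finite Fourier transform: the average over k = 0, 1, 2 of the k-th iterate of \<sigma>
  weighted with q to the power -ik. The negative exponents -i and -2i are written as
  \<open>2 * i\<close> and \<open>i\<close>.\<close>

definition eigenproj :: "('v::complex_space \<Rightarrow> 'v) \<Rightarrow> nat \<Rightarrow> 'v \<Rightarrow> 'v"
  where "eigenproj \<sigma> i x = (1 / 3) *\<^sub>C (x + q ^ (2 * i) *\<^sub>C \<sigma> x + q ^ i *\<^sub>C \<sigma> (\<sigma> x))"

lemma eigengrade_mod: "eigengrade \<sigma> (i mod 3) = eigengrade \<sigma> i"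
  by (simp add: eigengrade_def q_mod)

lemma Z3_operator_clinear: "Z3_operator \<sigma> \<Longrightarrow> clinear \<sigma>"
  by (simp add: Z3_operator_def)

lemma clinear_eigenproj: "Z3_operator \<sigma> \<Longrightarrow> clinear (eigenproj \<sigma> i)"
  unfolding eigenproj_def[abs_def] Z3_operator_def
  by (intro clinear_scaleC clinear_plus clinear_id clinear_comp[of \<sigma> \<sigma>]) auto

lemma subspace_eigengrade: "Z3_operator \<sigma> \<Longrightarrow> csubspace (eigengrade \<sigma> i)"
  by (rule complex_space.subspaceI)
    (simp_all add: eigengrade_def Z3_operator_def clinear_simps scaleC_add_right scaleC_scaleC
      mult.commute)

lemma eigenproj_in_eigengrade:
  assumes "Z3_operator \<sigma>"
  shows "eigenproj \<sigma> i x \<in> eigengrade \<sigma> i"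
proof -
  have 1: "q ^ i * q ^ (2 * i) = 1"
    using q_cong[of "3 * i" 0] by (simp flip: power_add)
  have "q ^ i *\<^sub>C eigenproj \<sigma> i x
      = (1 / 3) *\<^sub>C (q ^ i *\<^sub>C x + (q ^ i * q ^ (2 * i)) *\<^sub>C \<sigma> x + (q ^ i * q ^ i) *\<^sub>C \<sigma> (\<sigma> x))"
    by (simp add: eigenproj_def scaleC_add_right scaleC_scaleC mult.commute mult.left_commute)
  also have "\<dots> = \<sigma> (eigenproj \<sigma> i x)"
    using assms
    by (simp add: 1 eigenproj_def Z3_operator_def clinear_simps scaleC_one algebra_simps
        q_powers flip: power_add mult_2)
  finally show ?thesis by (simp add: eigengrade_def)
qed

lemma sum_eigenproj: "(\<Sum>i<3. eigenproj \<sigma> i x) = x"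
proof -
  have "(\<Sum>i<3. eigenproj \<sigma> i x)
      = (1 / 3) *\<^sub>C ((\<Sum>i<3::nat. x) + (\<Sum>i<3. q ^ (2 * i)) *\<^sub>C \<sigma> x + (\<Sum>i<3. q ^ i) *\<^sub>C \<sigma> (\<sigma> x))"
    unfolding eigenproj_def
    by (simp add: complex_space.scale_sum_right sum.distrib complex_space.scale_sum_left
        scaleC_add_right)
  moreover have "(\<Sum>i<3. q ^ i) = 0" "(\<Sum>i<3. q ^ (2 * i)) = 0"
    by (simp_all add: lessThan_3 q2 q_powers)
  moreover have "(\<Sum>i<3::nat. x) = 3 *\<^sub>C x"
    using scaleC_add_left[of 1 1 x] scaleC_add_left[of 2 1 x]
    by (simp add: lessThan_3 scaleC_one add.assoc)
  ultimately show ?thesis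
    by (simp add: scaleC_scaleC scaleC_one)
qed

lemma eigenproj_eigen:
  assumes "Z3_operator \<sigma>" "x \<in> eigengrade \<sigma> i" "i < 3" "j < 3"
  shows "eigenproj \<sigma> j x = (if i = j then x else 0)"
proof -
  have "\<sigma> x = q ^ i *\<^sub>C x" "\<sigma> (\<sigma> x) = q ^ (2 * i) *\<^sub>C x"
    using assms by (simp_all add: eigengrade_def Z3_operator_def clinear_simps scaleC_scaleC
      flip: power_add mult_2)
  then have "eigenproj \<sigma> j x = ((1 + q ^ (2 * j + i) + q ^ (j + 2 * i)) / 3) *\<^sub>C x"
    by (simp add: eigenproj_def scaleC_scaleC scaleC_add_left scaleC_add_right power_add
        add_divide_distrib add.assoc)
  moreover have "1 + q ^ (2 * j + i) + q ^ (j + 2 * i) = (if i = j then 3 else 0)"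
  proof -
    have "i = 0 \<or> i = 1 \<or> i = 2" "j = 0 \<or> j = 1 \<or> j = 2" using assms by auto
    then show ?thesis
      by (auto simp: q2 q3 q_powers qq)
  qed
  ultimately show ?thesis by (simp add: scaleC_one)
qed

text \<open>Applying the projection of degree j to any decomposition of x isolates its j-th term,
  whence uniqueness; existence is \<open>sum_eigenproj\<close>.\<close>

lemma decomposes_iff:
  assumes "Z3_operator \<sigma>"
  shows "decomposes (eigengrade \<sigma>) x c \<longleftrightarrow> c = (\<lambda>i. if i < 3 then eigenproj \<sigma> i x else 0)"
proof
  assume c: "decomposes (eigengrade \<sigma>) x c"
  show "c = (\<lambda>i. if i < 3 then eigenproj \<sigma> i x else 0)"
  proof
    fix j
    show "c j = (if j < 3 then eigenproj \<sigma> j x else 0)"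
    proof (cases "j < 3")
      case True
      have "eigenproj \<sigma> j x = (\<Sum>i<3. eigenproj \<sigma> j (c i))"
        using c clinear_simps(6)[OF clinear_eigenproj[OF assms]]
        by (metis decomposes_def)
      also have "\<dots> = (\<Sum>i<3. if i = j then c i else 0)"
        using c True by (intro sum.cong) (auto simp: eigenproj_eigen[OF assms] decomposes_def)
      also have "\<dots> = c j" using True by (simp add: sum.delta)
      finally show ?thesis using True by simp
    qed (use c in \<open>simp add: decomposes_def\<close>)
  qed
qed (simp add: decomposes_def eigenproj_in_eigengrade assms sum_eigenproj)

lemma Z3_grading_eigengrade: "Z3_operator \<sigma> \<Longrightarrow> Z3_grading (eigengrade \<sigma>)"
  by (simp add: Z3_grading_def subspace_eigengrade decomposes_iff)

lemma component_eigengrade: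
  "Z3_operator \<sigma> \<Longrightarrow> i < 3 \<Longrightarrow> component (eigengrade \<sigma>) i = eigenproj \<sigma> i"
  by (rule ext) (simp add: component_def decomposes_iff)

lemma eigen_induct [consumes 1, case_names add eigen]:
  assumes "Z3_operator \<sigma>" and add: "\<And>x y. P x \<Longrightarrow> P y \<Longrightarrow> P (x + y)"
    and eigen: "\<And>i x. x \<in> eigengrade \<sigma> i \<Longrightarrow> P x"
  shows "P x"
proof -
  have "P (\<Sum>i<3. eigenproj \<sigma> i x)"
    unfolding numeral_3_eq_3 lessThan_Suc
    by (simp add: add eigen[OF eigenproj_in_eigengrade[OF assms(1)]] lessThan_0)
  then show ?thesis by (simp only: sum_eigenproj)
qed

lemma tensor_eigen_induct [consumes 2, case_names add eigen]:
  assumes "Z3_operator \<sigma>" "Z3_operator \<rho>"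
    and add: "\<And>u v. P u \<Longrightarrow> P v \<Longrightarrow> P (u + v)"
    and eigen: "\<And>i j x y. x \<in> eigengrade \<sigma> i \<Longrightarrow> y \<in> eigengrade \<rho> j \<Longrightarrow> P (x \<otimes> y)"
  shows "P u"
proof (induct u rule: tensor_induct)
  case (tens x y)
  show ?case
  proof (induct x rule: eigen_induct[OF assms(1)])
    case (2 i x)
    show ?case
      by (induct y rule: eigen_induct[OF assms(2)]) (auto simp: tens_simps intro: add eigen 2)
  qed (simp add: tens_simps add)
qed (rule add)

end


section \<open>Products on graded tensor products\<close>

lemma component_cong: "(\<And>i. i < 3 \<Longrightarrow> G i = G' i) \<Longrightarrow> component G = component G'"
  by (simp add: component_def decomposes_def fun_eq_iff)

text \<open>Needed because \<open>GL_grade\<close> and the eigenspaces of the grading operator agree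
  only for degrees below 3: from there on the former are zero, whereas the latter repeat
  periodically.\<close>

lemma graded_mult_cong:
  "(\<And>i. i < 3 \<Longrightarrow> GW i = GW' i) \<Longrightarrow> (\<And>i. i < 3 \<Longrightarrow> GV i = GV' i) \<Longrightarrow>
    graded_mult q GW GV m n = graded_mult q GW' GV' m n"
  unfolding graded_mult_def[abs_def] by (simp add: component_cong[of GW GW'] component_cong[of GV GV'])

lemma tensor_lift_quadrilinear:
  assumes F: "\<And>x y. bilinear (F x y)" "\<And>x y. bilinear (\<lambda>x' y'. F x' y' x y)"
  shows "bilinear (\<lambda>s u. tensor_lift (\<lambda>x y. tensor_lift (F x y) u) s)"
    and "tensor_lift (\<lambda>x y. tensor_lift (F x y) (x' \<otimes> y')) (x \<otimes> y) = F x y x' y'"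
proof -
  have "F (x + x') y = (\<lambda>a b. F x y a b + F x' y a b)" "F (c *\<^sub>C x) y = (\<lambda>a b. c *\<^sub>C F x y a b)"
    "F x (y + y') = (\<lambda>a b. F x y a b + F x y' a b)" "F x (c *\<^sub>C y) = (\<lambda>a b. c *\<^sub>C F x y a b)"
    for x x' y y' c
    by (simp_all add: fun_eq_iff bilinear_simps[OF F(2)])
  then have b: "bilinear (\<lambda>x y. tensor_lift (F x y) u)" for u
    by (intro bilinearI) (simp_all add: tensor_lift_plus tensor_lift_scaleC F(1))
  show "bilinear (\<lambda>s u. tensor_lift (\<lambda>x y. tensor_lift (F x y) u) s)"
    by (rule bilinearI)
      (simp_all add: clinear_simps clinear_tensor_lift b F(1) tensor_lift_plus tensor_lift_scaleC)
  show "tensor_lift (\<lambda>x y. tensor_lift (F x y) (x' \<otimes> y')) (x \<otimes> y) = F x y x' y'"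
    by (simp add: tensor_lift_tens b F)
qed

context cubic_root
begin

abbreviation gmult where
  "gmult \<rho> \<sigma> \<equiv> graded_mult q (eigengrade \<rho>) (eigengrade \<sigma>)"

lemma
  assumes "Z3_operator \<rho>" "Z3_operator \<sigma>" "bilinear m" "bilinear n"
  shows bilinear_gmult: "bilinear (gmult \<rho> \<sigma> m n)"
    and gmult_tens_eigenproj: "gmult \<rho> \<sigma> m n (x \<otimes> y) (x' \<otimes> y') =
      (\<Sum>i<3. \<Sum>j<3. q ^ (i * j) *\<^sub>C (m x (eigenproj \<sigma> j x') \<otimes> n (eigenproj \<rho> i y) y'))"
proof -
  let ?F = "\<lambda>x y x' y'. \<Sum>i<3. \<Sum>j<3. q ^ (i * j) *\<^sub>C
    (m x (eigenproj \<sigma> j x') \<otimes> n (eigenproj \<rho> i y) y')"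
  have eq: "gmult \<rho> \<sigma> m n = (\<lambda>s u. tensor_lift (\<lambda>x y. tensor_lift (?F x y) u) s)"
    unfolding graded_mult_def[abs_def]
    by (intro ext arg_cong2[where f = tensor_lift] sum.cong refl)
      (simp add: component_eigengrade assms)
  note simps = bilinear_simps[OF assms(3)] bilinear_simps[OF assms(4)] tens_simps
    clinear_simps[OF clinear_eigenproj[OF assms(1)]] clinear_simps[OF clinear_eigenproj[OF assms(2)]]
    scaleC_add_right sum.distrib complex_space.scale_sum_right scaleC_scaleC mult.commute
  have F: "bilinear (?F x y)" "bilinear (\<lambda>x y. ?F x y x' y')" for x y x' y'
    by (rule bilinearI; simp only: simps)+
  show "bilinear (gmult \<rho> \<sigma> m n)"
    unfolding eq by (rule tensor_lift_quadrilinear(1)) (rule F)+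
  show "gmult \<rho> \<sigma> m n (x \<otimes> y) (x' \<otimes> y') = ?F x y x' y'"
    unfolding eq by (rule tensor_lift_quadrilinear(2)) (rule F)+
qed

text \<open>Only the inner factors y and x' cross each other, so their homogeneity suffices, and it
  leaves a single summand of the double sum.\<close>

lemma gmult_tens:
  assumes \<rho>: "Z3_operator \<rho>" and \<sigma>: "Z3_operator \<sigma>" and mn: "bilinear m" "bilinear n"
    and y: "y \<in> eigengrade \<rho> i" and x': "x' \<in> eigengrade \<sigma> j"
  shows "gmult \<rho> \<sigma> m n (x \<otimes> y) (x' \<otimes> y') = q ^ (i * j) *\<^sub>C (m x x' \<otimes> n y y')"
proof -
  let ?i = "i mod 3" and ?j = "j mod 3"
  have *: "eigenproj \<rho> i' y = (if i' = ?i then y else 0)" "eigenproj \<sigma> i' x' = (if i' = ?j then x' else 0)"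
    if "i' < 3" for i'
    using that eigenproj_eigen[OF \<rho>, of y ?i i'] eigenproj_eigen[OF \<sigma>, of x' ?j i'] y x'
    by (auto simp: eigengrade_mod)
  have "gmult \<rho> \<sigma> m n (x \<otimes> y) (x' \<otimes> y')
      = (\<Sum>i'<3. \<Sum>j'<3. if j' = ?j then if i' = ?i then q ^ (i' * j') *\<^sub>C (m x x' \<otimes> n y y') else 0 else 0)"
    unfolding gmult_tens_eigenproj[OF \<rho> \<sigma> mn]
    by (intro sum.cong refl) (auto simp: * tens_simps bilinear_simps[OF mn(1)] bilinear_simps[OF mn(2)])
  also have "\<dots> = q ^ (?i * ?j) *\<^sub>C (m x x' \<otimes> n y y')"
    by (simp add: sum.delta)
  \<comment> \<open>Degrees may be arbitrary natural numbers, since a power of q depends on its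
    exponent only modulo 3. This lets degrees be added later without reduction.\<close>
  also have "q ^ (?i * ?j) = q ^ (i * j)"
    by (rule q_cong) (simp add: mod_mult_eq)
  finally show ?thesis .
qed

lemma Z3_operator_tensor_map:
  assumes "Z3_operator \<rho>" "Z3_operator \<sigma>"
  shows "Z3_operator (tensor_map \<rho> \<sigma>)"
proof -
  have c: "clinear \<rho>" "clinear \<sigma>" using assms by (simp_all add: Z3_operator_def)
  then have "clinear (tensor_map \<rho> \<sigma>)" by (rule clinear_tensor_map)
  moreover from this have "tensor_map \<rho> \<sigma> (tensor_map \<rho> \<sigma> (tensor_map \<rho> \<sigma> u)) = u" for u
    using assms
    by (induct u rule: tensor_induct) (simp_all add: clinear_simps tensor_map_tens c Z3_operator_def)
  ultimately show ?thesis by (simp add: Z3_operator_def)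
qed

lemma tens_in_eigengrade:
  assumes "clinear \<rho>" "clinear \<sigma>" "x \<in> eigengrade \<rho> i" "y \<in> eigengrade \<sigma> j"
  shows "x \<otimes> y \<in> eigengrade (tensor_map \<rho> \<sigma>) (i + j)"
  using assms by (simp add: eigengrade_def tensor_map_tens tens_simps scaleC_scaleC power_add)

text \<open>Additivity of degrees under m, phrased as one equation between maps instead of a
  condition on homogeneous elements.\<close>

definition graded_bilinear where
  "graded_bilinear \<rho> \<sigma> \<tau> m \<longleftrightarrow> Z3_operator \<rho> \<and> Z3_operator \<sigma> \<and> Z3_operator \<tau> \<and> bilinear m \<and>
    (\<forall>x y. \<tau> (m x y) = m (\<rho> x) (\<sigma> y))"

lemma graded_bilinear_eigen:
  assumes "graded_bilinear \<rho> \<sigma> \<tau> m" "x \<in> eigengrade \<rho> i" "y \<in> eigengrade \<sigma> j"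
  shows "m x y \<in> eigengrade \<tau> (i + j)"
  using assms
  by (simp add: eigengrade_def graded_bilinear_def bilinear_simps scaleC_scaleC power_add mult.commute)

lemma graded_bilinear_gmult:
  assumes m: "graded_bilinear \<rho>1 \<rho>2 \<rho>3 m" and n: "graded_bilinear \<sigma>1 \<sigma>2 \<sigma>3 n"
  shows "graded_bilinear (tensor_map \<rho>1 \<sigma>1) (tensor_map \<rho>2 \<sigma>2) (tensor_map \<rho>3 \<sigma>3)
    (gmult \<sigma>1 \<rho>2 m n)"
proof -
  have Z: "Z3_operator \<rho>1" "Z3_operator \<rho>2" "Z3_operator \<rho>3" "bilinear m"
    "Z3_operator \<sigma>1" "Z3_operator \<sigma>2" "Z3_operator \<sigma>3" "bilinear n"
    using m n by (auto simp: graded_bilinear_def)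
  note c = Z(1-3,5-7)[THEN Z3_operator_clinear]
  note b = bilinear_gmult[OF Z(5,2,4,8)]
  have "tensor_map \<rho>3 \<sigma>3 (gmult \<sigma>1 \<rho>2 m n s u)
      = gmult \<sigma>1 \<rho>2 m n (tensor_map \<rho>1 \<sigma>1 s) (tensor_map \<rho>2 \<sigma>2 u)" for s u
  proof (induct s rule: tensor_eigen_induct[OF Z(1,5)])
    case (2 i j x y)
    note xy = this
    show ?case
    proof (induct u rule: tensor_eigen_induct[OF Z(2,6)])
      case (2 k l x' y')
      have "\<sigma>1 y \<in> eigengrade \<sigma>1 j" "\<rho>2 x' \<in> eigengrade \<rho>2 k"
        using xy 2 c by (simp_all add: eigengrade_def clinear_simps)
      then show ?case
        using m n xy 2
        by (simp add: gmult_tens[OF Z(5,2,4,8)] tensor_map_tens c graded_bilinear_def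
            clinear_simps clinear_tensor_map)
    qed (simp add: c clinear_tensor_map clinear_simps bilinear_simps[OF b])
  qed (simp add: c clinear_tensor_map clinear_simps bilinear_simps[OF b])
  then show ?thesis
    by (simp add: graded_bilinear_def Z Z3_operator_tensor_map b)
qed

text \<open>On homogeneous tensors both sides carry the exponent
  \<open>j1 * i2 + j1 * i3 + j2 * i3\<close>. The bilinear maps may all differ, so that one
  statement covers the product of the tensor square, its left and right actions on forms, and the
  compatibility of these actions.\<close>

lemma gmult_assoc:
  assumes m: "bilinear m12" "bilinear m123" "graded_bilinear \<rho>2 \<rho>3 \<rho>23 m23" "bilinear m1"
    and n: "graded_bilinear \<sigma>1 \<sigma>2 \<sigma>12 n12" "bilinear n123" "bilinear n23" "bilinear n1"
    and massoc: "\<And>x y z. m123 (m12 x y) z = m1 x (m23 y z)"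
    and nassoc: "\<And>x y z. n123 (n12 x y) z = n1 x (n23 y z)"
  shows "gmult \<sigma>12 \<rho>3 m123 n123 (gmult \<sigma>1 \<rho>2 m12 n12 s u) v
    = gmult \<sigma>1 \<rho>23 m1 n1 s (gmult \<sigma>2 \<rho>3 m23 n23 u v)"
proof -
  have Z': "Z3_operator \<rho>2" "Z3_operator \<rho>3" "Z3_operator \<rho>23" "bilinear m23"
    "Z3_operator \<sigma>1" "Z3_operator \<sigma>2" "Z3_operator \<sigma>12" "bilinear n12"
    using m n by (auto simp: graded_bilinear_def)
  note g = gmult_tens[OF Z'(7,2) m(2) n(2)] gmult_tens[OF Z'(5,1) m(1) Z'(8)]
    gmult_tens[OF Z'(5,3) m(4) n(4)] gmult_tens[OF Z'(6,2) Z'(4) n(3)]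
  note b = bilinear_simps[OF bilinear_gmult[OF Z'(7,2) m(2) n(2)]]
    bilinear_simps[OF bilinear_gmult[OF Z'(5,1) m(1) Z'(8)]]
    bilinear_simps[OF bilinear_gmult[OF Z'(5,3) m(4) n(4)]]
    bilinear_simps[OF bilinear_gmult[OF Z'(6,2) Z'(4) n(3)]]
  \<comment> \<open>The outermost factors cross nothing. The identity operator gives them the
    trivial grading, so that the induction over homogeneous tensors still applies.\<close>
  have id: "Z3_operator (\<lambda>x. x)" by (simp add: Z3_operator_def clinear_id)
  show ?thesis
  proof (induct s rule: tensor_eigen_induct[OF id Z'(5)])
    case (2 i1 j1 x1 y1)
    note 1 = this
    show ?case
    proof (induct u rule: tensor_eigen_induct[OF Z'(1) Z'(6)])
      case (2 i2 j2 x2 y2)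
      note 2 = this
      show ?case
      proof (induct v rule: tensor_eigen_induct[OF Z'(2) id])
        case (2 i3 j3 x3 y3)
        have "n12 y1 y2 \<in> eigengrade \<sigma>12 (j1 + j2)" "m23 x2 x3 \<in> eigengrade \<rho>23 (i2 + i3)"
          using 1 \<open>x2 \<in> _\<close> \<open>y2 \<in> _\<close> 2 by (auto intro: graded_bilinear_eigen m n)
        then show ?case
          using 1 \<open>x2 \<in> _\<close> \<open>y2 \<in> _\<close> 2
          by (simp add: g b massoc nassoc scaleC_scaleC algebra_simps flip: power_add)
      qed (simp add: b)
    qed (simp add: b)
  qed (simp add: b)
qed

text \<open>The maps \<open>h1\<close> and \<open>f2\<close> act on the inner factors, whose degrees
  determine the power of q; hence these two have to respect the gradings.\<close>

lemma gmult_map: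
  assumes Z: "Z3_operator \<rho>" "Z3_operator \<sigma>" "Z3_operator \<rho>'" "Z3_operator \<sigma>'"
    and b: "bilinear m" "bilinear n" "bilinear m'" "bilinear n'"
    and c: "clinear f1" "clinear f2" "clinear f3" "clinear h1" "clinear h2" "clinear h3"
    and m: "\<And>x y. f3 (m x y) = m' (f1 x) (f2 y)" and n: "\<And>x y. h3 (n x y) = n' (h1 x) (h2 y)"
    and h1: "\<And>y. h1 (\<rho> y) = \<rho>' (h1 y)" and f2: "\<And>y. f2 (\<sigma> y) = \<sigma>' (f2 y)"
  shows "tensor_map f3 h3 (gmult \<rho> \<sigma> m n s u) = gmult \<rho>' \<sigma>' m' n' (tensor_map f1 h1 s) (tensor_map f2 h2 u)"
proof -
  note bs = bilinear_simps[OF bilinear_gmult[OF Z(1,2) b(1,2)]]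
    bilinear_simps[OF bilinear_gmult[OF Z(3,4) b(3,4)]]
  have id: "Z3_operator (\<lambda>x. x)" by (simp add: Z3_operator_def clinear_id)
  show ?thesis
  proof (induct s rule: tensor_eigen_induct[OF id Z(1)])
    case (2 i j x y)
    note xy = this
    show ?case
    proof (induct u rule: tensor_eigen_induct[OF Z(2) id])
      case (2 k l x' y')
      have "h1 y \<in> eigengrade \<rho>' j" "f2 x' \<in> eigengrade \<sigma>' k"
        using xy 2 c by (simp_all add: eigengrade_def clinear_simps flip: h1 f2)
      then show ?case
        using xy 2 by (simp add: gmult_tens[OF Z(1,2) b(1,2)] gmult_tens[OF Z(3,4) b(3,4)]
            tensor_map_tens c clinear_simps clinear_tensor_map m n)
    qed (simp add: c clinear_tensor_map clinear_simps bs)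
  qed (simp add: c clinear_tensor_map clinear_simps bs)
qed

text \<open>Both bracketings produce the same three crossings, with total exponent
  \<open>l1 * i2 + j1 * i2 + j1 * l2\<close> on homogeneous tensors.\<close>

lemma tensor_assoc_gmult:
  assumes k: "graded_bilinear \<upsilon>1 \<upsilon>2 \<upsilon>3 k" and m: "graded_bilinear \<rho>1 \<rho>2 \<rho>3 m"
    and n: "graded_bilinear \<sigma>1 \<sigma>2 \<sigma>3 n"
  shows "tensor_assoc (gmult \<sigma>1 (tensor_map \<upsilon>2 \<rho>2) (gmult \<rho>1 \<upsilon>2 k m) n s u)
    = gmult (tensor_map \<rho>1 \<sigma>1) \<upsilon>2 k (gmult \<sigma>1 \<rho>2 m n) (tensor_assoc s) (tensor_assoc u)"
proof -
  have Z: "Z3_operator \<upsilon>1" "Z3_operator \<upsilon>2" "bilinear k" "Z3_operator \<rho>1" "Z3_operator \<rho>2" "bilinear m"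
    "Z3_operator \<sigma>1" "Z3_operator \<sigma>2" "bilinear n"
    using k m n by (auto simp: graded_bilinear_def)
  note c = Z(1,2,4,5,7,8)[THEN Z3_operator_clinear]
  note T = Z3_operator_tensor_map[OF Z(2,5)] Z3_operator_tensor_map[OF Z(4,7)]
    Z3_operator_tensor_map[OF Z(1,4)] Z3_operator_tensor_map[OF Z(5,8)]
  note b = bilinear_gmult[OF Z(4,2) Z(3,6)] bilinear_gmult[OF Z(7,5) Z(6,9)]
  note b' = bilinear_gmult[OF Z(7) T(1) b(1) Z(9)] bilinear_gmult[OF T(2) Z(2) Z(3) b(2)]
  note g = gmult_tens[OF Z(7) T(1) b(1) Z(9)] gmult_tens[OF T(2) Z(2) Z(3) b(2)]
    gmult_tens[OF Z(4,2) Z(3,6)] gmult_tens[OF Z(7,5) Z(6,9)]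
  note bs = bilinear_simps[OF b(1)] bilinear_simps[OF b(2)] bilinear_simps[OF b'(1)]
    bilinear_simps[OF b'(2)] clinear_simps[OF clinear_tensor_assoc] tens_simps
  show ?thesis
  proof (induct s rule: tensor_eigen_induct[OF T(3) Z(7)])
    case (2 _ j1 v z1)
    note z1 = 2(2)
    show ?case
    proof (induct v rule: tensor_eigen_induct[OF Z(1,4)])
      case (2 i1 l1 x1 y1)
      note xy1 = this
      show ?case
      proof (induct u rule: tensor_eigen_induct[OF T(1) Z(8)])
        case (2 _ j2 w z2)
        show ?case
        proof (induct w rule: tensor_eigen_induct[OF Z(2,5)])
          case (2 i2 l2 x2 y2)
          have "x2 \<otimes> y2 \<in> eigengrade (tensor_map \<upsilon>2 \<rho>2) (i2 + l2)"
            "y1 \<otimes> z1 \<in> eigengrade (tensor_map \<rho>1 \<sigma>1) (l1 + j1)"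
            using 2 xy1 z1 by (auto intro!: tens_in_eigengrade c)
          then show ?case
            using 2 xy1 z1
            by (simp add: g bs tensor_assoc_tens scaleC_scaleC algebra_simps flip: power_add)
        qed (simp add: bs)
      qed (simp add: bs)
    qed (simp add: bs)
  qed (simp add: bs)
qed

end

section \<open>The algebra and its universal property\<close>

text \<open>The six relations without \<open>Inv\<close> stand apart because their consequences,
  such as the formula for the cube of the determinant, are applied to operators before an inverse
  has been built.\<close>

definition Mq2_relations :: "complex \<Rightarrow> (letter \<Rightarrow> 'b::complex_algebra_1) \<Rightarrow> bool"
  where "Mq2_relations q h \<longleftrightarrow>
    (let a = h (Gen Gen_a); b = h (Gen Gen_b); c = h (Gen Gen_c); d = h (Gen Gen_d) in
      a * b = b * a \<and> a * c = q *\<^sub>C (c * a) \<and> b * c = c * b \<and> d * c = q\<^sup>2 *\<^sub>C (c * d) \<and>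
      b * d = d * b \<and> a * d = d * a + (q - 1) *\<^sub>C (b * c))"

definition GLq2_relations :: "complex \<Rightarrow> (letter \<Rightarrow> 'b::complex_algebra_1) \<Rightarrow> bool"
  where "GLq2_relations q h \<longleftrightarrow> Mq2_relations q h \<and>
    (\<forall>k. h Inv * h (Gen k) = h (Gen k) * h Inv) \<and>
    h Inv * (h (Gen Gen_a) * h (Gen Gen_d) - q *\<^sub>C (h (Gen Gen_b) * h (Gen Gen_c))) = 1"

lemma all_gen: "(\<forall>k. P k) \<longleftrightarrow> P Gen_a \<and> P Gen_b \<and> P Gen_c \<and> P Gen_d"
  by (metis gen.exhaust)

lemma GLq2_relations_iff:
  "GLq2_relations q h \<longleftrightarrow> (\<forall>r \<in> GLq2_relators q. evaluate h r = 0)"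
  by (simp add: GLq2_relations_def Mq2_relations_def all_gen conj_assoc
      GLq2_relators_def Let_def evaluate_add evaluate_diff evaluate_mult
      evaluate_scaleC evaluate_var evaluate_one)

definition algebra_hom :: "('a::complex_algebra_1 \<Rightarrow> 'b::complex_algebra_1) \<Rightarrow> bool"
  where "algebra_hom \<phi> \<longleftrightarrow> clinear \<phi> \<and> \<phi> 1 = 1 \<and> (\<forall>x y. \<phi> (x * y) = \<phi> x * \<phi> y)"

lemmas scaleC_simps = scaleC_add_right complex_space.scale_right_diff_distrib
  complex_space.scale_minus_right scaleC_mult_left scaleC_mult_right

locale GLq2 = cubic_root q for q +
  fixes g :: "letter \<Rightarrow> 'a::complex_algebra_1"
  assumes GLq2: "is_GLq2 q g"
begin

abbreviation (input) "ga \<equiv> g (Gen Gen_a)"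
abbreviation (input) "gb \<equiv> g (Gen Gen_b)"
abbreviation (input) "gc \<equiv> g (Gen Gen_c)"
abbreviation (input) "gd \<equiv> g (Gen Gen_d)"
abbreviation (input) "gt \<equiv> g Inv"
abbreviation (input) "qdet \<equiv> ga * gd - q *\<^sub>C (gb * gc)"

lemma scaleC_q_q: "q *\<^sub>C q *\<^sub>C x = - x - q *\<^sub>C x" "(q * q) *\<^sub>C x = - x - q *\<^sub>C x"
  and scaleC_q2: "q\<^sup>2 *\<^sub>C x = - x - q *\<^sub>C x"
  and scaleC_q_1: "(q - 1) *\<^sub>C x = q *\<^sub>C x - x"
  by (simp_all add: scaleC_scaleC qq q2 complex_space.scale_left_diff_distrib scaleC_one)

text \<open>\<open>evaluate h\<close> vanishes on the relators and hence on the ideal they generate,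
  which is the kernel of \<open>evaluate g\<close>. Its value is therefore independent of the
  preimage chosen under \<open>evaluate g\<close>.\<close>

lemma hom_exists:
  fixes h :: "letter \<Rightarrow> 'b::complex_algebra_1"
  assumes "GLq2_relations q h"
  shows "\<exists>\<phi>. algebra_hom \<phi> \<and> (\<forall>l. \<phi> (g l) = h l)"
proof -
  have surj: "surj (evaluate g)" and ker: "evaluate g f = 0 \<longleftrightarrow> f \<in> ideal_generated (GLq2_relators q)" for f
    using GLq2 by (auto simp: is_GLq2_def)
  have 0: "evaluate h f = 0" if "f \<in> ideal_generated (GLq2_relators q)" for f
    using that assms by induct (simp_all add: GLq2_relations_iff evaluate_add evaluate_mult evaluate_zero)
  define \<phi> where "\<phi> x = evaluate h (SOME f. evaluate g f = x)" for x
  have \<phi>: "\<phi> (evaluate g f) = evaluate h f" for f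
  proof -
    have "evaluate g (SOME f'. evaluate g f' = evaluate g f) = evaluate g f"
      by (rule someI) (rule refl)
    then show ?thesis
      using 0[of "(SOME f'. evaluate g f' = evaluate g f) - f"]
      by (simp add: \<phi>_def evaluate_diff flip: ker)
  qed
  have "algebra_hom \<phi>"
    unfolding algebra_hom_def
  proof (intro conjI allI clinearI)
    fix x y :: 'a and c
    obtain f k where [simp]: "x = evaluate g f" "y = evaluate g k"
      using surj by (metis surjD)
    show "\<phi> (x + y) = \<phi> x + \<phi> y" "\<phi> (c *\<^sub>C x) = c *\<^sub>C \<phi> x" "\<phi> (x * y) = \<phi> x * \<phi> y"
      using \<phi>[of "f + k"] \<phi>[of "c *\<^sub>C f"] \<phi>[of "f * k"]
      by (simp_all add: \<phi> evaluate_add evaluate_scaleC evaluate_mult)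
    show "\<phi> 1 = 1" using \<phi>[of 1] by (simp add: evaluate_one)
  qed
  moreover have "\<phi> (g l) = h l" for l
    using \<phi>[of "var l"] by (simp add: evaluate_var)
  ultimately show ?thesis by blast
qed

lemma relations: "GLq2_relations q g"
  using GLq2 ideal_generated.gen[of _ "GLq2_relators q"]
  by (auto simp: GLq2_relations_iff is_GLq2_def)

lemma letter_induct [case_names one add scale mult]:
  assumes "P 1" "\<And>x y. P x \<Longrightarrow> P y \<Longrightarrow> P (x + y)" "\<And>c x. P x \<Longrightarrow> P (c *\<^sub>C x)"
    and "\<And>l x. P x \<Longrightarrow> P (g l * x)"
  shows "P x"
proof -
  obtain f where f: "x = evaluate g f"
    using GLq2 by (metis is_GLq2_def surjD)
  have words: "P (prod_list (map g ls))" for ls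
    by (induct ls) (simp_all add: assms)
  have "P (\<Sum>w\<in>K. k w *\<^sub>C prod_list (map g (letters w)))" if "finite K" for K k
    using that by (induct K) (use assms(1-3) assms(3)[of 1 0] words in \<open>simp_all\<close>)
  then show ?thesis by (simp add: f evaluate_def)
qed

lemma qdet_inverse: "gt * qdet = 1" "qdet * gt = 1"
proof -
  show "gt * qdet = 1"
    using relations unfolding GLq2_relations_def Mq2_relations_def all_gen Let_def by blast
  moreover have "ga * (gd * gt) = gt * (ga * gd)" "gb * (gc * gt) = gt * (gb * gc)"
    using relations unfolding GLq2_relations_def Mq2_relations_def all_gen Let_def by (metis mult.assoc)+
  then have "qdet * gt = gt * qdet"
    by (simp add: left_diff_distrib right_diff_distrib scaleC_mult_left scaleC_mult_right mult.assoc)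
  ultimately show "qdet * gt = 1" by simp
qed

text \<open>A rewriting system that sorts monomials into the order b, c, a, d, with
  \<open>q\<^sup>2\<close> already replaced by - 1 - q so that coefficients become unique as well.
  The second half repeats each rule with a tail x, as products are associated to the right.\<close>

lemma normal_order:
  fixes h :: "letter \<Rightarrow> 'b::complex_algebra_1"
  defines "a \<equiv> h (Gen Gen_a)" and "b \<equiv> h (Gen Gen_b)" and "c \<equiv> h (Gen Gen_c)" and "d \<equiv> h (Gen Gen_d)"
  assumes "Mq2_relations q h"
  shows "a * b = b * a" "c * b = b * c" "d * b = b * d" "a * c = q *\<^sub>C (c * a)"
    "d * c = - (c * d) - q *\<^sub>C (c * d)" "d * a = a * d + b * c - q *\<^sub>C (b * c)"
    and "a * (b * x) = b * (a * x)" "c * (b * x) = b * (c * x)" "d * (b * x) = b * (d * x)"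
    "a * (c * x) = q *\<^sub>C (c * (a * x))" "d * (c * x) = - (c * (d * x)) - q *\<^sub>C (c * (d * x))"
    "d * (a * x) = a * (d * x) + b * (c * x) - q *\<^sub>C (b * (c * x))"
proof -
  have r: "a * b = b * a" "c * b = b * c" "d * b = b * d" "a * c = q *\<^sub>C (c * a)"
    "d * c = - (c * d) - q *\<^sub>C (c * d)" "d * a = a * d + b * c - q *\<^sub>C (b * c)"
    using assms(5) by (simp_all add: assms(1-4) Mq2_relations_def Let_def scaleC_q2 scaleC_q_1)
  then show "a * b = b * a" "c * b = b * c" "d * b = b * d" "a * c = q *\<^sub>C (c * a)"
    "d * c = - (c * d) - q *\<^sub>C (c * d)" "d * a = a * d + b * c - q *\<^sub>C (b * c)"
    by -
  show "a * (b * x) = b * (a * x)" "c * (b * x) = b * (c * x)" "d * (b * x) = b * (d * x)"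
    "a * (c * x) = q *\<^sub>C (c * (a * x))" "d * (c * x) = - (c * (d * x)) - q *\<^sub>C (c * (d * x))"
    "d * (a * x) = a * (d * x) + b * (c * x) - q *\<^sub>C (b * (c * x))"
    unfolding mult.assoc[symmetric] r
    by (simp_all add: algebra_simps scaleC_mult_left)
qed

lemma Mq2_relations_g: "Mq2_relations q g"
  using relations by (simp add: GLq2_relations_def)

lemmas normal_order_g = normal_order[OF Mq2_relations_g]

lemmas normalize = mult.assoc left_diff_distrib right_diff_distrib distrib_left distrib_right
  minus_mult_left[symmetric] minus_mult_right[symmetric] scaleC_simps scaleC_q_q

text \<open>Behind the last identity: with v = b c one has a v = q v a and a d = D + q v. Hence
  \<open>a^3 d^3 = (D + v) (D + q v) (D + q^2 v) = D^3 + v^3\<close>, the mixed terms dropping out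
  because the cubic roots of unity sum to zero.\<close>

lemma qdet_relations:
  fixes h :: "letter \<Rightarrow> 'b::complex_algebra_1"
  defines "a \<equiv> h (Gen Gen_a)" and "b \<equiv> h (Gen Gen_b)" and "c \<equiv> h (Gen Gen_c)" and "d \<equiv> h (Gen Gen_d)"
  assumes rels: "Mq2_relations q h"
  defines "D \<equiv> a * d - q *\<^sub>C (b * c)"
  shows "D * a = a * D" "D * b = b * D" "D * c = c * D" "D * d = d * D"
    and "D * (D * D) = a * (a * (a * (d * (d * d)))) - b * (b * (b * (c * (c * c))))"
  unfolding D_def a_def b_def c_def d_def
  by (simp_all add: normal_order[OF rels] normalize algebra_simps del: complex_space.scale_scale)


section \<open>Grading, counit and coproduct\<close>

text \<open>All relations are homogeneous modulo 3. The only point to watch is that \<beta>\<gamma>,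
  of degree 2 + 1, must scale like the products of degree 0 with which it is added.\<close>

lemma letter_scale_relations: "GLq2_relations q (\<lambda>l. q ^ deg l *\<^sub>C g l)"
proof -
  have "q * q\<^sup>2 = 1" "q\<^sup>2 * q = 1"
    using q3 by (simp_all add: power3_eq_cube power2_eq_square mult.assoc)
  then have bc: "(q\<^sup>2 *\<^sub>C gb) * (q *\<^sub>C gc) = gb * gc" "(q *\<^sub>C gc) * (q\<^sup>2 *\<^sub>C gb) = gc * gb"
    by (simp_all only: scaleC_mult_left scaleC_mult_right scaleC_scaleC scaleC_one)
  have r: "ga * gb = gb * ga" "ga * gc = q *\<^sub>C (gc * ga)" "gb * gc = gc * gb" "gd * gc = q\<^sup>2 *\<^sub>C (gc * gd)"
    "gb * gd = gd * gb" "ga * gd = gd * ga + (q - 1) *\<^sub>C (gb * gc)" "gt * ga = ga * gt" "gt * gb = gb * gt"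
    "gt * gc = gc * gt" "gt * gd = gd * gt" "gt * qdet = 1"
    using relations unfolding GLq2_relations_def Mq2_relations_def all_gen Let_def by blast+
  show ?thesis
    unfolding GLq2_relations_def Mq2_relations_def all_gen Let_def deg.simps power_0 power_one_right scaleC_one bc
    by (intro conjI; (fact r | simp only: scaleC_mult_left scaleC_mult_right scaleC_scaleC r mult.commute))
qed

definition \<tau> :: "'a \<Rightarrow> 'a"
  where "\<tau> = (SOME \<phi>. algebra_hom \<phi> \<and> (\<forall>l. \<phi> (g l) = q ^ deg l *\<^sub>C g l))"

lemma tau: "clinear \<tau>" "\<tau> 1 = 1" "\<tau> (x * y) = \<tau> x * \<tau> y" "\<tau> (g l) = q ^ deg l *\<^sub>C g l"
proof -
  have "algebra_hom \<tau> \<and> (\<forall>l. \<tau> (g l) = q ^ deg l *\<^sub>C g l)"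
    unfolding \<tau>_def by (rule someI_ex[OF hom_exists[OF letter_scale_relations]])
  then show "clinear \<tau>" "\<tau> 1 = 1" "\<tau> (x * y) = \<tau> x * \<tau> y" "\<tau> (g l) = q ^ deg l *\<^sub>C g l"
    by (auto simp: algebra_hom_def)
qed

lemma Z3_operator_tau: "Z3_operator \<tau>"
proof -
  have "\<tau> (\<tau> (\<tau> x)) = x" for x
  proof (induct x rule: letter_induct)
    case (mult l x)
    have "q ^ deg l * (q ^ deg l * q ^ deg l) = 1"
      using q_powers(4)[of "deg l"] by (simp add: power_mult power3_eq_cube mult.assoc)
    then show ?case
      using mult
      by (simp add: tau clinear_simps scaleC_mult_left scaleC_scaleC scaleC_one mult.assoc)
  qed (simp_all add: tau clinear_simps)
  then show ?thesis by (simp add: Z3_operator_def tau)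
qed

lemma graded_times: "graded_bilinear \<tau> \<tau> \<tau> (*)"
  by (simp add: graded_bilinear_def Z3_operator_tau bilinear_times tau)

lemma one_in_eigengrade: "1 \<in> eigengrade \<tau> 0"
  and letter_in_eigengrade: "g l \<in> eigengrade \<tau> (deg l)"
  by (simp_all add: eigengrade_def tau scaleC_one)

lemma qdet_in_eigengrade: "qdet \<in> eigengrade \<tau> 0"
proof -
  have "ga * gd \<in> eigengrade \<tau> (0 + 0)" "gb * gc \<in> eigengrade \<tau> (2 + 1)"
    using letter_in_eigengrade[of "Gen Gen_a"] letter_in_eigengrade[of "Gen Gen_b"]
      letter_in_eigengrade[of "Gen Gen_c"] letter_in_eigengrade[of "Gen Gen_d"]
    by (intro graded_bilinear_eigen[OF graded_times]; simp)+
  then show ?thesis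
    using eigengrade_mod[of \<tau> 3]
    by (intro complex_space.subspace_diff complex_space.subspace_scale subspace_eigengrade[OF Z3_operator_tau])
      auto
qed

text \<open>The spans of words lie in the eigenspaces and together they exhaust the algebra. Since
  the decomposition into eigenvectors is unique, no eigenspace can be larger than its span of
  words.\<close>

lemma GL_grade_eq:
  assumes "i < 3"
  shows "GL_grade g i = eigengrade \<tau> i"
proof -
  have sub: "GL_grade g j \<subseteq> eigengrade \<tau> j" for j
    unfolding GL_grade_def
  proof (rule complex_space.span_minimal[OF _ subspace_eigengrade[OF Z3_operator_tau]], clarify)
    fix ls
    have "prod_list (map g ls) \<in> eigengrade \<tau> (sum_list (map deg ls))"
      by (induct ls)
        (simp_all add: one_in_eigengrade graded_bilinear_eigen[OF graded_times] letter_in_eigengrade)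
    then show "prod_list (map g ls) \<in> eigengrade \<tau> (sum_list (map deg ls) mod 3)"
      by (simp add: eigengrade_mod)
  qed
  have letter: "g l * x \<in> GL_grade g ((deg l + j) mod 3)" if "x \<in> GL_grade g j" for l x j
    using that unfolding GL_grade_def
  proof (induct rule: complex_space.span_induct_alt)
    case base
    show ?case by (simp add: complex_space.span_zero)
  next
    case (step c x y)
    then obtain ls where ls: "x = prod_list (map g ls)" "sum_list (map deg ls) mod 3 = j" by blast
    then have "g l * x = prod_list (map g (l # ls))" "sum_list (map deg (l # ls)) mod 3 = (deg l + j) mod 3"
      by (auto simp: mod_add_right_eq)
    then have "g l * x \<in> {prod_list (map g ls) |ls. sum_list (map deg ls) mod 3 = (deg l + j) mod 3}"
      by blast
    with step show ?case
      by (simp add: distrib_left scaleC_mult_right complex_space.span_add complex_space.span_scale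
          complex_space.span_base)
  qed
  have dec: "\<exists>c. decomposes (GL_grade g) x c" for x
  proof (induct x rule: letter_induct)
    case one
    have "1 \<in> GL_grade g 0"
      unfolding GL_grade_def by (rule complex_space.span_base) (auto intro!: exI[of _ "[]"])
    then have "decomposes (GL_grade g) 1 (\<lambda>i. if i = 0 then 1 else 0)"
      by (simp add: decomposes_def lessThan_3 GL_grade_def complex_space.span_zero)
    then show ?case by blast
  next
    case (add x y)
    then obtain c c' where "decomposes (GL_grade g) x c" "decomposes (GL_grade g) y c'" by blast
    then have "decomposes (GL_grade g) (x + y) (\<lambda>i. c i + c' i)"
      by (auto simp: decomposes_def sum.distrib GL_grade_def complex_space.span_add)
    then show ?case by blast
  next
    case (scale k x)
    then obtain c where "decomposes (GL_grade g) x c" by blast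
    then have "decomposes (GL_grade g) (k *\<^sub>C x) (\<lambda>i. k *\<^sub>C c i)"
      by (auto simp: decomposes_def complex_space.scale_sum_right GL_grade_def complex_space.span_scale)
    then show ?case by blast
  next
    case (mult l x)
    then obtain c where c: "decomposes (GL_grade g) x c" by blast
    \<comment> \<open>The index \<open>i + 2 * deg l\<close> is i - deg l modulo 3, written without
      subtraction.\<close>
    define c' where "c' i = (if i < 3 then g l * c ((i + 2 * deg l) mod 3) else 0)" for i
    have "c' i \<in> GL_grade g i" if "i < 3" for i
    proof -
      have "(deg l + (i + 2 * deg l) mod 3) mod 3 = i" using that by presburger
      moreover have "c ((i + 2 * deg l) mod 3) \<in> GL_grade g ((i + 2 * deg l) mod 3)"
        using c by (simp add: decomposes_def)
      ultimately show ?thesis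
        using letter[of "c ((i + 2 * deg l) mod 3)" "(i + 2 * deg l) mod 3" l] that
        by (simp only: c'_def if_True)
    qed
    moreover have "deg l \<in> {0, 1, 2}" by (cases l rule: deg.cases) auto
    then have "(\<Sum>i<3. c' i) = g l * (\<Sum>i<3. c i)"
      by (auto simp: lessThan_3 c'_def distrib_left algebra_simps numeral_2_eq_2)
    ultimately have "decomposes (GL_grade g) (g l * x) c'"
      using c by (simp add: decomposes_def c'_def)
    then show ?case by blast
  qed
  have "x \<in> GL_grade g i" if "x \<in> eigengrade \<tau> i" for x
  proof -
    obtain c where c: "decomposes (GL_grade g) x c" using dec by blast
    then have "decomposes (eigengrade \<tau>) x c" using sub by (auto simp: decomposes_def)
    then have "c i = x"
      using that assms by (simp add: decomposes_iff Z3_operator_tau eigenproj_eigen)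
    then show ?thesis using c assms by (auto simp: decomposes_def)
  qed
  with sub show ?thesis by blast
qed

definition \<epsilon> :: "'a \<Rightarrow> complex"
  where "\<epsilon> = (SOME \<phi>. algebra_hom \<phi> \<and> (\<forall>l. \<phi> (g l) = (if l \<in> {Gen Gen_b, Gen Gen_c} then 0 else 1)))"

lemma eps: "clinear \<epsilon>" "\<epsilon> 1 = 1" "\<epsilon> (x * y) = \<epsilon> x * \<epsilon> y"
  "\<epsilon> (g l) = (if l \<in> {Gen Gen_b, Gen Gen_c} then 0 else 1)"
proof -
  have rel: "GLq2_relations q (\<lambda>l. if l \<in> {Gen Gen_b, Gen Gen_c} then 0 else 1 :: complex)"
    by (simp add: GLq2_relations_def Mq2_relations_def)
  have "algebra_hom \<epsilon> \<and> (\<forall>l. \<epsilon> (g l) = (if l \<in> {Gen Gen_b, Gen Gen_c} then 0 else 1))"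
    unfolding \<epsilon>_def by (rule someI_ex[OF hom_exists[OF rel]])
  then show "clinear \<epsilon>" "\<epsilon> 1 = 1" "\<epsilon> (x * y) = \<epsilon> x * \<epsilon> y"
    "\<epsilon> (g l) = (if l \<in> {Gen Gen_b, Gen Gen_c} then 0 else 1)"
    by (auto simp: algebra_hom_def)
qed

lemma eps_tau: "\<epsilon> (\<tau> x) = \<epsilon> x"
proof (induct x rule: letter_induct)
  case (mult l x)
  then show ?case by (cases l rule: deg.cases) (simp_all add: tau eps clinear_simps scaleC_mult_left scaleC_one)
qed (simp_all add: tau eps clinear_simps)

lemma is_counit: "is_counit g \<epsilon>"
  by (simp add: is_counit_def eps tmat_def)

abbreviation tmult :: "('a, 'a) tensor \<Rightarrow> ('a, 'a) tensor \<Rightarrow> ('a, 'a) tensor" (infixl "\<bullet>" 75)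
  where "u \<bullet> v \<equiv> gmult \<tau> \<tau> (*) (*) u v"

lemmas bilinear_tmult =
  bilinear_gmult[OF Z3_operator_tau Z3_operator_tau bilinear_times bilinear_times]
lemmas tmult_simps = bilinear_simps[OF bilinear_tmult]
lemmas tmult_tens = gmult_tens[OF Z3_operator_tau Z3_operator_tau bilinear_times bilinear_times]

lemma tmult_assoc: "u \<bullet> v \<bullet> w = u \<bullet> (v \<bullet> w)"
  by (rule gmult_assoc) (simp_all add: graded_times bilinear_times mult.assoc)

lemma tmult_one: "(1 \<otimes> 1) \<bullet> u = u" "u \<bullet> (1 \<otimes> 1) = u"
proof -
  show "(1 \<otimes> 1) \<bullet> u = u"
    by (induct u rule: tensor_eigen_induct[OF Z3_operator_tau Z3_operator_tau])
      (simp_all add: tmult_simps tmult_tens[OF one_in_eigengrade] scaleC_one)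
  show "u \<bullet> (1 \<otimes> 1) = u"
    by (induct u rule: tensor_eigen_induct[OF Z3_operator_tau Z3_operator_tau])
      (simp_all add: tmult_simps tmult_tens[OF _ one_in_eigengrade] scaleC_one)
qed

text \<open>The value at \<open>Inv\<close> is dictated by the determinant being group-like, which
  is the last identity of \<open>cop_relations\<close>.\<close>

fun cop :: "letter \<Rightarrow> ('a, 'a) tensor" where
  "cop (Gen Gen_a) = ga \<otimes> ga + gb \<otimes> gc"
| "cop (Gen Gen_b) = ga \<otimes> gb + gb \<otimes> gd"
| "cop (Gen Gen_c) = gc \<otimes> ga + gd \<otimes> gc"
| "cop (Gen Gen_d) = gc \<otimes> gb + gd \<otimes> gd"
| "cop Inv = gt \<otimes> gt"

lemmas tmult_letters = tmult_tens[OF letter_in_eigengrade letter_in_eigengrade]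

lemma cop_relations:
  "cop (Gen Gen_a) \<bullet> cop (Gen Gen_b) = cop (Gen Gen_b) \<bullet> cop (Gen Gen_a)"
  "cop (Gen Gen_a) \<bullet> cop (Gen Gen_c) = q *\<^sub>C (cop (Gen Gen_c) \<bullet> cop (Gen Gen_a))"
  "cop (Gen Gen_b) \<bullet> cop (Gen Gen_c) = cop (Gen Gen_c) \<bullet> cop (Gen Gen_b)"
  "cop (Gen Gen_d) \<bullet> cop (Gen Gen_c) = q\<^sup>2 *\<^sub>C (cop (Gen Gen_c) \<bullet> cop (Gen Gen_d))"
  "cop (Gen Gen_b) \<bullet> cop (Gen Gen_d) = cop (Gen Gen_d) \<bullet> cop (Gen Gen_b)"
  "cop (Gen Gen_a) \<bullet> cop (Gen Gen_d)
    = cop (Gen Gen_d) \<bullet> cop (Gen Gen_a) + (q - 1) *\<^sub>C (cop (Gen Gen_b) \<bullet> cop (Gen Gen_c))"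
  "cop (Gen Gen_a) \<bullet> cop (Gen Gen_d) - q *\<^sub>C (cop (Gen Gen_b) \<bullet> cop (Gen Gen_c)) = qdet \<otimes> qdet"
  by (simp_all add: tmult_letters tmult_simps tens_simps normal_order_g normalize q_powers q3
      scaleC_q2 scaleC_q_1 scaleC_one algebra_simps del: complex_space.scale_scale)

lemma cop_Inv_commute: "cop Inv \<bullet> cop (Gen k) = cop (Gen k) \<bullet> cop Inv"
proof -
  have *: "gt * g (Gen k) = g (Gen k) * gt" for k
    using relations by (simp add: GLq2_relations_def)
  show ?thesis
    by (cases k) (simp_all add: tmult_letters tmult_simps * scaleC_one)
qed

text \<open>The graded product is not the multiplication of a type class, so each letter is sent to
  the operator of left multiplication by \<open>cop l\<close>. An operator commuting with right
  multiplications is determined by its value at the unit, which is taken as the coproduct.\<close>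

lemma ex_coproduct: "\<exists>\<Delta>. clinear \<Delta> \<and> \<Delta> 1 = 1 \<otimes> 1 \<and> (\<forall>x y. \<Delta> (x * y) = \<Delta> x \<bullet> \<Delta> y) \<and> (\<forall>l. \<Delta> (g l) = cop l)"
proof -
  define T where "T l = Cend (tmult (cop l))" for l
  have T: "apply_cend (T l) = tmult (cop l)" for l
    unfolding T_def by (rule apply_Cend[OF bilinear_right[OF bilinear_tmult]])
  note simps = apply_cend_simps apply_cend_mult T tmult_assoc[symmetric] tmult_simps[symmetric]
  have "GLq2_relations q T"
    unfolding GLq2_relations_def Mq2_relations_def Let_def
  proof (intro conjI allI cend_eqI, goal_cases)
    \<comment> \<open>The eighth relation is the one making \<open>Inv\<close> inverse to the
      determinant; it follows from both being group-like.\<close>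
    case (8 v)
    have "cop Inv \<bullet> (cop (Gen Gen_a) \<bullet> cop (Gen Gen_d) - q *\<^sub>C (cop (Gen Gen_b) \<bullet> cop (Gen Gen_c)))
        = 1 \<otimes> 1"
      unfolding cop_relations(7)
      by (simp add: tmult_tens[OF letter_in_eigengrade qdet_in_eigengrade] qdet_inverse scaleC_one)
    then show ?case
      by (simp only: apply_cend_simps apply_cend_mult T tmult_one
          tmult_assoc[symmetric] tmult_simps(2,9)[symmetric])
  qed (simp_all only: simps cop_relations(1-6) cop_Inv_commute)
  from hom_exists[OF this] obtain \<Phi> where \<Phi>: "algebra_hom \<Phi>" "\<And>l. \<Phi> (g l) = T l"
    by blast
  define \<Delta> where "\<Delta> x = apply_cend (\<Phi> x) (1 \<otimes> 1)" for x
  have c: "clinear \<Delta>"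
    by (rule clinearI) (use \<Phi>(1) in \<open>simp_all add: \<Delta>_def algebra_hom_def clinear_simps apply_cend_simps\<close>)
  have letter: "apply_cend (\<Phi> (g l * x)) u = cop l \<bullet> apply_cend (\<Phi> x) u" for l x u
    using \<Phi> by (simp add: algebra_hom_def apply_cend_mult T)
  have \<Phi>_mult: "apply_cend (\<Phi> x) u = \<Delta> x \<bullet> u" for x u
  proof (induct x rule: letter_induct)
    case (mult l x)
    have "\<Delta> (g l * x) = cop l \<bullet> \<Delta> x" by (simp add: \<Delta>_def letter)
    with mult show ?case by (simp add: letter tmult_assoc)
  next
    case one
    then show ?case
      using \<Phi>(1) by (simp add: \<Delta>_def algebra_hom_def apply_cend_mult tmult_one)
  qed (use \<Phi>(1) in \<open>simp_all add: algebra_hom_def clinear_simps c tmult_simps apply_cend_simps\<close>)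
  note c
  moreover have "\<Delta> 1 = 1 \<otimes> 1"
    using \<Phi>(1) by (simp add: \<Delta>_def algebra_hom_def apply_cend_mult)
  moreover have "\<Delta> (x * y) = \<Delta> x \<bullet> \<Delta> y" for x y
    using \<Phi>(1) by (simp add: \<Delta>_def algebra_hom_def apply_cend_mult flip: \<Phi>_mult[unfolded \<Delta>_def])
  moreover have "\<Delta> (g l) = cop l" for l
    using \<Phi>(2) by (simp add: \<Delta>_def T tmult_one)
  ultimately show ?thesis by blast
qed

definition \<Delta> :: "'a \<Rightarrow> ('a, 'a) tensor"
  where "\<Delta> = (SOME \<Delta>. clinear \<Delta> \<and> \<Delta> 1 = 1 \<otimes> 1 \<and> (\<forall>x y. \<Delta> (x * y) = \<Delta> x \<bullet> \<Delta> y) \<and>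
    (\<forall>l. \<Delta> (g l) = cop l))"

lemma coprod: "clinear \<Delta>" "\<Delta> 1 = 1 \<otimes> 1" "\<Delta> (x * y) = \<Delta> x \<bullet> \<Delta> y" "\<Delta> (g l) = cop l"
  using someI_ex[OF ex_coproduct] unfolding \<Delta>_def by blast+

lemmas coprod_simps = clinear_simps[OF coprod(1)] coprod(2-4)

lemma graded_mult_GL_grade:
  "(\<And>i. i < 3 \<Longrightarrow> G i = eigengrade \<rho> i) \<Longrightarrow> graded_mult q G (GL_grade g) m n = gmult \<rho> \<tau> m n"
  by (rule graded_mult_cong) (simp_all add: GL_grade_eq)

lemma is_coproduct: "is_coproduct q g \<Delta>"
  by (simp add: is_coproduct_def coprod graded_mult_GL_grade GL_grade_eq tmat_def)

lemma coprod_tau: "\<Delta> (\<tau> x) = tensor_map \<tau> \<tau> (\<Delta> x)"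
proof -
  note c = clinear_tensor_map[OF tau(1) tau(1)]
  note gb = graded_bilinear_gmult[OF graded_times graded_times, unfolded graded_bilinear_def]
  show ?thesis
  proof (induct x rule: letter_induct)
    case (mult l x)
    have "tensor_map \<tau> \<tau> (cop l) = q ^ deg l *\<^sub>C cop l"
      by (cases l rule: deg.cases)
        (simp_all add: clinear_simps[OF c] tensor_map_tens tau tens_simps scaleC_add_right
          scaleC_scaleC q3 scaleC_one mult.commute flip: power_add power_Suc)
    then show ?case
      using mult gb by (simp add: coprod_simps tau tmult_simps scaleC_mult_left)
  qed (simp_all add: coprod_simps tau clinear_simps[OF c] clinear_simps[OF tau(1)] tensor_map_tens)
qed

lemma graded_tmult: "Z3_operator (tensor_map \<tau> \<tau>)"
  "graded_bilinear (tensor_map \<tau> \<tau>) (tensor_map \<tau> \<tau>) (tensor_map \<tau> \<tau>) tmult"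
  using graded_bilinear_gmult[OF graded_times graded_times]
  by (simp_all add: Z3_operator_tensor_map Z3_operator_tau)

section \<open>Coassociativity and the counit axiom\<close>

abbreviation tmult3 (infixl "\<bullet>\<^sub>3" 75)
  where "u \<bullet>\<^sub>3 v \<equiv> gmult (tensor_map \<tau> \<tau>) \<tau> (*) tmult u v"

definition coprod_left :: "'a \<Rightarrow> ('a, ('a, 'a) tensor) tensor"
  where "coprod_left x = tensor_assoc (tensor_map \<Delta> id (\<Delta> x))"

definition coprod_right :: "'a \<Rightarrow> ('a, ('a, 'a) tensor) tensor"
  where "coprod_right x = tensor_map id \<Delta> (\<Delta> x)"

lemma coprod_left_mult: "coprod_left (x * y) = coprod_left x \<bullet>\<^sub>3 coprod_left y"
proof -
  have "tensor_map \<Delta> id (u \<bullet> v)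
      = gmult \<tau> (tensor_map \<tau> \<tau>) tmult (*) (tensor_map \<Delta> id u) (tensor_map \<Delta> id v)" for u v
    by (rule gmult_map)
      (simp_all add: Z3_operator_tau graded_tmult bilinear_times bilinear_tmult coprod
        clinear_id coprod_tau)
  then show ?thesis
    by (simp add: coprod_left_def coprod
        tensor_assoc_gmult[OF graded_times graded_times graded_times])
qed

lemma coprod_right_mult: "coprod_right (x * y) = coprod_right x \<bullet>\<^sub>3 coprod_right y"
  unfolding coprod_right_def coprod
  by (rule gmult_map)
    (simp_all add: Z3_operator_tau graded_tmult bilinear_times bilinear_tmult coprod
      clinear_id coprod_tau)

text \<open>Both iterated coproducts are multiplicative for the same product on the triple tensor
  space, so it is enough to compare letters; for the matrix entries this is associativity of matrix
  multiplication.\<close>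

lemma coassociative: "coprod_left x = coprod_right x"
proof (induct x rule: letter_induct)
  case (mult l x)
  have "coprod_left (g l) = coprod_right (g l)"
    unfolding coprod_left_def coprod_right_def
    by (cases l rule: deg.cases)
      (simp_all add: coprod coprod_simps clinear_simps[OF clinear_tensor_map] clinear_id tensor_map_tens
        clinear_simps[OF clinear_tensor_assoc] tensor_assoc_tens tens_simps add_ac)
  with mult show ?case by (simp add: coprod_left_mult coprod_right_mult)
qed (simp_all add: coprod_left_def coprod_right_def coprod clinear_simps[OF coprod(1)]
    clinear_simps[OF clinear_tensor_map] clinear_id tensor_map_tens
    clinear_simps[OF clinear_tensor_assoc] tensor_assoc_tens)

definition counit_left :: "('a, 'v::complex_space) tensor \<Rightarrow> 'v"
  where "counit_left = tensor_lift (\<lambda>x v. \<epsilon> x *\<^sub>C v)"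

lemma counit_left:
  fixes v :: "'v::complex_space"
  shows "clinear (counit_left :: ('a, 'v) tensor \<Rightarrow> 'v)" "counit_left (x \<otimes> v) = \<epsilon> x *\<^sub>C v"
proof -
  have "bilinear (\<lambda>x (v :: 'v). \<epsilon> x *\<^sub>C v)"
    by (rule bilinearI)
      (simp_all add: clinear_simps[OF eps(1)] scaleC_add_left scaleC_add_right scaleC_scaleC
        scaleC_complex_def mult.commute)
  then show "clinear (counit_left :: ('a, 'v) tensor \<Rightarrow> 'v)" "counit_left (x \<otimes> v) = \<epsilon> x *\<^sub>C v"
    by (simp_all add: counit_left_def clinear_tensor_lift tensor_lift_tens)
qed

lemmas counit_left_simps = clinear_simps[OF counit_left(1)] counit_left(2)

text \<open>Since \<open>\<epsilon>\<close> vanishes outside degree 0, the sign of the graded product disappears under it.\<close>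

lemma counit_left_gmult:
  assumes "Z3_operator \<rho>" "bilinear n"
  shows "counit_left (gmult \<rho> \<tau> (*) n u v) = n (counit_left u) (counit_left v)"
proof -
  note b = bilinear_simps[OF bilinear_gmult[OF assms(1) Z3_operator_tau bilinear_times assms(2)]]
    bilinear_simps[OF assms(2)] counit_left_simps
  have id: "Z3_operator (\<lambda>x. x)" by (simp add: Z3_operator_def clinear_id)
  have 0: "q ^ (j * k) * \<epsilon> x = \<epsilon> x" if "x \<in> eigengrade \<tau> k" for x j k
  proof (cases "\<epsilon> x = 0")
    case False
    have "q ^ k *\<^sub>C \<epsilon> x = \<epsilon> x"
      using that eps_tau[of x] by (simp add: eigengrade_def clinear_simps[OF eps(1)])
    with False have "q ^ k = 1" by (simp add: scaleC_complex_def)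
    then have "q ^ (k * j) = 1" by (simp add: power_mult)
    then show ?thesis by (simp add: mult.commute)
  qed simp
  show ?thesis
  proof (induct u rule: tensor_eigen_induct[OF id assms(1)])
    case (2 i j x y)
    note xy = this
    show ?case
    proof (induct v rule: tensor_eigen_induct[OF Z3_operator_tau id])
      case (2 k l x' y')
      have "q ^ (j * k) * (\<epsilon> x * \<epsilon> x') = \<epsilon> x * \<epsilon> x'"
        using 0[OF 2(1), of j] by (simp add: mult.left_commute)
      then show ?case
        using xy 2
        by (simp add: gmult_tens[OF assms(1) Z3_operator_tau bilinear_times assms(2)] b eps
            scaleC_scaleC)
    qed (simp add: b)
  qed (simp add: b)
qed

lemma counit: "counit_left (\<Delta> x) = x"
proof (induct x rule: letter_induct)
  case (mult l x)
  have "counit_left (cop l) = g l"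
    by (cases l rule: deg.cases) (simp_all add: counit_left_simps eps scaleC_one)
  with mult show ?case
    by (simp add: coprod counit_left_gmult[OF Z3_operator_tau bilinear_times])
qed (simp_all add: coprod_simps counit_left_simps eps scaleC_one)


section \<open>Modules over the algebra\<close>

definition left_module :: "('a \<Rightarrow> 'v::complex_space \<Rightarrow> 'v) \<Rightarrow> bool"
  where "left_module \<rho> \<longleftrightarrow>
    bilinear \<rho> \<and> (\<forall>v. \<rho> 1 v = v) \<and> (\<forall>x y v. \<rho> (x * y) v = \<rho> x (\<rho> y v))"

text \<open>The generator \<open>gt\<close> follows from the other four because it acts as the inverse of \<open>qdet\<close>.\<close>

lemma intertwine:
  assumes \<rho>: "left_module \<rho>" and \<rho>': "left_module \<rho>'" and \<psi>: "clinear \<psi>"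
    and gen: "\<And>k v. \<psi> (\<rho> (g (Gen k)) v) = \<rho>' (g (Gen k)) (\<psi> v)"
  shows "\<psi> (\<rho> x v) = \<rho>' x (\<psi> v)"
proof -
  note r = \<rho>[unfolded left_module_def] \<rho>'[unfolded left_module_def]
  note b = bilinear_simps[OF conjunct1[OF r(1)]] bilinear_simps[OF conjunct1[OF r(2)]]
    clinear_simps[OF \<psi>]
  have D: "\<psi> (\<rho> qdet v) = \<rho>' qdet (\<psi> v)" for v
    using r by (simp add: b gen)
  have "\<psi> (\<rho> gt v) = \<rho>' (gt * qdet) (\<psi> (\<rho> gt v))" for v
    using r unfolding qdet_inverse by simp
  also have "\<dots> v = \<rho>' gt (\<psi> (\<rho> (qdet * gt) v))" for v
    using r D by metis
  finally have t: "\<psi> (\<rho> gt v) = \<rho>' gt (\<psi> v)" for v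
    using r unfolding qdet_inverse by simp
  have l: "\<psi> (\<rho> (g l) v) = \<rho>' (g l) (\<psi> v)" for l v
    using gen t by (cases l) auto
  show ?thesis
    by (induct x arbitrary: v rule: letter_induct) (use r in \<open>simp_all add: b l\<close>)
qed

end

section \<open>A calculus is determined by its bimodule relations\<close>

context GLq2
begin

definition basis_comb :: "('a, 'w::complex_space) calculus \<Rightarrow> (gen \<Rightarrow> 'a) \<Rightarrow> 'w"
  where "basis_comb \<Omega> c = (\<Sum>y\<in>UNIV. ract \<Omega> (diff \<Omega> (g (Gen y))) (c y))"

lemma basis_comb_iff: "differentials_right_basis g \<Omega> \<longleftrightarrow> bij (basis_comb \<Omega>)"
  unfolding differentials_right_basis_def basis_comb_def[symmetric] bij_def inj_def surj_def
  by metis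

lemma basis_comb_simps:
  assumes "bimodule \<Omega>"
  shows "basis_comb \<Omega> (\<lambda>y. c y + c' y) = basis_comb \<Omega> c + basis_comb \<Omega> c'"
    "basis_comb \<Omega> (\<lambda>y. k *\<^sub>C c y) = k *\<^sub>C basis_comb \<Omega> c"
    "basis_comb \<Omega> (\<lambda>y. c y * x) = ract \<Omega> (basis_comb \<Omega> c) x"
proof -
  have r: "bilinear (ract \<Omega>)" "\<And>x y w. ract \<Omega> w (x * y) = ract \<Omega> (ract \<Omega> w x) y"
    using assms by (simp_all add: bimodule_def)
  show "basis_comb \<Omega> (\<lambda>y. c y + c' y) = basis_comb \<Omega> c + basis_comb \<Omega> c'"
    "basis_comb \<Omega> (\<lambda>y. k *\<^sub>C c y) = k *\<^sub>C basis_comb \<Omega> c"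
    "basis_comb \<Omega> (\<lambda>y. c y * x) = ract \<Omega> (basis_comb \<Omega> c) x"
    by (simp_all add: basis_comb_def bilinear_simps[OF r(1)] r(2) sum.distrib
        complex_space.scale_sum_right)
qed

lemma calculus_left_module: "bimodule \<Omega> \<Longrightarrow> left_module (lact \<Omega>)"
  by (simp add: bimodule_def left_module_def)

lemma calculus_leibniz:
  assumes "graded_calculus q g \<Omega>" "x \<in> eigengrade \<tau> i"
  shows "diff \<Omega> (x * y) = ract \<Omega> (diff \<Omega> x) y + q ^ i *\<^sub>C lact \<Omega> x (diff \<Omega> y)"
proof -
  have "x \<in> GL_grade g (i mod 3)"
    using assms(2) by (simp add: GL_grade_eq eigengrade_mod)
  then have "diff \<Omega> (x * y) = ract \<Omega> (diff \<Omega> x) y + q ^ (i mod 3) *\<^sub>C lact \<Omega> x (diff \<Omega> y)"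
    using assms(1) unfolding graded_calculus_def by (meson mod_less_divisor zero_less_numeral)
  then show ?thesis by (simp add: q_mod)
qed

text \<open>Differentiate \<open>qdet * gt = 1\<close>. The determinant has degree 0, so the Leibniz
  rule carries no power of q.\<close>

lemma calculus_diff_Inv:
  assumes "graded_calculus q g \<Omega>"
  shows "diff \<Omega> gt = - lact \<Omega> gt (ract \<Omega> (diff \<Omega> qdet) gt)"
proof -
  have b: "bimodule \<Omega>" and c: "clinear (diff \<Omega>)"
    using assms by (simp_all add: graded_calculus_def)
  note b' = b[unfolded bimodule_def]
  have "diff \<Omega> 1 = 0"
    using calculus_leibniz[OF assms one_in_eigengrade, of 1] b' by (simp add: scaleC_one)
  moreover have "diff \<Omega> (qdet * gt) = ract \<Omega> (diff \<Omega> qdet) gt + lact \<Omega> qdet (diff \<Omega> gt)"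
    using calculus_leibniz[OF assms qdet_in_eigengrade, of gt] by (simp add: scaleC_one)
  ultimately have "lact \<Omega> qdet (diff \<Omega> gt) = - ract \<Omega> (diff \<Omega> qdet) gt"
    by (simp add: qdet_inverse eq_neg_iff_add_eq_0 add.commute)
  then have "lact \<Omega> gt (lact \<Omega> qdet (diff \<Omega> gt)) = lact \<Omega> gt (- ract \<Omega> (diff \<Omega> qdet) gt)"
    by simp
  moreover have "lact \<Omega> gt (lact \<Omega> qdet (diff \<Omega> gt)) = diff \<Omega> gt"
    using b' qdet_inverse(1) by metis
  ultimately show ?thesis
    using b' by (simp add: bilinear_simps)
qed

text \<open>The differential of a generator y has degree \<open>deg (Gen y) + 1\<close>, so in a
  form of degree i its coefficient has degree i - deg y - 1, which modulo 3 is
  \<open>i + 2 * deg (Gen y) + 2\<close>. Thus the basis forces the grading.\<close>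

lemma calculus_grade:
  assumes "graded_calculus q g \<Omega>" "differentials_right_basis g \<Omega>" "i < 3"
  shows "grade \<Omega> i = basis_comb \<Omega> ` {c. \<forall>y. c y \<in> eigengrade \<tau> (i + 2 * deg (Gen y) + 2)}"
proof -
  have b: "bimodule \<Omega>" and Z: "Z3_grading (grade \<Omega>)"
    using assms by (simp_all add: graded_calculus_def)
  have sub: "csubspace (grade \<Omega> i)" if "i < 3" for i
    using Z that by (simp add: Z3_grading_def)
  have comb: "basis_comb \<Omega> c \<in> grade \<Omega> i"
    if "i < 3" and c: "\<And>y. c y \<in> eigengrade \<tau> (i + 2 * deg (Gen y) + 2)" for i c
    unfolding basis_comb_def
  proof (rule complex_space.subspace_sum[OF sub[OF that(1)]])
    fix y :: gen
    let ?j = "(i + 2 * deg (Gen y) + 2) mod 3" and ?k = "(deg (Gen y) + 1) mod 3"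
    have "c y \<in> GL_grade g ?j"
      using c[of y] by (simp add: GL_grade_eq eigengrade_mod)
    moreover have "deg (Gen y) < 3" by (cases y) simp_all
    then have "g (Gen y) \<in> GL_grade g (deg (Gen y))"
      by (simp add: GL_grade_eq letter_in_eigengrade)
    then have "diff \<Omega> (g (Gen y)) \<in> grade \<Omega> ?k"
      using assms(1) \<open>deg (Gen y) < 3\<close> unfolding graded_calculus_def by blast
    ultimately have "ract \<Omega> (diff \<Omega> (g (Gen y))) (c y) \<in> grade \<Omega> ((?j + ?k) mod 3)"
      using assms(1) unfolding graded_calculus_def by (meson mod_less_divisor zero_less_numeral)
    moreover have "(?j + ?k) mod 3 = (i + (deg (Gen y) + 1) * 3) mod 3"
      unfolding mod_add_eq by (simp add: algebra_simps)
    then have "(?j + ?k) mod 3 = i"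
      unfolding mod_mult_self1 using that(1) by simp
    ultimately show "ract \<Omega> (diff \<Omega> (g (Gen y))) (c y) \<in> grade \<Omega> i" by simp
  qed
  have "\<exists>c. w = basis_comb \<Omega> c \<and> (\<forall>y. c y \<in> eigengrade \<tau> (i + 2 * deg (Gen y) + 2))"
    if w: "w \<in> grade \<Omega> i" for w
  proof -
    obtain c where c: "w = basis_comb \<Omega> c"
      using assms(2) unfolding basis_comb_iff by (metis bij_pointE)
    define p where "p k y = eigenproj \<tau> ((k + 2 * deg (Gen y) + 2) mod 3) (c y)" for k y
    have p: "p k y \<in> eigengrade \<tau> (k + 2 * deg (Gen y) + 2)" for k y
      unfolding p_def
      by (subst eigengrade_mod[symmetric]) (rule eigenproj_in_eigengrade[OF Z3_operator_tau])
    have p_sum: "p 0 y + (p (Suc 0) y + p 2 y) = c y" for y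
      using sum_eigenproj[of \<tau> "c y"] by (cases y) (simp_all add: p_def lessThan_3 add_ac numeral_2_eq_2)
    then have sum: "(\<Sum>k<3. basis_comb \<Omega> (p k)) = w"
      by (simp add: c lessThan_3 p_sum flip: basis_comb_simps(1)[OF b])
    \<comment> \<open>Two homogeneous decompositions of w: one from the components of its
      coefficients, the other w itself placed in degree i. Uniqueness identifies them.\<close>
    define w1 where "w1 k = (if k < 3 then basis_comb \<Omega> (p k) else 0)" for k
    define w2 where "w2 k = (if k = i then w else 0)" for k
    have "decomposes (grade \<Omega>) w w1"
      using sum comb p by (simp add: decomposes_def w1_def)
    moreover have "decomposes (grade \<Omega>) w w2"
      using w assms(3) sub by (auto simp: decomposes_def w2_def complex_space.subspace_0)
    ultimately have "w1 = w2" using Z unfolding Z3_grading_def by metis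
    then have "basis_comb \<Omega> (p i) = w" using assms(3) by (metis w1_def w2_def)
    then show ?thesis using p by blast
  qed
  then show ?thesis using comb[OF assms(3)] by blast
qed

text \<open>The hypothesis \<open>rel\<close> asks for the same coefficients c in both calculi, for
  generators acting on basis differentials. The rest is forced: the left action by
  \<open>intertwine\<close>, the differential by the Leibniz rule and
  \<open>calculus_diff_Inv\<close>, the grading by \<open>calculus_grade\<close>.\<close>

lemma calculus_unique:
  fixes \<Omega> :: "('a, 'w::complex_space) calculus" and \<Omega>' :: "('a, 'v::complex_space) calculus"
  assumes \<Omega>: "graded_calculus q g \<Omega>" "differentials_right_basis g \<Omega>"
    and \<Omega>': "graded_calculus q g \<Omega>'" "differentials_right_basis g \<Omega>'"
    and rel: "\<And>k x. \<exists>c. lact \<Omega> (g (Gen k)) (diff \<Omega> (g (Gen x))) = basis_comb \<Omega> c \<and>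
      lact \<Omega>' (g (Gen k)) (diff \<Omega>' (g (Gen x))) = basis_comb \<Omega>' c"
  shows "\<exists>\<phi>. calculus_iso \<Omega> \<Omega>' \<phi>"
proof -
  have b: "bimodule \<Omega>" "bimodule \<Omega>'" "clinear (diff \<Omega>)" "clinear (diff \<Omega>')"
    using \<Omega>(1) \<Omega>'(1) by (simp_all add: graded_calculus_def)
  note b' = b(1,2)[unfolded bimodule_def]
  have bij: "bij (basis_comb \<Omega>)" "bij (basis_comb \<Omega>')"
    using \<Omega>(2) \<Omega>'(2) by (simp_all add: basis_comb_iff)
  define \<phi> where "\<phi> w = basis_comb \<Omega>' (inv (basis_comb \<Omega>) w)" for w
  have \<phi>: "\<phi> (basis_comb \<Omega> c) = basis_comb \<Omega>' c" for c
    using bij(1) by (simp add: \<phi>_def bij_is_inj)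
  have ex: "\<exists>c. w = basis_comb \<Omega> c" for w
    using bij(1) by (metis bij_pointE)
  have bij_\<phi>: "bij \<phi>"
    using bij_comp[OF bij_imp_bij_inv[OF bij(1)] bij(2)] by (simp add: \<phi>_def[abs_def] comp_def)
  have lin: "clinear \<phi>"
  proof (rule clinearI)
    fix v w k
    obtain c c' where [simp]: "v = basis_comb \<Omega> c" "w = basis_comb \<Omega> c'" using ex by metis
    show "\<phi> (v + w) = \<phi> v + \<phi> w" "\<phi> (k *\<^sub>C v) = k *\<^sub>C \<phi> v"
      by (simp_all add: \<phi> flip: basis_comb_simps[OF b(1)])
        (simp_all add: basis_comb_simps[OF b(2)])
  qed
  have ract: "\<phi> (ract \<Omega> w x) = ract \<Omega>' (\<phi> w) x" for w x
  proof -
    obtain c where [simp]: "w = basis_comb \<Omega> c" using ex by metis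
    show ?thesis
      by (simp add: \<phi> flip: basis_comb_simps[OF b(1)]) (simp add: basis_comb_simps[OF b(2)])
  qed
  have gen: "\<phi> (diff \<Omega> (g (Gen x))) = diff \<Omega>' (g (Gen x))" for x
  proof -
    have "diff \<Omega> (g (Gen x)) = basis_comb \<Omega> (\<lambda>y. if y = x then 1 else 0)"
      "diff \<Omega>' (g (Gen x)) = basis_comb \<Omega>' (\<lambda>y. if y = x then 1 else 0)"
      using b' by (simp_all add: basis_comb_def if_distrib[of "ract _ _"] bilinear_simps sum.delta cong: if_cong)
    then show ?thesis using \<phi> by metis
  qed
  have "\<phi> (lact \<Omega> (g (Gen k)) w) = lact \<Omega>' (g (Gen k)) (\<phi> w)" for k w
  proof -
    obtain c where w: "w = basis_comb \<Omega> c" using ex by metis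
    have "\<phi> (lact \<Omega> (g (Gen k)) (diff \<Omega> (g (Gen x))))
        = lact \<Omega>' (g (Gen k)) (\<phi> (diff \<Omega> (g (Gen x))))" for x
      using rel[of k x] \<phi> gen by metis
    then have "\<phi> (lact \<Omega> (g (Gen k)) (ract \<Omega> (diff \<Omega> (g (Gen x))) (c x)))
        = lact \<Omega>' (g (Gen k)) (\<phi> (ract \<Omega> (diff \<Omega> (g (Gen x))) (c x)))" for x
      using b' ract by metis
    then show ?thesis
      using b' unfolding w basis_comb_def by (simp add: bilinear_simps clinear_sum[OF lin])
  qed
  then have lact: "\<phi> (lact \<Omega> x w) = lact \<Omega>' x (\<phi> w)" for x w
    by (rule intertwine[OF b(1,2)[THEN calculus_left_module] lin])
  note leib = calculus_leibniz[OF \<Omega>(1) letter_in_eigengrade] calculus_leibniz[OF \<Omega>'(1) letter_in_eigengrade]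
  have diff: "\<phi> (diff \<Omega> x) = diff \<Omega>' x" for x
  proof (induct x rule: letter_induct)
    case one
    show ?case
      using calculus_leibniz[OF \<Omega>(1) one_in_eigengrade, of 1] b'
        calculus_leibniz[OF \<Omega>'(1) one_in_eigengrade, of 1]
      by (simp add: scaleC_one clinear_zero[OF lin])
  next
    case (mult l x)
    have "\<phi> (diff \<Omega> qdet) = diff \<Omega>' qdet"
      by (simp add: clinear_simps[OF b(3)] clinear_simps[OF b(4)] clinear_simps[OF lin] leib ract lact gen)
    then have "\<phi> (diff \<Omega> gt) = diff \<Omega>' gt"
      by (simp add: calculus_diff_Inv[OF \<Omega>(1)] calculus_diff_Inv[OF \<Omega>'(1)] ract lact
          clinear_minus[OF lin] del: scaleC_simps)
    then have "\<phi> (diff \<Omega> (g l)) = diff \<Omega>' (g l)"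
      using gen by (cases l) auto
    with mult show ?case
      by (simp add: leib clinear_simps[OF lin] ract lact)
  qed (simp_all add: clinear_simps[OF lin] clinear_simps[OF b(3)] clinear_simps[OF b(4)])
  have "\<phi> ` grade \<Omega> i = grade \<Omega>' i" if "i < 3" for i
    unfolding calculus_grade[OF \<Omega> that] calculus_grade[OF \<Omega>' that] image_image \<phi> ..
  then show ?thesis
    unfolding calculus_iso_def using lin bij_\<phi> lact ract diff by blast
qed

end

section \<open>Construction of calculi on a free right module\<close>

type_synonym 'a forms = "'a \<times> 'a \<times> 'a \<times> 'a"

fun form :: "gen \<Rightarrow> 'a::complex_algebra_1 forms" where
  "form Gen_a = (1, 0, 0, 0)"
| "form Gen_b = (0, 1, 0, 0)"
| "form Gen_c = (0, 0, 1, 0)"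
| "form Gen_d = (0, 0, 0, 1)"

fun coord :: "gen \<Rightarrow> 'a forms \<Rightarrow> 'a" where
  "coord Gen_a (w1, w2, w3, w4) = w1"
| "coord Gen_b (w1, w2, w3, w4) = w2"
| "coord Gen_c (w1, w2, w3, w4) = w3"
| "coord Gen_d (w1, w2, w3, w4) = w4"

fun fmult :: "'a::complex_algebra_1 forms \<Rightarrow> 'a \<Rightarrow> 'a forms" where
  "fmult (w1, w2, w3, w4) x = (w1 * x, w2 * x, w3 * x, w4 * x)"

lemma scaleC_Pair: "c *\<^sub>C (x, y) = (c *\<^sub>C x, c *\<^sub>C y)"
  by (simp add: scaleC_prod_def)

lemma bilinear_fmult: "bilinear fmult"
  by (rule bilinearI)
    (auto simp: algebra_simps scaleC_mult_left scaleC_mult_right scaleC_Pair elim!: fmult.elims)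

lemmas fmult_simps = bilinear_simps[OF bilinear_fmult]

lemma fmult_mult: "fmult w (x * y) = fmult (fmult w x) y" and fmult_one: "fmult w 1 = w"
  by (cases w; simp add: mult.assoc)+

lemma clinear_coord: "clinear (coord k)"
  by (rule clinearI; cases k) (auto simp: scaleC_Pair)

lemma coord_fmult: "coord k (fmult w x) = coord k w * x"
  by (cases k; cases w) auto

lemma coord_form: "coord k (form l) = (if k = l then 1 else 0)"
  by (cases k; cases l) auto

lemma sum_gen: "(\<Sum>k\<in>UNIV. f k) = f Gen_a + (f Gen_b + (f Gen_c + f Gen_d))"
  by (simp add: UNIV_gen)

lemma forms_expand: "(\<Sum>k\<in>UNIV. fmult (form k) (coord k w)) = w"
  by (cases w) (simp add: sum_gen)

lemma sum_coord: "(\<Sum>k\<in>UNIV. fmult (f k) (coord k (form l))) = f l"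
  by (cases l) (simp_all add: sum_gen coord_form fmult_one fmult_simps)

declare form.simps [simp del]

text \<open>The pairs \<open>(t\<^sub>i\<^sub>k, t\<^sub>k\<^sub>j)\<close>, \<open>k = 1, 2\<close>, for the matrix entry \<open>t\<^sub>i\<^sub>j\<close>.\<close>

fun parts :: "gen \<Rightarrow> (gen \<times> gen) list" where
  "parts Gen_a = [(Gen_a, Gen_a), (Gen_b, Gen_c)]"
| "parts Gen_b = [(Gen_a, Gen_b), (Gen_b, Gen_d)]"
| "parts Gen_c = [(Gen_c, Gen_a), (Gen_d, Gen_c)]"
| "parts Gen_d = [(Gen_c, Gen_b), (Gen_d, Gen_d)]"

context GLq2
begin

section \<open>Grading and coaction on the free right module\<close>

lemma q_cube: "q * q\<^sup>2 = 1" "q\<^sup>2 * q = 1" "q * (q * q) = 1"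
  using q3 by (simp_all add: power3_eq_cube power2_eq_square mult.assoc)

abbreviation gl :: "gen \<Rightarrow> 'a" where "gl k \<equiv> g (Gen k)"
abbreviation dg :: "gen \<Rightarrow> nat" where "dg k \<equiv> deg (Gen k)"

text \<open>The exponent \<open>dg k + 1\<close> appears because the basis form k is to become the
  differential of \<open>gl k\<close>, which raises the degree by one.\<close>

definition \<sigma> :: "'a forms \<Rightarrow> 'a forms"
  where "\<sigma> w = (\<Sum>k\<in>UNIV. q ^ (dg k + 1) *\<^sub>C fmult (form k) (\<tau> (coord k w)))"

lemma clinear_sigma: "clinear \<sigma>"
  unfolding \<sigma>_def
  by (intro clinear_Sum clinear_scaleC clinear_comp[OF bilinear_right[OF bilinear_fmult]]
      clinear_comp[OF tau(1)] clinear_coord)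

lemma sigma_fmult: "\<sigma> (fmult w x) = fmult (\<sigma> w) (\<tau> x)"
  by (simp add: \<sigma>_def coord_fmult tau fmult_mult fmult_simps)

lemma sigma_form: "\<sigma> (form k) = q ^ (dg k + 1) *\<^sub>C form k"
  by (cases k) (simp_all add: \<sigma>_def sum_gen coord_form tau fmult_one fmult_simps clinear_simps[OF tau(1)]
      q_cube q3 scaleC_one)

lemma form_in_eigengrade: "form k \<in> eigengrade \<sigma> (dg k + 1)"
  by (simp add: eigengrade_def sigma_form)

lemma Z3_operator_sigma: "Z3_operator \<sigma>"
proof -
  have "\<sigma> (\<sigma> (\<sigma> (fmult (form k) x))) = fmult (form k) x" for k x
  proof -
    have "q ^ (dg k + 1) * (q ^ (dg k + 1) * q ^ (dg k + 1)) = 1"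
      using q_powers(4)[of "dg k + 1"] by (simp only: power_mult power3_eq_cube mult.assoc)
    then show ?thesis
      using Z3_operator_tau
      by (simp only: sigma_fmult sigma_form fmult_simps clinear_simps[OF clinear_sigma] scaleC_scaleC
          scaleC_one Z3_operator_def mult.assoc)
  qed
  then have "\<sigma> (\<sigma> (\<sigma> (\<Sum>k\<in>UNIV. fmult (form k) (coord k w)))) = (\<Sum>k\<in>UNIV. fmult (form k) (coord k w))" for w
    by (simp add: clinear_sum[OF clinear_sigma])
  then show ?thesis by (simp add: Z3_operator_def clinear_sigma forms_expand)
qed

lemma graded_fmult: "graded_bilinear \<sigma> \<tau> \<sigma> fmult"
  by (simp add: graded_bilinear_def Z3_operator_tau Z3_operator_sigma bilinear_fmult sigma_fmult)

abbreviation rmult (infixl "\<star>" 75)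
  where "u \<star> v \<equiv> gmult \<sigma> \<tau> (*) fmult u v"

lemma graded_rmult: "graded_bilinear (tensor_map \<tau> \<sigma>) (tensor_map \<tau> \<tau>) (tensor_map \<tau> \<sigma>) rmult"
  by (rule graded_bilinear_gmult[OF graded_times graded_fmult])

lemma bilinear_rmult: "bilinear rmult"
  using graded_rmult by (simp add: graded_bilinear_def)

lemmas rmult_simps = bilinear_simps[OF bilinear_rmult]
lemmas rmult_tens = gmult_tens[OF Z3_operator_sigma Z3_operator_tau bilinear_times bilinear_fmult]

lemma rmult_assoc: "u \<star> v \<star> w = u \<star> (v \<bullet> w)"
  by (rule gmult_assoc)
    (simp_all add: graded_times graded_fmult bilinear_times bilinear_fmult mult.assoc fmult_mult)

lemma rmult_one: "u \<star> (1 \<otimes> 1) = u"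
  by (induct u rule: tensor_eigen_induct[OF Z3_operator_tau Z3_operator_sigma])
    (simp_all add: rmult_simps rmult_tens[OF _ one_in_eigengrade] scaleC_one fmult_one)

text \<open>The value forced by compatibility with the differential: a summand l \<otimes> r of the
  coproduct must go to \<tau>(l) \<otimes> dr, and \<tau> contributes
  \<open>q ^ dg l\<close>.\<close>

definition cof :: "gen \<Rightarrow> ('a, 'a forms) tensor"
  where "cof x = (\<Sum>(l, r)\<leftarrow>parts x. q ^ dg l *\<^sub>C (gl l \<otimes> form r))"

definition \<Delta>L :: "'a forms \<Rightarrow> ('a, 'a forms) tensor"
  where "\<Delta>L w = (\<Sum>k\<in>UNIV. cof k \<star> \<Delta> (coord k w))"

lemma cop_parts: "cop (Gen k) = (\<Sum>(l, r)\<leftarrow>parts k. gl l \<otimes> gl r)"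
  by (cases k) simp_all

lemma clinear_coaction: "clinear \<Delta>L"
  unfolding \<Delta>L_def
  by (intro clinear_Sum clinear_comp[OF bilinear_right[OF bilinear_rmult]]
      clinear_comp[OF coprod(1)] clinear_coord)

lemma coaction_fmult: "\<Delta>L (fmult w x) = \<Delta>L w \<star> \<Delta> x"
  by (simp add: \<Delta>L_def coord_fmult coprod rmult_assoc rmult_simps)

lemma coaction_form: "\<Delta>L (form k) = cof k"
  by (cases k) (simp_all add: \<Delta>L_def sum_gen coord_form coprod_simps rmult_one rmult_simps)

lemma forms_ext:
  assumes "clinear F" "clinear H" "\<And>k x. F (fmult (form k) x) = H (fmult (form k) x)"
  shows "F w = H w"
proof -
  have "F (\<Sum>k\<in>UNIV. fmult (form k) (coord k w)) = H (\<Sum>k\<in>UNIV. fmult (form k) (coord k w))"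
    by (simp add: clinear_sum[OF assms(1)] clinear_sum[OF assms(2)] assms(3))
  then show ?thesis by (simp add: forms_expand)
qed

text \<open>Preservation of the total degree is what allows \<open>gmult_map\<close> to apply the
  coaction to an inner tensor factor in the proof of coassociativity.\<close>

lemma coaction_sigma: "\<Delta>L (\<sigma> w) = tensor_map \<tau> \<sigma> (\<Delta>L w)"
proof (rule forms_ext)
  fix k x
  have c: "clinear (tensor_map \<tau> \<sigma>)" by (intro clinear_tensor_map tau clinear_sigma)
  have "tensor_map \<tau> \<sigma> (cof k) = q ^ (dg k + 1) *\<^sub>C cof k"
    by (cases k)
      (simp_all add: cof_def clinear_simps[OF c] tensor_map_tens tau clinear_sigma sigma_form
        tens_simps scaleC_simps scaleC_q2 scaleC_q_q power2_eq_square numeral_eq_Suc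
        q_cube scaleC_one
        del: complex_space.scale_scale)
  then show "\<Delta>L (\<sigma> (fmult (form k) x)) = tensor_map \<tau> \<sigma> (\<Delta>L (fmult (form k) x))"
    using graded_rmult
    by (simp add: sigma_fmult sigma_form fmult_simps clinear_simps[OF clinear_coaction] coaction_fmult
        coaction_form coprod_tau graded_bilinear_def rmult_simps)
qed (intro clinear_comp[OF clinear_coaction clinear_sigma] clinear_comp[OF clinear_tensor_map clinear_coaction]
    tau clinear_sigma)+

lemma coaction_coassociative:
  "tensor_assoc (tensor_map \<Delta> id (\<Delta>L w)) = tensor_map id \<Delta>L (\<Delta>L w)"
proof (rule forms_ext)
  fix k x
  let ?m = "gmult (tensor_map \<tau> \<sigma>) \<tau> (*) rmult"
  note c = clinear_tensor_map[OF coprod(1) clinear_id(1)] clinear_tensor_map[OF clinear_id(1) clinear_coaction]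
  have "tensor_map \<Delta> id (u \<star> \<Delta> x)
      = gmult \<sigma> (tensor_map \<tau> \<tau>) tmult fmult (tensor_map \<Delta> id u) (tensor_map \<Delta> id (\<Delta> x))" for u
    by (rule gmult_map)
      (simp_all add: Z3_operator_tau Z3_operator_sigma graded_tmult bilinear_times
        bilinear_tmult bilinear_fmult coprod clinear_id coprod_tau)
  then have l: "tensor_assoc (tensor_map \<Delta> id (u \<star> \<Delta> x))
      = ?m (tensor_assoc (tensor_map \<Delta> id u)) (coprod_left x)" for u
    by (simp add: coprod_left_def tensor_assoc_gmult[OF graded_times graded_times graded_fmult])
  have r: "tensor_map id \<Delta>L (u \<star> \<Delta> x) = ?m (tensor_map id \<Delta>L u) (coprod_right x)" for u
    unfolding coprod_right_def
    by (rule gmult_map)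
      (simp_all add: Z3_operator_tau Z3_operator_sigma Z3_operator_tensor_map bilinear_times
        bilinear_rmult bilinear_fmult coprod clinear_id clinear_coaction coaction_fmult coaction_sigma)
  have "tensor_assoc (tensor_map \<Delta> id (cof k)) = tensor_map id \<Delta>L (cof k)"
    by (cases k)
      (simp_all add: cof_def clinear_simps[OF c(1)] clinear_simps[OF c(2)] tensor_map_tens coprod clinear_id
        clinear_coaction coaction_form clinear_simps[OF clinear_tensor_assoc] tensor_assoc_tens tens_simps
        scaleC_add_right scaleC_scaleC add_ac q_cube scaleC_one)
  then show "tensor_assoc (tensor_map \<Delta> id (\<Delta>L (fmult (form k) x)))
      = tensor_map id \<Delta>L (\<Delta>L (fmult (form k) x))"
    by (simp add: coaction_fmult coaction_form l r coassociative)
qed (intro clinear_comp[OF clinear_tensor_assoc] clinear_comp[OF clinear_tensor_map clinear_coaction]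
    coprod clinear_id clinear_coaction)+

lemma coaction_counit: "counit_left (\<Delta>L w) = w"
proof (rule forms_ext[of "\<lambda>w. counit_left (\<Delta>L w)" "\<lambda>w. w"])
  fix k x
  have "counit_left (cof k) = form k"
    by (cases k) (simp_all add: cof_def counit_left_simps eps scaleC_one)
  then show "counit_left (\<Delta>L (fmult (form k) x)) = fmult (form k) x"
    by (simp add: coaction_fmult coaction_form counit_left_gmult[OF Z3_operator_sigma bilinear_fmult] counit)
qed (intro clinear_comp[OF counit_left(1) clinear_coaction] clinear_id)+

text \<open>Moving a letter past a cube multiplies by a cube of a power of q, that is by 1. The
  correction terms between a and d carry the coefficient 1 + q + \<open>q^2\<close> = 0.\<close>

lemma cube_central: "gl k * (gl k * gl k) * x = x * (gl k * (gl k * gl k))"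
proof (induct x rule: letter_induct)
  case (mult l x)
  have "gl k * (gl k * gl k) * g l = g l * (gl k * (gl k * gl k))"
  proof (cases l)
    case (Gen m)
    then show ?thesis
      by (cases k; cases m)
        (simp_all add: normal_order_g normalize algebra_simps del: complex_space.scale_scale)
  next
    case Inv
    have c: "gl k * gt = gt * gl k" using relations by (simp add: GLq2_relations_def)
    then have "gl k * (gt * x) = gt * (gl k * x)" for x by (metis mult.assoc)
    with c show ?thesis unfolding Inv by (simp add: mult.assoc)
  qed
  then have "gl k * (gl k * gl k) * (g l * x) = g l * (gl k * (gl k * gl k) * x)"
    by (simp add: mult.assoc[symmetric])
  with mult show ?case by (simp add: mult.assoc)
qed (simp_all add: distrib_left distrib_right scaleC_mult_left scaleC_mult_right)

end

lemma fst_snd_scaleC: "fst (c *\<^sub>C v) = c *\<^sub>C fst v" "snd (c *\<^sub>C v) = c *\<^sub>C snd v"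
  by (simp_all add: scaleC_prod_def)

context GLq2
begin

text \<open>Left multiplication by \<open>gl k\<close> when \<open>M k x\<close> is prescribed as \<open>gl k\<close> times the basis form \<open>x\<close>.\<close>

definition act :: "(gen \<Rightarrow> gen \<Rightarrow> 'a forms) \<Rightarrow> gen \<Rightarrow> 'a forms \<Rightarrow> 'a forms"
  where "act M k w = (\<Sum>x\<in>UNIV. fmult (M k x) (coord x w))"

text \<open>What the Leibniz rule demands as the differential of \<open>gl k * gl l\<close>.\<close>

definition diff2 :: "(gen \<Rightarrow> gen \<Rightarrow> 'a forms) \<Rightarrow> gen \<Rightarrow> gen \<Rightarrow> 'a forms"
  where "diff2 M k l = fmult (form k) (gl l) + q ^ dg k *\<^sub>C M k l"

lemma clinear_act: "clinear (act M k)"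
  unfolding act_def
  by (intro clinear_Sum clinear_comp[OF bilinear_right[OF bilinear_fmult]] clinear_coord)

lemma act_fmult: "act M k (fmult w x) = fmult (act M k w) x"
  by (simp add: act_def coord_fmult fmult_mult fmult_simps)

lemma act_form: "act M k (form x) = M k x"
  unfolding act_def by (rule sum_coord)

lemma act_act: "act M k (act M l w) = (\<Sum>x\<in>UNIV. fmult (act M k (M l x)) (coord x w))"
  unfolding act_def[of M l] by (simp add: clinear_sum[OF clinear_act] act_fmult)

end

text \<open>A finite list of conditions on the table M. \<open>rels\<close> and
  \<open>diff_rels\<close> let the left action and the differential respect the matrix relations.
  \<open>cubes\<close> and \<open>diff_cubes\<close> serve to invert the determinant; the latter
  says that the differential of each cube vanishes. In \<open>M_covariant\<close> the exponent
  \<open>dg l'\<close> comes from \<open>cof\<close>, and \<open>dg r * dg l'\<close> from moving r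
  past l'.\<close>

locale calculus_data = GLq2 +
  fixes M :: "gen \<Rightarrow> gen \<Rightarrow> 'a forms"
  assumes rels:
      "act M Gen_a (M Gen_b x) = act M Gen_b (M Gen_a x)"
      "act M Gen_a (M Gen_c x) = q *\<^sub>C act M Gen_c (M Gen_a x)"
      "act M Gen_b (M Gen_c x) = act M Gen_c (M Gen_b x)"
      "act M Gen_d (M Gen_c x) = q\<^sup>2 *\<^sub>C act M Gen_c (M Gen_d x)"
      "act M Gen_b (M Gen_d x) = act M Gen_d (M Gen_b x)"
      "act M Gen_a (M Gen_d x) = act M Gen_d (M Gen_a x) + (q - 1) *\<^sub>C act M Gen_b (M Gen_c x)"
    and diff_rels:
      "diff2 M Gen_a Gen_b = diff2 M Gen_b Gen_a"
      "diff2 M Gen_a Gen_c = q *\<^sub>C diff2 M Gen_c Gen_a"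
      "diff2 M Gen_b Gen_c = diff2 M Gen_c Gen_b"
      "diff2 M Gen_d Gen_c = q\<^sup>2 *\<^sub>C diff2 M Gen_c Gen_d"
      "diff2 M Gen_b Gen_d = diff2 M Gen_d Gen_b"
      "diff2 M Gen_a Gen_d = diff2 M Gen_d Gen_a + (q - 1) *\<^sub>C diff2 M Gen_b Gen_c"
    and cubes: "act M k (act M k (M k x)) = fmult (form x) (gl k * (gl k * gl k))"
    and diff_cubes: "fmult (form k) (gl k * gl k) + q ^ dg k *\<^sub>C act M k (diff2 M k k) = 0"
    and M_grade: "M k x \<in> eigengrade \<sigma> (dg k + dg x + 1)"
    and M_covariant: "\<Delta>L (M k x) = (\<Sum>(l, r)\<leftarrow>parts k. \<Sum>(l', r')\<leftarrow>parts x.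
      q ^ (dg l' + dg r * dg l') *\<^sub>C ((gl l * gl l') \<otimes> M r r'))"
begin

text \<open>The first component is \<open>\<tau> x \<cdot> w + dx \<cdot> h\<close> for \<open>x = gl k\<close>, since \<open>\<tau> x = q ^ dg k *\<^sub>C x\<close>.\<close>

definition op :: "gen \<Rightarrow> 'a forms \<times> 'a \<Rightarrow> 'a forms \<times> 'a"
  where "op k v = (q ^ dg k *\<^sub>C act M k (fst v) + fmult (form k) (snd v), gl k * snd v)"

definition vmult :: "'a \<Rightarrow> 'a forms \<times> 'a \<Rightarrow> 'a forms \<times> 'a"
  where "vmult x v = (fmult (fst v) x, snd v * x)"

lemma clinear_op: "clinear (op k)"
  by (rule clinearI)
    (simp_all add: op_def clinear_simps[OF clinear_act] fmult_simps scaleC_add_right scaleC_scaleC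
      scaleC_Pair distrib_left scaleC_mult_right mult.commute fst_snd_scaleC algebra_simps)

lemma clinear_vmult: "clinear (vmult x)"
  by (rule clinearI)
    (simp_all add: vmult_def fmult_simps fst_snd_scaleC scaleC_Pair distrib_right scaleC_mult_left)

lemma vmult_vmult: "vmult x (vmult y v) = vmult (y * x) v"
  by (simp add: vmult_def fmult_mult mult.assoc)

lemma op_vmult: "op k (vmult x v) = vmult x (op k v)"
  by (simp add: op_def vmult_def act_fmult fmult_simps fmult_mult mult.assoc)

lemma op_op:
  "op k (op l v) = (q ^ (dg k + dg l) *\<^sub>C act M k (act M l (fst v)) + fmult (diff2 M k l) (snd v),
    gl k * (gl l * snd v))"
  by (simp add: op_def diff2_def clinear_simps[OF clinear_act] act_fmult act_form fmult_simps fmult_mult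
      scaleC_add_right scaleC_scaleC power_add add_ac)

lemma act_rels:
  "act M Gen_a (act M Gen_b w) = act M Gen_b (act M Gen_a w)"
  "act M Gen_a (act M Gen_c w) = q *\<^sub>C act M Gen_c (act M Gen_a w)"
  "act M Gen_b (act M Gen_c w) = act M Gen_c (act M Gen_b w)"
  "act M Gen_d (act M Gen_c w) = q\<^sup>2 *\<^sub>C act M Gen_c (act M Gen_d w)"
  "act M Gen_b (act M Gen_d w) = act M Gen_d (act M Gen_b w)"
  "act M Gen_a (act M Gen_d w) = act M Gen_d (act M Gen_a w) + (q - 1) *\<^sub>C act M Gen_b (act M Gen_c w)"
  unfolding act_act rels by (simp_all add: fmult_simps complex_space.scale_sum_right sum.distrib)

lemma op_rels:
  "op Gen_a (op Gen_b v) = op Gen_b (op Gen_a v)"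
  "op Gen_a (op Gen_c v) = q *\<^sub>C op Gen_c (op Gen_a v)"
  "op Gen_b (op Gen_c v) = op Gen_c (op Gen_b v)"
  "op Gen_d (op Gen_c v) = q\<^sup>2 *\<^sub>C op Gen_c (op Gen_d v)"
  "op Gen_b (op Gen_d v) = op Gen_d (op Gen_b v)"
  "op Gen_a (op Gen_d v) = op Gen_d (op Gen_a v) + (q - 1) *\<^sub>C op Gen_b (op Gen_c v)"
  unfolding op_op act_rels diff_rels mult.assoc[symmetric]
  using Mq2_relations_g
  by (simp_all add: Mq2_relations_def Let_def scaleC_Pair fmult_simps scaleC_mult_left scaleC_scaleC
      scaleC_add_right distrib_right q3 q_cube power2_eq_square scaleC_one mult.commute)

text \<open>The off-diagonal block of the cube is the differential of the cube of
  \<open>gl k\<close>, which vanishes. On the diagonal the powers of q multiply to 1, and centrality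
  turns left into right multiplication.\<close>

lemma op_cube: "op k (op k (op k v)) = vmult (gl k * (gl k * gl k)) v"
proof -
  have "act M k (act M k (act M k w)) = fmult w (gl k * (gl k * gl k))" for w
  proof (rule forms_ext[of "\<lambda>w. act M k (act M k (act M k w))" "\<lambda>w. fmult w (gl k * (gl k * gl k))"])
    fix x y
    show "act M k (act M k (act M k (fmult (form x) y))) = fmult (fmult (form x) y) (gl k * (gl k * gl k))"
      by (simp only: act_fmult act_form cubes flip: fmult_mult)
        (simp only: cube_central)
  qed (intro clinear_comp[OF clinear_act] clinear_act bilinear_left[OF bilinear_fmult])+
  moreover have "q ^ dg k *\<^sub>C q ^ (dg k + dg k) *\<^sub>C w = w" for w :: "'a forms"
  proof -
    have "dg k + (dg k + dg k) = dg k * 3" by simp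
    then show ?thesis by (simp only: scaleC_scaleC scaleC_one q_powers(4) flip: power_add)
  qed
  moreover have "q ^ dg k *\<^sub>C act M k (fmult (diff2 M k k) x) + fmult (form k) (gl k * (gl k * x)) = 0" for x
    using arg_cong[OF diff_cubes[of k], of "\<lambda>w. fmult w x"]
    by (simp add: fmult_simps act_fmult add.commute mult.assoc flip: fmult_mult)
  moreover have "gl k * (gl k * (gl k * x)) = x * (gl k * (gl k * gl k))" for x
    using cube_central[of k x] by (simp add: mult.assoc)
  ultimately show ?thesis
    by (simp add: op_op op_def[of k "(_, _)"] vmult_def clinear_simps[OF clinear_act] scaleC_add_right add.assoc
        del: complex_space.scale_scale)
qed

text \<open>The cubes appear in reversed order because composing right multiplications reverses
  their factors, see \<open>vmult_vmult\<close>.\<close>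

lemma qdet_cube: "qdet * (qdet * qdet) = gl Gen_d * (gl Gen_d * gl Gen_d) * (gl Gen_a * (gl Gen_a * gl Gen_a))
    - gl Gen_c * (gl Gen_c * gl Gen_c) * (gl Gen_b * (gl Gen_b * gl Gen_b))"
  using cube_central[of Gen_d "gl Gen_a * (gl Gen_a * gl Gen_a)"]
    cube_central[of Gen_c "gl Gen_b * (gl Gen_b * gl Gen_b)"]
  unfolding qdet_relations(5)[OF Mq2_relations_g] by (simp add: mult.assoc)

lemma ex_module:
  "\<exists>\<Phi>. left_module \<Phi> \<and> (\<forall>k. \<Phi> (gl k) = op k)"
proof -
  define X where "X k = Cend (op k)" for k
  define R where "R x = Cend (vmult x)" for x
  have X: "apply_cend (X k) = op k" and R: "apply_cend (R x) = vmult x" for k x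
    by (simp_all add: X_def R_def apply_Cend clinear_op clinear_vmult)
  define D where "D = X Gen_a * X Gen_d - q *\<^sub>C (X Gen_b * X Gen_c)"
  \<comment> \<open>S will be the inverse of the cube of D. It commutes with every operator X k,
    which makes \<open>D * (D * S)\<close> a two-sided inverse of D.\<close>
  define S where "S = R (gt * (gt * gt))"
  define h where "h l = (case l of Gen k \<Rightarrow> X k | Inv \<Rightarrow> D * (D * S))" for l
  have M: "Mq2_relations q h"
    unfolding Mq2_relations_def Let_def h_def letter.case
    by (intro conjI cend_eqI) (simp_all only: apply_cend_simps apply_cend_mult X op_rels)
  note D_rel = qdet_relations[OF M, unfolded h_def letter.case, folded D_def]
  have XS: "X k * S = S * X k" for k
    by (rule cend_eqI) (simp add: apply_cend_mult X R S_def op_vmult)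
  have "X k * (S * T) = S * (X k * T)" for k T
    by (simp add: XS flip: mult.assoc)
  note XS' = this XS
  have DS: "D * S = S * D"
    unfolding D_def left_diff_distrib right_diff_distrib scaleC_mult_left scaleC_mult_right mult.assoc XS' ..
  have DS': "D * (S * T) = S * (D * T)" for T
    by (simp add: DS flip: mult.assoc)
  have "D * (D * D) = R (qdet * (qdet * qdet))"
    unfolding D_rel(5) qdet_cube
    by (rule cend_eqI)
      (simp add: apply_cend_simps apply_cend_mult X R op_cube vmult_vmult mult.assoc,
        simp add: vmult_def fmult_simps right_diff_distrib)
  moreover have "qdet * (qdet * qdet) * (gt * (gt * gt)) = 1"
  proof -
    have "qdet * (gt * x) = x" for x
      using qdet_inverse(2) by (simp flip: mult.assoc)
    then show ?thesis by (simp only: mult.assoc qdet_inverse)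
  qed
  ultimately have "S * (D * (D * D)) = 1"
    by (intro cend_eqI) (simp add: apply_cend_mult R S_def vmult_vmult, simp add: vmult_def fmult_one)
  then have "D * (D * S) * D = 1"
    by (simp add: mult.assoc DS DS')
  moreover have "D * (D * S) * X k = X k * (D * (D * S))" for k
  proof -
    have "D * X k = X k * D" using D_rel(1-4) by (cases k) auto
    moreover from this have "D * (X k * T) = X k * (D * T)" for T
      by (simp flip: mult.assoc)
    ultimately show ?thesis by (simp add: mult.assoc DS DS' XS')
  qed
  ultimately have "GLq2_relations q h"
    using M by (simp add: GLq2_relations_def h_def flip: D_def)
  from hom_exists[OF this] obtain \<Phi> where \<Phi>: "algebra_hom \<Phi>" "\<And>l. \<Phi> (g l) = h l"
    by blast
  have "left_module (\<lambda>x. apply_cend (\<Phi> x))"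
    unfolding left_module_def
  proof (intro conjI allI bilinearI)
  qed (use \<Phi>(1) in \<open>simp_all add: algebra_hom_def apply_cend_mult apply_cend_simps clinear_simps
      clinear_apply_cend\<close>)
  moreover have "apply_cend (\<Phi> (gl k)) = op k" for k
    by (simp add: \<Phi>(2) h_def X)
  ultimately show ?thesis by (intro exI[of _ "\<lambda>x. apply_cend (\<Phi> x)"]) simp
qed

section \<open>Blocks of the representation: left action and differential\<close>

definition \<Phi> :: "'a \<Rightarrow> 'a forms \<times> 'a \<Rightarrow> 'a forms \<times> 'a"
  where "\<Phi> = (SOME \<Phi>. left_module \<Phi> \<and> (\<forall>k. \<Phi> (gl k) = op k))"

lemma module: "left_module \<Phi>" and module_gl: "\<Phi> (gl k) = op k"
  using someI_ex[OF ex_module] unfolding \<Phi>_def by blast+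

lemma bilinear_module: "bilinear \<Phi>" and module_one: "\<Phi> 1 v = v"
  and module_mult: "\<Phi> (x * y) v = \<Phi> x (\<Phi> y v)"
  using module unfolding left_module_def by blast+

lemmas module_simps = bilinear_simps[OF bilinear_module]

lemma module_vmult: "\<Phi> x (vmult y v) = vmult y (\<Phi> x v)"
  by (rule intertwine[OF module module clinear_vmult, symmetric]) (simp add: module_gl op_vmult)

text \<open>The second projection intertwines the representation with left multiplication on the
  algebra. Hence all its operators are block triangular.\<close>

lemma snd_module: "snd (\<Phi> x v) = x * snd v"
proof (rule intertwine[OF module, where \<psi> = snd and \<rho>' = "(*)"])
  show "left_module ((*) :: 'a \<Rightarrow> 'a \<Rightarrow> 'a)"
    by (simp add: left_module_def bilinear_times mult.assoc)
  show "clinear (snd :: 'a forms \<times> 'a \<Rightarrow> 'a)" by (rule clinearI) (simp_all add: fst_snd_scaleC)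
qed (simp add: module_gl op_def)

definition tact :: "'a \<Rightarrow> 'a forms \<Rightarrow> 'a forms"
  where "tact x w = fst (\<Phi> x (w, 0))"

text \<open>The diagonal block \<open>tact\<close> is the action of \<tau>(x). Since the cube of
  \<tau> is the identity, two further applications of \<tau> undo this twist.\<close>

definition lmul :: "'a \<Rightarrow> 'a forms \<Rightarrow> 'a forms"
  where "lmul x = tact (\<tau> (\<tau> x))"

definition d :: "'a \<Rightarrow> 'a forms"
  where "d x = fst (\<Phi> x (0, 1))"

lemma module_tact: "\<Phi> x (w, 0) = (tact x w, 0)"
  using snd_module[of x "(w, 0)"] by (simp add: tact_def prod_eq_iff)

lemma module_eq: "\<Phi> x (w, h) = (tact x w + fmult (d x) h, x * h)"
proof -
  have "\<Phi> x (w, h) = \<Phi> x (w, 0) + \<Phi> x (vmult h (0, 1))"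
    by (simp add: vmult_def fmult_simps flip: module_simps)
  moreover have "\<Phi> x (0, 1) = (d x, x)"
    using snd_module[of x "(0, 1)"] by (simp add: d_def prod_eq_iff)
  ultimately show ?thesis
    by (simp add: module_tact module_vmult) (simp add: vmult_def)
qed

lemma clinear_d: "clinear d"
  by (rule clinearI) (simp_all add: d_def module_simps fst_snd_scaleC)

lemma bilinear_tact: "bilinear tact"
proof (rule bilinearI)
  fix x c v w
  have "\<Phi> x ((v, 0) + (w, 0)) = \<Phi> x (v, 0) + \<Phi> x (w, 0)" "\<Phi> x (c *\<^sub>C (w, 0)) = c *\<^sub>C \<Phi> x (w, 0)"
    by (simp_all only: module_simps)
  then show "tact x (v + w) = tact x v + tact x w" "tact x (c *\<^sub>C w) = c *\<^sub>C tact x w"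
    by (simp_all add: module_tact scaleC_Pair)
qed (simp_all add: tact_def module_simps fst_snd_scaleC)

lemma tact_module: "tact 1 w = w" "tact (x * y) w = tact x (tact y w)"
    "tact x (fmult w y) = fmult (tact x w) y"
  using module_one[of "(w, 0)"] module_mult[of x y "(w, 0)"] module_vmult[of x y "(w, 0)"]
  by (simp_all add: module_tact vmult_def)

text \<open>This is the off-diagonal block of a product of two triangular operators.\<close>

lemma d_mult: "d (x * y) = tact x (d y) + fmult (d x) y"
  using module_mult[of x y "(0, 1)"]
  by (simp add: module_eq bilinear_simps[OF bilinear_tact] fmult_one)

lemma d_gl: "d (gl k) = form k"
  by (simp add: d_def module_gl op_def clinear_simps[OF clinear_act] fmult_one)

lemma d_one: "d 1 = 0"
  by (simp add: d_def module_one)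

lemma tau3: "\<tau> (\<tau> (\<tau> x)) = x"
  using Z3_operator_tau by (simp add: Z3_operator_def)

lemma lmul_tau: "lmul (\<tau> x) = tact x"
  by (simp add: lmul_def tau3)

lemma bilinear_lmul: "bilinear lmul"
  unfolding lmul_def[abs_def]
  using bilinear_comp[OF bilinear_tact clinear_id(2) clinear_comp[OF tau(1) tau(1)] clinear_id(2)] .

lemma lmul_module: "lmul 1 w = w" "lmul (x * y) w = lmul x (lmul y w)"
    "lmul x (fmult w y) = fmult (lmul x w) y"
  by (simp_all add: lmul_def tau tact_module)

lemma lmul_gl: "lmul (gl k) w = act M k w"
proof -
  have "q ^ dg k * (q ^ dg k * q ^ dg k) = 1"
    using q_powers(4)[of "dg k"] by (simp add: power_mult power3_eq_cube mult.assoc)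
  moreover have "tact (gl k) w = q ^ dg k *\<^sub>C act M k w"
    by (simp add: tact_def module_gl op_def fmult_simps)
  ultimately show ?thesis
    by (simp only: lmul_def tau clinear_simps[OF tau(1)] bilinear_simps[OF bilinear_tact]
        scaleC_scaleC scaleC_one mult.assoc)
qed

lemma sigma_module: "\<sigma> (tact x w) = tact (\<tau> x) (\<sigma> w)" "\<sigma> (d x) = q *\<^sub>C d (\<tau> x)"
proof -
  \<comment> \<open>The extra factor q shifts the degrees of the algebra summand by one, so that the
    differential, of degree 1, becomes degree preserving.\<close>
  define \<psi> where "\<psi> v = (\<sigma> (fst v), q *\<^sub>C \<tau> (snd v))" for v
  have \<psi>: "clinear \<psi>"
    by (rule clinearI)
      (simp_all add: \<psi>_def clinear_simps[OF clinear_sigma] clinear_simps[OF tau(1)] fst_snd_scaleC scaleC_Pair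
        scaleC_add_right scaleC_scaleC mult.commute)
  have *: "\<psi> (\<Phi> x v) = \<Phi> (\<tau> x) (\<psi> v)" for x v
  proof (rule intertwine[OF module _ \<psi>, of "\<lambda>x. \<Phi> (\<tau> x)"])
    show "left_module (\<lambda>x. \<Phi> (\<tau> x))"
      using bilinear_comp[OF bilinear_module clinear_id(2) tau(1) clinear_id(2)]
      by (simp add: left_module_def tau module_one module_mult)
    fix k v
    have "\<sigma> (act M k w) = q ^ dg k *\<^sub>C act M k (\<sigma> w)" for w
    proof (rule forms_ext[of "\<lambda>w. \<sigma> (act M k w)" "\<lambda>w. q ^ dg k *\<^sub>C act M k (\<sigma> w)"])
      fix x y
      have "\<sigma> (M k x) = q ^ (dg k + dg x + 1) *\<^sub>C M k x"
        using M_grade by (simp add: eigengrade_def)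
      then show "\<sigma> (act M k (fmult (form x) y)) = q ^ dg k *\<^sub>C act M k (\<sigma> (fmult (form x) y))"
        by (simp add: act_fmult act_form sigma_fmult sigma_form fmult_simps clinear_simps[OF clinear_act]
            scaleC_scaleC power_add mult_ac)
    qed (intro clinear_comp[OF clinear_sigma clinear_act] clinear_scaleC clinear_comp[OF clinear_act]
        clinear_sigma)+
    then show "\<psi> (\<Phi> (gl k) v) = \<Phi> (\<tau> (gl k)) (\<psi> v)"
      by (simp add: \<psi>_def tau module_simps module_gl op_def clinear_simps[OF clinear_sigma]
          clinear_simps[OF tau(1)] sigma_fmult sigma_form fmult_simps scaleC_Pair scaleC_add_right
          scaleC_scaleC scaleC_mult_left scaleC_mult_right mult_ac)
  qed
  show "\<sigma> (tact x w) = tact (\<tau> x) (\<sigma> w)"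
    using *[of x "(w, 0)"] by (simp add: module_tact \<psi>_def clinear_simps[OF tau(1)])
  show "\<sigma> (d x) = q *\<^sub>C d (\<tau> x)"
    using *[of x "(0, 1)"]
    by (simp add: module_eq \<psi>_def fmult_simps fmult_one bilinear_simps[OF bilinear_tact] tau(2)
        clinear_simps[OF clinear_sigma])
qed

lemma graded_lmul: "graded_bilinear \<tau> \<sigma> \<sigma> lmul"
  by (simp add: graded_bilinear_def Z3_operator_tau Z3_operator_sigma bilinear_lmul lmul_def sigma_module)

lemma d_eigengrade: "x \<in> eigengrade \<tau> i \<Longrightarrow> d x \<in> eigengrade \<sigma> (i + 1)"
  by (simp add: eigengrade_def sigma_module clinear_simps[OF clinear_d] scaleC_scaleC)

section \<open>Covariance of the left action and of the differential\<close>

abbreviation lmult (infixr "\<diamondop>" 76)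
  where "u \<diamondop> v \<equiv> gmult \<tau> \<tau> (*) lmul u v"

lemmas bilinear_lmult = bilinear_gmult[OF Z3_operator_tau Z3_operator_tau bilinear_times bilinear_lmul]
lemmas lmult_simps = bilinear_simps[OF bilinear_lmult]
lemmas lmult_tens = gmult_tens[OF Z3_operator_tau Z3_operator_tau bilinear_times bilinear_lmul]

lemma lmult_assoc: "(u \<bullet> v) \<diamondop> w = u \<diamondop> (v \<diamondop> w)"
  by (rule gmult_assoc)
    (simp_all add: graded_times bilinear_times bilinear_lmul mult.assoc lmul_module)

lemma lmult_rmult_assoc: "(u \<diamondop> w) \<star> v = u \<diamondop> (w \<star> v)"
  by (rule gmult_assoc)
    (simp_all add: graded_times graded_lmul bilinear_times bilinear_lmul bilinear_fmult mult.assoc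
      lmul_module)

lemma lmult_one: "(1 \<otimes> 1) \<diamondop> w = w"
  by (induct w rule: tensor_eigen_induct[OF Z3_operator_tau Z3_operator_sigma])
    (simp_all add: lmult_simps lmult_tens[OF one_in_eigengrade] scaleC_one lmul_module)

lemma coproduct_left_module: "left_module (\<lambda>x u. \<Delta> x \<diamondop> u)"
  using bilinear_comp[OF bilinear_lmult clinear_id(2) coprod(1) clinear_id(2)]
  by (simp add: left_module_def coprod lmult_one lmult_assoc)

text \<open>The coaction is an intertwiner between two left modules, so only generators need
  checking; compatibility with right multiplication then reduces w to basis forms, where
  \<open>M_covariant\<close> is the claim.\<close>

lemma coaction_lmul: "\<Delta>L (lmul x w) = \<Delta> x \<diamondop> \<Delta>L w"
proof (rule intertwine[OF _ coproduct_left_module clinear_coaction])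
  show "left_module lmul" by (simp add: left_module_def bilinear_lmul lmul_module)
  fix k w
  show "\<Delta>L (lmul (gl k) w) = \<Delta> (gl k) \<diamondop> \<Delta>L w"
  proof (rule forms_ext[of "\<lambda>w. \<Delta>L (lmul (gl k) w)" "\<lambda>w. \<Delta> (gl k) \<diamondop> \<Delta>L w"])
    fix x y
    have t: "(X \<otimes> gl r) \<diamondop> (gl l' \<otimes> form r') = q ^ (dg r * dg l') *\<^sub>C ((X * gl l') \<otimes> M r r')" for X r l' r'
      by (simp add: lmult_tens[OF letter_in_eigengrade letter_in_eigengrade] lmul_gl act_form)
    have "cop (Gen k) \<diamondop> cof x = \<Delta>L (M k x)"
      unfolding M_covariant cop_parts cof_def
      by (cases k; cases x)
        (simp_all add: t lmult_simps scaleC_add_right scaleC_scaleC power_add add_ac mult.commute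
          power2_eq_square)
    then show "\<Delta>L (lmul (gl k) (fmult (form x) y)) = \<Delta> (gl k) \<diamondop> \<Delta>L (fmult (form x) y)"
      by (simp add: lmul_module lmul_gl act_form coaction_fmult coaction_form coprod lmult_rmult_assoc[symmetric])
  qed (intro clinear_comp[OF clinear_coaction] clinear_comp[OF bilinear_right[OF bilinear_lmult]]
      clinear_coaction bilinear_right[OF bilinear_lmul])+
qed

lemma clinear_tensor_d: "clinear (tensor_map \<tau> d)"
  by (intro clinear_tensor_map tau clinear_d)

text \<open>This is where \<tau> in the first factor is needed. The form \<open>d y1\<close> has
  degree one more than \<open>y1\<close>, so moving it past \<open>x2\<close> costs an additional
  \<open>q ^ i2\<close>, exactly the factor by which \<tau> multiplies \<open>x2\<close>.\<close>

lemma tensor_d_mult: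
  "tensor_map \<tau> d (u \<bullet> v) = tensor_map \<tau> \<tau> u \<diamondop> tensor_map \<tau> d v + tensor_map \<tau> d u \<star> v"
proof -
  note s = clinear_simps[OF clinear_tensor_d] clinear_simps[OF clinear_tensor_map[OF tau(1) tau(1)]]
    tmult_simps lmult_simps rmult_simps
  have Z: "Z3_operator \<tau>" by (rule Z3_operator_tau)
  show ?thesis
  proof (induct u rule: tensor_eigen_induct[OF Z Z])
    case (2 i1 j1 x1 y1)
    note 1 = this
    show ?case
    proof (induct v rule: tensor_eigen_induct[OF Z Z])
      case (2 i2 j2 x2 y2)
      have "\<tau> x2 \<in> eigengrade \<tau> i2" "\<tau> y1 \<in> eigengrade \<tau> j1" "d y1 \<in> eigengrade \<sigma> (j1 + 1)"
        using 1 2 d_eigengrade[of y1 j1] by (simp_all add: eigengrade_def clinear_simps[OF tau(1)])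
      moreover have "\<tau> x2 = q ^ i2 *\<^sub>C x2" using 2 by (simp add: eigengrade_def)
      ultimately show ?case
        using 1 2
        by (simp add: s tensor_map_tens tau(1) clinear_d tmult_tens lmult_tens rmult_tens d_mult tau(3)
            lmul_tau tens_simps scaleC_add_right scaleC_scaleC scaleC_mult_right power_add mult_ac)
    qed (simp_all add: s scaleC_add_right add_ac)
  qed (simp_all add: s add_ac)
qed

text \<open>The difference E of the two sides obeys a twisted Leibniz rule and vanishes at the
  generators, hence at \<open>qdet\<close>. Applied to \<open>qdet * gt = 1\<close>, the rule also
  gives E gt = 0, since the coproduct of \<open>qdet\<close> is invertible.\<close>

lemma coaction_d: "\<Delta>L (d x) = tensor_map \<tau> d (\<Delta> x)"
proof -
  define E where "E x = \<Delta>L (d x) - tensor_map \<tau> d (\<Delta> x)" for x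
  have E: "clinear E"
    unfolding E_def[abs_def]
    by (rule clinearI)
      (simp_all add: clinear_simps[OF clinear_coaction] clinear_simps[OF clinear_d]
        clinear_simps[OF clinear_tensor_d] coprod_simps scaleC_simps)
  have mult: "E (x * y) = \<Delta> (\<tau> x) \<diamondop> E y + E x \<star> \<Delta> y" for x y
    by (simp add: E_def d_mult clinear_simps[OF clinear_coaction] coaction_fmult coprod tensor_d_mult
        lmult_simps rmult_simps coprod_tau algebra_simps flip: coprod_tau lmul_tau coaction_lmul)
  have one: "E 1 = 0"
    by (simp add: E_def d_one clinear_simps[OF clinear_coaction] coprod tensor_map_tens tau clinear_d
        tens_simps)
  have gl: "E (gl k) = 0" for k
    by (cases k)
      (simp_all add: E_def d_gl coaction_form cof_def coprod clinear_simps[OF clinear_tensor_d]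
        tensor_map_tens tau clinear_d tens_simps scaleC_one)
  have qdet: "E qdet = 0"
    by (simp add: clinear_simps[OF E] mult gl lmult_simps rmult_simps)
  have "\<tau> qdet = qdet"
    using qdet_in_eigengrade by (simp add: eigengrade_def scaleC_one)
  then have "\<Delta> qdet \<diamondop> E gt = 0"
    using mult[of qdet gt] by (simp only: qdet qdet_inverse one rmult_simps add_0_right)
  then have "\<Delta> (gt * qdet) \<diamondop> E gt = 0"
    by (simp only: coprod lmult_assoc lmult_simps)
  then have "E gt = 0"
    by (simp only: qdet_inverse coprod lmult_one)
  with gl have letter: "E (g l) = 0" for l by (cases l) auto
  have "E x = 0"
    by (induct x rule: letter_induct)
      (simp_all add: clinear_simps[OF E] mult one letter lmult_simps rmult_simps)
  then show ?thesis by (simp add: E_def)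
qed

section \<open>The calculus obtained from the data\<close>

definition calc :: "('a, 'a forms) calculus"
  where "calc = \<lparr>lact = lmul, ract = fmult, diff = d, grade = eigengrade \<sigma>\<rparr>"

lemma calc_simps: "lact calc = lmul" "ract calc = fmult" "diff calc = d" "grade calc = eigengrade \<sigma>"
  by (simp_all add: calc_def)

lemma grade_twist_eq: "grade_twist q g = \<tau>"
proof
  fix x
  have "grade_twist q g x = (\<Sum>i<3. q ^ i *\<^sub>C eigenproj \<tau> i x)"
    unfolding grade_twist_def
    by (intro sum.cong refl)
      (simp add: component_cong[OF GL_grade_eq] component_eigengrade Z3_operator_tau)
  also have "\<dots> = \<tau> (\<Sum>i<3. eigenproj \<tau> i x)"
    using eigenproj_in_eigengrade[OF Z3_operator_tau]
    by (simp add: clinear_sum[OF tau(1)] eigengrade_def)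
  finally show "grade_twist q g x = \<tau> x" by (simp add: sum_eigenproj)
qed

lemma graded_calculus_calc: "graded_calculus q g calc"
  unfolding graded_calculus_def calc_simps
proof (intro conjI allI impI ballI)
  show "bimodule calc"
    by (simp add: bimodule_def calc_simps bilinear_lmul bilinear_fmult lmul_module fmult_one fmult_mult)
  show "Z3_grading (eigengrade \<sigma>)" by (rule Z3_grading_eigengrade[OF Z3_operator_sigma])
  show "clinear d" by (rule clinear_d)
  show "subbimodule_generated calc (range (\<lambda>x. d (gl x))) = UNIV"
  proof (intro equalityI subsetI UNIV_I)
    fix w
    have "fmult (form k) y \<in> subbimodule_generated calc (range (\<lambda>x. d (gl x)))" for k y
      using subbimodule_generated.act[OF subbimodule_generated.gen[of "form k" "range (\<lambda>x. d (gl x))" calc], of 1 y]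
      by (simp add: calc_simps lmul_module d_gl)
    then have "(\<Sum>k\<in>UNIV. fmult (form k) (coord k w)) \<in> subbimodule_generated calc (range (\<lambda>x. d (gl x)))"
      unfolding sum_gen by (intro subbimodule_generated.add)
    then show "w \<in> subbimodule_generated calc (range (\<lambda>x. d (gl x)))" by (simp add: forms_expand)
  qed
next
  fix i j :: nat and f w assume "i < 3" "j < 3" and f: "f \<in> GL_grade g i" and w: "w \<in> eigengrade \<sigma> j"
  then have f': "f \<in> eigengrade \<tau> i" by (simp add: GL_grade_eq)
  show "lmul f w \<in> eigengrade \<sigma> ((i + j) mod 3)"
    using graded_bilinear_eigen[OF graded_lmul f' w] by (simp add: eigengrade_mod)
  show "fmult w f \<in> eigengrade \<sigma> ((i + j) mod 3)"
    using graded_bilinear_eigen[OF graded_fmult w f'] by (simp add: eigengrade_mod add.commute)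
next
  fix i :: nat and f h assume "i < 3" "f \<in> GL_grade g i"
  then have f: "f \<in> eigengrade \<tau> i" by (simp add: GL_grade_eq)
  show "d f \<in> eigengrade \<sigma> ((i + 1) mod 3)"
    using d_eigengrade[OF f] by (simp only: eigengrade_mod)
  have "lmul (\<tau> f) w = q ^ i *\<^sub>C lmul f w" for w
    using f by (simp add: eigengrade_def bilinear_simps[OF bilinear_lmul])
  then show "d (f * h) = fmult (d f) h + q ^ i *\<^sub>C lmul f (d h)"
    by (simp add: d_mult lmul_tau add.commute)
qed

lemma left_covariant_calc: "left_covariant q g calc"
  unfolding left_covariant_def
proof (intro exI[of _ \<Delta>] exI[of _ \<epsilon>] exI[of _ \<Delta>L] conjI allI)
  show "left_coaction \<Delta> \<epsilon> \<Delta>L"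
    using coaction_counit by (simp add: left_coaction_def coaction_coassociative counit_left_def)
  show "\<Delta>L (ract calc (lact calc f w) h) = graded_mult q (grade calc) (GL_grade g) (*) (ract calc)
      (graded_mult q (GL_grade g) (GL_grade g) (*) (lact calc) (\<Delta> f) (\<Delta>L w)) (\<Delta> h)" for f w h
    by (simp add: calc_simps graded_mult_GL_grade GL_grade_eq coaction_fmult coaction_lmul)
qed (simp_all add: is_coproduct is_counit clinear_coaction calc_simps grade_twist_eq coaction_d)

lemma free_covariant_calculus_calc: "free_covariant_calculus q g calc"
proof -
  have "differentials_right_basis g calc"
    unfolding differentials_right_basis_def calc_simps d_gl
  proof (rule allI, rule ex1I)
    fix w c assume "w = (\<Sum>x\<in>UNIV. fmult (form x) (c x))"
    then have "coord k w = c k" for k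
      by (cases k) (simp_all add: clinear_add[OF clinear_coord] coord_fmult coord_form sum_gen)
    then show "c = (\<lambda>k. coord k w)" by simp
  qed (rule forms_expand[symmetric])
  then show ?thesis
    by (simp add: free_covariant_calculus_def graded_calculus_calc left_covariant_calc)
qed

lemma calc_relation: "lact calc (gl k) (diff calc (gl x)) = M k x"
  by (simp add: calc_simps d_gl lmul_gl act_form)

end

section \<open>The two families of calculi\<close>

context GLq2
begin

fun forms_I :: "complex \<Rightarrow> complex \<Rightarrow> gen \<Rightarrow> gen \<Rightarrow> 'a forms" where
  "forms_I P\<^sub>1 P\<^sub>2 Gen_a Gen_a = P\<^sub>1 *\<^sub>C fmult (form Gen_a) (gl Gen_a)"
| "forms_I P\<^sub>1 P\<^sub>2 Gen_a Gen_b = fmult (form Gen_b) (gl Gen_a)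
      + (q\<^sup>2 * P\<^sub>2 - 1) *\<^sub>C fmult (form Gen_a) (gl Gen_b)"
| "forms_I P\<^sub>1 P\<^sub>2 Gen_a Gen_c = (q\<^sup>2 * inverse P\<^sub>1) *\<^sub>C fmult (form Gen_c) (gl Gen_a)
      + (q * (1 - q * P\<^sub>1)) *\<^sub>C fmult (form Gen_a) (gl Gen_c)"
| "forms_I P\<^sub>1 P\<^sub>2 Gen_a Gen_d = fmult (form Gen_d) (gl Gen_a)
      + (q\<^sup>2 * P\<^sub>2 - 1) *\<^sub>C fmult (form Gen_a) (gl Gen_d)
      + (q - 1) *\<^sub>C fmult (form Gen_b) (gl Gen_c)"
| "forms_I P\<^sub>1 P\<^sub>2 Gen_b Gen_a = P\<^sub>2 *\<^sub>C fmult (form Gen_a) (gl Gen_b)"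
| "forms_I P\<^sub>1 P\<^sub>2 Gen_b Gen_b = P\<^sub>2 *\<^sub>C fmult (form Gen_b) (gl Gen_b)"
| "forms_I P\<^sub>1 P\<^sub>2 Gen_b Gen_c = P\<^sub>2 *\<^sub>C fmult (form Gen_c) (gl Gen_b)"
| "forms_I P\<^sub>1 P\<^sub>2 Gen_b Gen_d = inverse P\<^sub>2 *\<^sub>C fmult (form Gen_d) (gl Gen_b)
      + (q\<^sup>2 * (1 - P\<^sub>2)) *\<^sub>C fmult (form Gen_b) (gl Gen_d)"
| "forms_I P\<^sub>1 P\<^sub>2 Gen_c Gen_a = inverse P\<^sub>1 *\<^sub>C fmult (form Gen_a) (gl Gen_c)
      + (q - P\<^sub>1) *\<^sub>C fmult (form Gen_c) (gl Gen_a)"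
| "forms_I P\<^sub>1 P\<^sub>2 Gen_c Gen_b = (q\<^sup>2) *\<^sub>C fmult (form Gen_b) (gl Gen_c)
      + (q * (P\<^sub>2 - q)) *\<^sub>C fmult (form Gen_c) (gl Gen_b)"
| "forms_I P\<^sub>1 P\<^sub>2 Gen_c Gen_c = (q\<^sup>2 * P\<^sub>1) *\<^sub>C fmult (form Gen_c) (gl Gen_c)"
| "forms_I P\<^sub>1 P\<^sub>2 Gen_c Gen_d = fmult (form Gen_d) (gl Gen_c)
      + (q * (P\<^sub>2 - q)) *\<^sub>C fmult (form Gen_c) (gl Gen_d)"
| "forms_I P\<^sub>1 P\<^sub>2 Gen_d Gen_a = (q\<^sup>2 * P\<^sub>2) *\<^sub>C fmult (form Gen_a) (gl Gen_d)
      + ((q\<^sup>2 - 1) * P\<^sub>2) *\<^sub>C fmult (form Gen_c) (gl Gen_b)"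
| "forms_I P\<^sub>1 P\<^sub>2 Gen_d Gen_b = inverse P\<^sub>2 *\<^sub>C fmult (form Gen_b) (gl Gen_d)
      + (q\<^sup>2 - P\<^sub>2) *\<^sub>C fmult (form Gen_d) (gl Gen_b)"
| "forms_I P\<^sub>1 P\<^sub>2 Gen_d Gen_c = (q * P\<^sub>2) *\<^sub>C fmult (form Gen_c) (gl Gen_d)"
| "forms_I P\<^sub>1 P\<^sub>2 Gen_d Gen_d = (q\<^sup>2 * P\<^sub>2) *\<^sub>C fmult (form Gen_d) (gl Gen_d)"

fun forms_II :: "complex \<Rightarrow> complex \<Rightarrow> gen \<Rightarrow> gen \<Rightarrow> 'a forms" where
  "forms_II P\<^sub>1 P\<^sub>2 Gen_a Gen_a = P\<^sub>1 *\<^sub>C fmult (form Gen_a) (gl Gen_a)"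
| "forms_II P\<^sub>1 P\<^sub>2 Gen_a Gen_b = P\<^sub>1 *\<^sub>C fmult (form Gen_b) (gl Gen_a)"
| "forms_II P\<^sub>1 P\<^sub>2 Gen_a Gen_c = (q\<^sup>2 * inverse P\<^sub>1) *\<^sub>C fmult (form Gen_c) (gl Gen_a)
      + (q * (1 - q * P\<^sub>1)) *\<^sub>C fmult (form Gen_a) (gl Gen_c)"
| "forms_II P\<^sub>1 P\<^sub>2 Gen_a Gen_d = P\<^sub>1 *\<^sub>C fmult (form Gen_d) (gl Gen_a)
      + ((q - 1) * P\<^sub>1) *\<^sub>C fmult (form Gen_b) (gl Gen_c)"
| "forms_II P\<^sub>1 P\<^sub>2 Gen_b Gen_a = q *\<^sub>C fmult (form Gen_a) (gl Gen_b)
      + (q * (P\<^sub>1 - 1)) *\<^sub>C fmult (form Gen_b) (gl Gen_a)"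
| "forms_II P\<^sub>1 P\<^sub>2 Gen_b Gen_b = P\<^sub>2 *\<^sub>C fmult (form Gen_b) (gl Gen_b)"
| "forms_II P\<^sub>1 P\<^sub>2 Gen_b Gen_c = q *\<^sub>C fmult (form Gen_c) (gl Gen_b)
      + (q * (P\<^sub>1 - 1)) *\<^sub>C fmult (form Gen_b) (gl Gen_c)"
| "forms_II P\<^sub>1 P\<^sub>2 Gen_b Gen_d = inverse P\<^sub>2 *\<^sub>C fmult (form Gen_d) (gl Gen_b)
      + (q\<^sup>2 * (1 - P\<^sub>2)) *\<^sub>C fmult (form Gen_b) (gl Gen_d)"
| "forms_II P\<^sub>1 P\<^sub>2 Gen_c Gen_a = inverse P\<^sub>1 *\<^sub>C fmult (form Gen_a) (gl Gen_c)
      + (q - P\<^sub>1) *\<^sub>C fmult (form Gen_c) (gl Gen_a)"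
| "forms_II P\<^sub>1 P\<^sub>2 Gen_c Gen_b = (q\<^sup>2 * P\<^sub>1) *\<^sub>C fmult (form Gen_b) (gl Gen_c)"
| "forms_II P\<^sub>1 P\<^sub>2 Gen_c Gen_c = (q\<^sup>2 * P\<^sub>1) *\<^sub>C fmult (form Gen_c) (gl Gen_c)"
| "forms_II P\<^sub>1 P\<^sub>2 Gen_c Gen_d = P\<^sub>1 *\<^sub>C fmult (form Gen_d) (gl Gen_c)"
| "forms_II P\<^sub>1 P\<^sub>2 Gen_d Gen_a = fmult (form Gen_a) (gl Gen_d)
      + (1 - q) *\<^sub>C fmult (form Gen_c) (gl Gen_b)
      + (P\<^sub>1 - 1) *\<^sub>C fmult (form Gen_d) (gl Gen_a)"
| "forms_II P\<^sub>1 P\<^sub>2 Gen_d Gen_b = inverse P\<^sub>2 *\<^sub>C fmult (form Gen_b) (gl Gen_d)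
      + (q\<^sup>2 - P\<^sub>2) *\<^sub>C fmult (form Gen_d) (gl Gen_b)"
| "forms_II P\<^sub>1 P\<^sub>2 Gen_d Gen_c = (q\<^sup>2) *\<^sub>C fmult (form Gen_c) (gl Gen_d)
      + (P\<^sub>1 - 1) *\<^sub>C fmult (form Gen_d) (gl Gen_c)"
| "forms_II P\<^sub>1 P\<^sub>2 Gen_d Gen_d = (q\<^sup>2 * P\<^sub>2) *\<^sub>C fmult (form Gen_d) (gl Gen_d)"

end

locale GLq2_parameters = GLq2 +
  fixes P\<^sub>1 P\<^sub>2 :: complex
  assumes P1: "P\<^sub>1 \<in> {q, q\<^sup>2}" and P2: "P\<^sub>2 \<in> {1, q\<^sup>2}"
begin

lemma P1_P1: "P\<^sub>1 * P\<^sub>1 = - P\<^sub>1 - 1"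
proof -
  have "P\<^sub>1 = q \<or> P\<^sub>1 = - q - 1" using P1 by (simp add: q2)
  then show ?thesis by (elim disjE; simp only:; simp add: qq algebra_simps)
qed

text \<open>The quadratic equation with roots 1 and \<open>q\<^sup>2\<close>, whose sum is - q and
  whose product is - q - 1.\<close>

lemma P2_P2: "P\<^sub>2 * P\<^sub>2 = q + 1 - q * P\<^sub>2"
proof -
  have "P\<^sub>2 = 1 \<or> P\<^sub>2 = - q - 1" using P2 by (simp add: q2)
  then show ?thesis by (elim disjE; simp only:; simp add: qq algebra_simps)
qed

lemma inverse_P1: "inverse P\<^sub>1 = - P\<^sub>1 - 1"
proof (rule inverse_unique)
  show "P\<^sub>1 * (- P\<^sub>1 - 1) = 1" by (simp add: right_diff_distrib P1_P1)
qed

lemma inverse_P2: "inverse P\<^sub>2 = q + 1 - q * P\<^sub>2"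
proof (rule inverse_unique)
  have "P\<^sub>2 * (P\<^sub>2 * P\<^sub>2) = 1"
    using P2 q_cube q_powers(3) by (auto simp flip: power_add power_Suc power_Suc2)
  then show "P\<^sub>2 * (q + 1 - q * P\<^sub>2) = 1" by (simp only: P2_P2)
qed

text \<open>Scalars are kept as nested actions in the order q, \<open>P\<^sub>1\<close>,
  \<open>P\<^sub>2\<close>, each occurring at most once, with coefficients of monomials reduced by
  the three quadratic equations. Merging nested scalars again would destroy this form, which is why
  \<open>complex_space.scale_scale\<close> is removed wherever it is used.\<close>

lemma scalar_reduce:
  fixes x :: "'v::complex_space"
  shows "q *\<^sub>C q *\<^sub>C x = - x - q *\<^sub>C x"
    "P\<^sub>1 *\<^sub>C P\<^sub>1 *\<^sub>C x = - x - P\<^sub>1 *\<^sub>C x"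
    "P\<^sub>2 *\<^sub>C P\<^sub>2 *\<^sub>C x = q *\<^sub>C x + x - q *\<^sub>C P\<^sub>2 *\<^sub>C x"
    "inverse P\<^sub>1 *\<^sub>C x = - x - P\<^sub>1 *\<^sub>C x"
    "inverse P\<^sub>2 *\<^sub>C x = q *\<^sub>C x + x - q *\<^sub>C P\<^sub>2 *\<^sub>C x"
    "P\<^sub>1 *\<^sub>C q *\<^sub>C x = q *\<^sub>C P\<^sub>1 *\<^sub>C x" "P\<^sub>2 *\<^sub>C q *\<^sub>C x = q *\<^sub>C P\<^sub>2 *\<^sub>C x"
    "P\<^sub>2 *\<^sub>C P\<^sub>1 *\<^sub>C x = P\<^sub>1 *\<^sub>C P\<^sub>2 *\<^sub>C x"
    "(c * c') *\<^sub>C x = c *\<^sub>C c' *\<^sub>C x"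
    "(c + c') *\<^sub>C x = c *\<^sub>C x + c' *\<^sub>C x" "(c - c') *\<^sub>C x = c *\<^sub>C x - c' *\<^sub>C x"
    "(- c) *\<^sub>C x = - (c *\<^sub>C x)"
    "c *\<^sub>C (x + y) = c *\<^sub>C x + c *\<^sub>C y" "c *\<^sub>C (x - y) = c *\<^sub>C x - c *\<^sub>C y"
    "c *\<^sub>C (- x) = - (c *\<^sub>C x)" "1 *\<^sub>C x = x"
  unfolding inverse_P1 inverse_P2
  by (simp_all add: scaleC_scaleC qq P1_P1 P2_P2 scaleC_one mult.commute scaleC_add_left
      scaleC_add_right algebra_simps)

lemmas normalize_forms = clinear_simps[OF clinear_act] act_fmult act_form fmult_mult[symmetric]
  fmult_simps normal_order_g scalar_reduce power2_eq_square q_cube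
  scaleC_mult_left scaleC_mult_right mult.assoc algebra_simps

lemmas eigen_forms = eigengrade_def clinear_simps[OF clinear_sigma] sigma_fmult sigma_form tau(4)
  fmult_simps scalar_reduce power2_eq_square power3_eq_cube numeral_eq_Suc algebra_simps

lemmas covariant_forms = clinear_simps[OF clinear_coaction] coaction_fmult coaction_form cof_def coprod(4)
  rmult_simps rmult_tens[OF form_in_eigengrade letter_in_eigengrade] tens_simps
  normal_order_g scalar_reduce power2_eq_square numeral_eq_Suc algebra_simps

lemma calculus_data_I: "calculus_data q g (forms_I P\<^sub>1 P\<^sub>2)"
proof (intro calculus_data.intro GLq2_axioms calculus_data_axioms.intro)
  let ?M = "forms_I P\<^sub>1 P\<^sub>2"
  fix k x
  show "act ?M Gen_a (?M Gen_b x) = act ?M Gen_b (?M Gen_a x)"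
    "act ?M Gen_a (?M Gen_c x) = q *\<^sub>C act ?M Gen_c (?M Gen_a x)"
    "act ?M Gen_b (?M Gen_c x) = act ?M Gen_c (?M Gen_b x)"
    by (cases x; simp add: normalize_forms del: complex_space.scale_scale)+
  show "act ?M Gen_d (?M Gen_c x) = q\<^sup>2 *\<^sub>C act ?M Gen_c (?M Gen_d x)"
    "act ?M Gen_b (?M Gen_d x) = act ?M Gen_d (?M Gen_b x)"
    "act ?M Gen_a (?M Gen_d x) = act ?M Gen_d (?M Gen_a x) + (q - 1) *\<^sub>C act ?M Gen_b (?M Gen_c x)"
    by (cases x; simp add: normalize_forms del: complex_space.scale_scale)+
  show "diff2 ?M Gen_a Gen_b = diff2 ?M Gen_b Gen_a"
    "diff2 ?M Gen_a Gen_c = q *\<^sub>C diff2 ?M Gen_c Gen_a"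
    "diff2 ?M Gen_b Gen_c = diff2 ?M Gen_c Gen_b"
    "diff2 ?M Gen_d Gen_c = q\<^sup>2 *\<^sub>C diff2 ?M Gen_c Gen_d"
    "diff2 ?M Gen_b Gen_d = diff2 ?M Gen_d Gen_b"
    "diff2 ?M Gen_a Gen_d = diff2 ?M Gen_d Gen_a + (q - 1) *\<^sub>C diff2 ?M Gen_b Gen_c"
    by (simp_all add: diff2_def normalize_forms del: complex_space.scale_scale)
  show "act ?M k (act ?M k (?M k x)) = fmult (form x) (gl k * (gl k * gl k))"
    by (cases k; cases x; simp add: normalize_forms del: complex_space.scale_scale)
  show "fmult (form k) (gl k * gl k) + q ^ dg k *\<^sub>C act ?M k (diff2 ?M k k) = 0"
    by (cases k; simp add: diff2_def normalize_forms del: complex_space.scale_scale)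
  show "?M k x \<in> eigengrade \<sigma> (dg k + dg x + 1)"
    by (cases k; cases x; simp add: eigen_forms del: complex_space.scale_scale)
  show "\<Delta>L (?M k x) = (\<Sum>(l, r)\<leftarrow>parts k. \<Sum>(l', r')\<leftarrow>parts x.
      q ^ (dg l' + dg r * dg l') *\<^sub>C ((gl l * gl l') \<otimes> ?M r r'))"
    by (cases k; cases x; simp add: covariant_forms del: complex_space.scale_scale)
qed

lemma calculus_data_II: "calculus_data q g (forms_II P\<^sub>1 P\<^sub>2)"
proof (intro calculus_data.intro GLq2_axioms calculus_data_axioms.intro)
  let ?M = "forms_II P\<^sub>1 P\<^sub>2"
  fix k x
  show "act ?M Gen_a (?M Gen_b x) = act ?M Gen_b (?M Gen_a x)"
    "act ?M Gen_a (?M Gen_c x) = q *\<^sub>C act ?M Gen_c (?M Gen_a x)"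
    "act ?M Gen_b (?M Gen_c x) = act ?M Gen_c (?M Gen_b x)"
    by (cases x; simp add: normalize_forms del: complex_space.scale_scale)+
  show "act ?M Gen_d (?M Gen_c x) = q\<^sup>2 *\<^sub>C act ?M Gen_c (?M Gen_d x)"
    "act ?M Gen_b (?M Gen_d x) = act ?M Gen_d (?M Gen_b x)"
    "act ?M Gen_a (?M Gen_d x) = act ?M Gen_d (?M Gen_a x) + (q - 1) *\<^sub>C act ?M Gen_b (?M Gen_c x)"
    by (cases x; simp add: normalize_forms del: complex_space.scale_scale)+
  show "diff2 ?M Gen_a Gen_b = diff2 ?M Gen_b Gen_a"
    "diff2 ?M Gen_a Gen_c = q *\<^sub>C diff2 ?M Gen_c Gen_a"
    "diff2 ?M Gen_b Gen_c = diff2 ?M Gen_c Gen_b"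
    "diff2 ?M Gen_d Gen_c = q\<^sup>2 *\<^sub>C diff2 ?M Gen_c Gen_d"
    "diff2 ?M Gen_b Gen_d = diff2 ?M Gen_d Gen_b"
    "diff2 ?M Gen_a Gen_d = diff2 ?M Gen_d Gen_a + (q - 1) *\<^sub>C diff2 ?M Gen_b Gen_c"
    by (simp_all add: diff2_def normalize_forms del: complex_space.scale_scale)
  show "act ?M k (act ?M k (?M k x)) = fmult (form x) (gl k * (gl k * gl k))"
    by (cases k; cases x; simp add: normalize_forms del: complex_space.scale_scale)
  show "fmult (form k) (gl k * gl k) + q ^ dg k *\<^sub>C act ?M k (diff2 ?M k k) = 0"
    by (cases k; simp add: diff2_def normalize_forms del: complex_space.scale_scale)
  show "?M k x \<in> eigengrade \<sigma> (dg k + dg x + 1)"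
    by (cases k; cases x; simp add: eigen_forms del: complex_space.scale_scale)
  show "\<Delta>L (?M k x) = (\<Sum>(l, r)\<leftarrow>parts k. \<Sum>(l', r')\<leftarrow>parts x.
      q ^ (dg l' + dg r * dg l') *\<^sub>C ((gl l * gl l') \<otimes> ?M r r'))"
    by (cases k; cases x; simp add: covariant_forms del: complex_space.scale_scale)
qed

text \<open>The coefficients come from the table \<open>forms_I\<close> and are thus the same in
  every calculus satisfying the relations, as \<open>calculus_unique\<close> requires.\<close>

lemma case_I_relation:
  assumes "case_I q P\<^sub>1 P\<^sub>2 g \<Omega>" "bimodule \<Omega>"
  shows "lact \<Omega> (gl k) (diff \<Omega> (gl x)) = basis_comb \<Omega> (\<lambda>y. coord y (forms_I P\<^sub>1 P\<^sub>2 k x))"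
proof -
  have b: "bilinear (ract \<Omega>)" using assms(2) by (simp add: bimodule_def)
  note c = clinear_simps[OF clinear_coord] coord_fmult coord_form bilinear_simps[OF b] basis_comb_def sum_gen
  show ?thesis
    using assms(1) unfolding case_I_def Let_def by (cases k; cases x) (simp_all add: c add_ac)
qed

lemma case_I_unique:
  fixes \<Omega> :: "('a, 'w::complex_space) calculus" and \<Omega>' :: "('a, 'v::complex_space) calculus"
  assumes "free_covariant_calculus q g \<Omega>" "case_I q P\<^sub>1 P\<^sub>2 g \<Omega>"
    and "free_covariant_calculus q g \<Omega>'" "case_I q P\<^sub>1 P\<^sub>2 g \<Omega>'"
  shows "\<exists>\<phi>. calculus_iso \<Omega> \<Omega>' \<phi>"
proof (rule calculus_unique)
  have "bimodule \<Omega>" "bimodule \<Omega>'"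
    using assms(1,3) by (simp_all add: free_covariant_calculus_def graded_calculus_def)
  then show "\<exists>c. lact \<Omega> (gl k) (diff \<Omega> (gl x)) = basis_comb \<Omega> c \<and>
      lact \<Omega>' (gl k) (diff \<Omega>' (gl x)) = basis_comb \<Omega>' c" for k x
    using case_I_relation[OF assms(2)] case_I_relation[OF assms(4)] by blast
qed (use assms in \<open>simp_all add: free_covariant_calculus_def\<close>)

lemma case_II_relation:
  assumes "case_II q P\<^sub>1 P\<^sub>2 g \<Omega>" "bimodule \<Omega>"
  shows "lact \<Omega> (gl k) (diff \<Omega> (gl x)) = basis_comb \<Omega> (\<lambda>y. coord y (forms_II P\<^sub>1 P\<^sub>2 k x))"
proof -
  have b: "bilinear (ract \<Omega>)" using assms(2) by (simp add: bimodule_def)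
  note c = clinear_simps[OF clinear_coord] coord_fmult coord_form bilinear_simps[OF b] basis_comb_def sum_gen
  show ?thesis
    using assms(1) unfolding case_II_def Let_def by (cases k; cases x) (simp_all add: c add_ac)
qed

lemma case_II_unique:
  fixes \<Omega> :: "('a, 'w::complex_space) calculus" and \<Omega>' :: "('a, 'v::complex_space) calculus"
  assumes "free_covariant_calculus q g \<Omega>" "case_II q P\<^sub>1 P\<^sub>2 g \<Omega>"
    and "free_covariant_calculus q g \<Omega>'" "case_II q P\<^sub>1 P\<^sub>2 g \<Omega>'"
  shows "\<exists>\<phi>. calculus_iso \<Omega> \<Omega>' \<phi>"
proof (rule calculus_unique)
  have "bimodule \<Omega>" "bimodule \<Omega>'"
    using assms(1,3) by (simp_all add: free_covariant_calculus_def graded_calculus_def)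
  then show "\<exists>c. lact \<Omega> (gl k) (diff \<Omega> (gl x)) = basis_comb \<Omega> c \<and>
      lact \<Omega>' (gl k) (diff \<Omega>' (gl x)) = basis_comb \<Omega>' c" for k x
    using case_II_relation[OF assms(2)] case_II_relation[OF assms(4)] by blast
qed (use assms in \<open>simp_all add: free_covariant_calculus_def\<close>)

end

context GLq2_parameters
begin

lemma case_I_exists: "\<exists>\<Omega> :: ('a, 'a forms) calculus. free_covariant_calculus q g \<Omega> \<and> case_I q P\<^sub>1 P\<^sub>2 g \<Omega>"
proof -
  interpret calculus_data q g "forms_I P\<^sub>1 P\<^sub>2" by (rule calculus_data_I)
  have "case_I q P\<^sub>1 P\<^sub>2 g calc"
    unfolding case_I_def Let_def calc_relation by (simp add: calc_simps d_gl)
  then show ?thesis using free_covariant_calculus_calc by blast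
qed

lemma case_II_exists: "\<exists>\<Omega> :: ('a, 'a forms) calculus. free_covariant_calculus q g \<Omega> \<and> case_II q P\<^sub>1 P\<^sub>2 g \<Omega>"
proof -
  interpret calculus_data q g "forms_II P\<^sub>1 P\<^sub>2" by (rule calculus_data_II)
  have "case_II q P\<^sub>1 P\<^sub>2 g calc"
    unfolding case_II_def Let_def calc_relation by (simp add: calc_simps d_gl)
  then show ?thesis using free_covariant_calculus_calc by blast
qed

end

theorem theorem4p5:
  fixes q P\<^sub>1 P\<^sub>2 :: complex
    and g :: "letter \<Rightarrow> 'a::complex_algebra_1"
  assumes "q ^ 3 = 1" and "q \<noteq> 1" and "q\<^sup>2 \<noteq> 1"
    and "is_GLq2 q g"
    and "P\<^sub>1 \<in> {q, q\<^sup>2}" and "P\<^sub>2 \<in> {1, q\<^sup>2}"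
  shows
    "(\<exists>\<Omega> :: ('a, 'a \<times> 'a \<times> 'a \<times> 'a) calculus.
        free_covariant_calculus q g \<Omega> \<and> case_I q P\<^sub>1 P\<^sub>2 g \<Omega>) \<and>
     (\<forall>(\<Omega> :: ('a, 'w::complex_space) calculus) (\<Omega>' :: ('a, 'v::complex_space) calculus).
        free_covariant_calculus q g \<Omega> \<and> case_I q P\<^sub>1 P\<^sub>2 g \<Omega> \<and>
        free_covariant_calculus q g \<Omega>' \<and> case_I q P\<^sub>1 P\<^sub>2 g \<Omega>' \<longrightarrow>
        (\<exists>\<phi>. calculus_iso \<Omega> \<Omega>' \<phi>)) \<and>
     (\<exists>\<Omega> :: ('a, 'a \<times> 'a \<times> 'a \<times> 'a) calculus.
        free_covariant_calculus q g \<Omega> \<and> case_II q P\<^sub>1 P\<^sub>2 g \<Omega>) \<and>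
     (\<forall>(\<Omega> :: ('a, 'w) calculus) (\<Omega>' :: ('a, 'v) calculus).
        free_covariant_calculus q g \<Omega> \<and> case_II q P\<^sub>1 P\<^sub>2 g \<Omega> \<and>
        free_covariant_calculus q g \<Omega>' \<and> case_II q P\<^sub>1 P\<^sub>2 g \<Omega>' \<longrightarrow>
        (\<exists>\<phi>. calculus_iso \<Omega> \<Omega>' \<phi>))"
proof -
  interpret GLq2_parameters q g P\<^sub>1 P\<^sub>2
    using assms by unfold_locales
  show ?thesis
    using case_I_exists case_II_exists case_I_unique case_II_unique by blast
qed

end
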